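(* Let $\alpha\in(0,\frac13)$ and let $S(K_\alpha)=(C(K_\alpha),\mathscr H_\alpha,D_\alpha)$ be the direct sum spectral triple of the stretched Sierpinski gasket $K_\alpha$ described in the context. Its spectral dimension $\mathfrak d(K_\alpha)=\inf\{p>0:\mathrm{tr}((I+D_\alpha^2)^{-p/2})<\infty\}$ is equal to $$d_\alpha=\frac{\log 3}{\log 2-\log(1-\alpha)},$$ the Hausdorff dimension of the stretched Sierpinski gasket of parameter $\alpha$.
   Context: **Stretched Sierpinski gasket.** Fix $\alpha\in(0,\frac13)$. Let $p_1=(0,0)$, $p_2=(\frac12,\frac{\sqrt3}2)$, $p_3=(1,0)$, $p_4=\frac{p_2+p_3}2$, $p_5=\frac{p_1+p_3}2$, $p_6=\frac{p_1+p_2}2$; $A_1=A_2=A_3=\frac{1-\alpha}2 I_2$, $A_4=\frac\alpha4\begin{pmatrix}1&-\sqrt3\\-\sqrt3&3\end{pmatrix}$, $A_5=\alpha\begin{pmatrix}1&0\\0&0\end{pmatrix}$, $A_6=\frac\alpha4\begin{pmatrix}1&\sqrt3\\\sqrt3&3\end{pmatrix}$; $F_j(x)=A_j(x-p_j)+p_j$ on $\mathbb R^2$, $j=1,\dots,6$. $K_\alpha$ is the unique nonempty compact set with $K_\alpha=\bigcup_{j=1}^6F_j(K_\alpha)$. For $w=w_1\cdots w_n\in\{1,2,3\}^n$ put $F_w=F_{w_n}\circ\cdots\circ F_{w_1}$, $F_\emptyset=\mathrm{id}$. Let $T$ be the triangle with vertices $p_1,p_2,p_3$. **Edges.** For $n\ge0$,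 $T_n$ is the set of closed segments $[x\to y]$ joining two distinct points $x,y$ of $F_w(\{p_1,p_2,p_3\})$ for some $w\in\{1,2,3\}^n$ (triangle edges). Let $\overline{e_i}=F_{i+3}(T)$, $i=1,2,3$ (closed segments of length $\alpha$), $\mathcal J_0=\emptyset$ and $\mathcal J_n=\bigcup_{m=0}^{n-1}\bigcup_{w\in\{1,2,3\}^m}\{F_w(\overline{e_i}):i=1,2,3\}$ for $n\ge1$ (joining edges). Put $\mathscr E_n=T_n\cup\mathcal J_n$ and enumerate $\mathscr E=\bigcup_{n\ge0}\mathscr E_n=\{\epsilon_1,\epsilon_2,\dots\}$. For each $j$ let $l_j=L(\epsilon_j)$ and let $R^s_j:[0,l_j]\to K_\alpha$ be the arclength (affine) parametrization of $\epsilon_j$. **Spectral triple of a curve.** For a compact Hausdorff space $X$, $\ell>0$ and a continuous injective $R:[0,\ell]\to X$: the algebra is $C(X)$, $\mathscr H_\ell=L^2([-\ell,\ell],(2\ell)^{-1}dm)$ ($m$ = Lebesgue measure), $(\pi_\ell(f)h)(x)=f(R(|x|))h(x)$, and $D_\ell=D+\frac{\pi}{2\ell}I$, where $D$ is the closure of $-i\frac{d}{dx}$ on $\mathrm{span}\{e^{i\pi kx/\ell}:k\in\mathbb Z\}$; so $D_\ell$ has orthonormal eigenbasis $e^{i\pi kx/\ell}$ with eigenvalues $\frac{(2k+1)\pi}{2\ell}$, $k\in\mathbb Z$. **Spectral triple of $K_\alpha$.** $S(K_\alpha)=(C(K_\alpha),\mathscr H_\alpha,D_\alpha)$ with representation $\pi_\alpha$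 is the direct sum over $j\ge1$ of the spectral triples of the curves $R^s_j$ (with $X=K_\alpha$). *)

theory Defs
  imports "HOL-Analysis.Analysis"
begin

subsection \<open>Hilbert spaces of functions\<close>

text \<open>
  A Hilbert space is given by a carrier of complex functions together with a form that is linear
  in the first argument. As usual for L2 spaces, elements are functions rather than classes:
  two functions represent the same vector iff their difference has norm 0.
\<close>

record 'x hilbert =
  hcarrier :: "('x \<Rightarrow> complex) set"
  hinner :: "('x \<Rightarrow> complex) \<Rightarrow> ('x \<Rightarrow> complex) \<Rightarrow> complex"

definition hnorm :: "'x hilbert \<Rightarrow> ('x \<Rightarrow> complex) \<Rightarrow> real" where
  "hnorm H f = sqrt (Re (hinner H f f))"

definition heq :: "'x hilbert \<Rightarrow> ('x \<Rightarrow> complex) \<Rightarrow> ('x \<Rightarrow> complex) \<Rightarrow> bool" where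
  "heq H f g \<longleftrightarrow> hnorm H (\<lambda>x. f x - g x) = 0"

definition L2_space :: "'x measure \<Rightarrow> 'x hilbert" where
  "L2_space M =
     \<lparr> hcarrier = {f \<in> borel_measurable M. integrable M (\<lambda>x. (cmod (f x))\<^sup>2)},
       hinner = (\<lambda>f g. (LINT x|M. f x * cnj (g x))) \<rparr>"

text \<open>The j-th component of a vector \<open>f\<close> of the direct sum is the function \<open>x \<mapsto> f (j, x)\<close>.\<close>

definition hilbert_sum :: "(nat \<Rightarrow> 'x hilbert) \<Rightarrow> (nat \<times> 'x) hilbert" where
  "hilbert_sum H =
     \<lparr> hcarrier = {f. (\<forall>j. (\<lambda>x. f (j, x)) \<in> hcarrier (H j)) \<and>
                      summable (\<lambda>j. (hnorm (H j) (\<lambda>x. f (j, x)))\<^sup>2)},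
       hinner = (\<lambda>f g. \<Sum>j. hinner (H j) (\<lambda>x. f (j, x)) (\<lambda>x. g (j, x))) \<rparr>"

definition orthonormal_basis :: "'x hilbert \<Rightarrow> ('x \<Rightarrow> complex) set \<Rightarrow> bool" where
  "orthonormal_basis H B \<longleftrightarrow>
     B \<subseteq> hcarrier H \<and>
     (\<forall>e\<in>B. \<forall>e'\<in>B. hinner H e e' = (if e = e' then 1 else 0)) \<and>
     (\<forall>h\<in>hcarrier H. (\<forall>e\<in>B. hinner H h e = 0) \<longrightarrow> hnorm H h = 0)"


subsection \<open>Unbounded operators, Borel functional calculus and trace\<close>

text \<open>An operator is its graph, a set of pairs saturated under equality of vectors.\<close>

type_synonym 'x graph = "(('x \<Rightarrow> complex) \<times> ('x \<Rightarrow> complex)) set"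

definition op_closure :: "'x hilbert \<Rightarrow> 'x graph \<Rightarrow> 'x graph" where
  "op_closure H G =
     {(h, g). h \<in> hcarrier H \<and> g \<in> hcarrier H \<and>
        (\<exists>u v. (\<forall>n::nat. (u n, v n) \<in> G) \<and>
               (\<lambda>n. hnorm H (\<lambda>x. u n x - h x)) \<longlonglongrightarrow> 0 \<and>
               (\<lambda>n. hnorm H (\<lambda>x. v n x - g x)) \<longlonglongrightarrow> 0)}"

definition operator_sum :: "(nat \<Rightarrow> 'x hilbert) \<Rightarrow> (nat \<Rightarrow> 'x graph) \<Rightarrow> (nat \<times> 'x) graph" where
  "operator_sum H D =
     {(h, g). h \<in> hcarrier (hilbert_sum H) \<and> g \<in> hcarrier (hilbert_sum H) \<and>
        (\<forall>j. ((\<lambda>x. h (j, x)), (\<lambda>x. g (j, x))) \<in> D j)}"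

definition orthogonal_projection ::
    "'x hilbert \<Rightarrow> (('x \<Rightarrow> complex) \<Rightarrow> ('x \<Rightarrow> complex)) \<Rightarrow> bool" where
  "orthogonal_projection H P \<longleftrightarrow>
     (\<forall>f\<in>hcarrier H. P f \<in> hcarrier H \<and> heq H (P (P f)) (P f)) \<and>
     (\<forall>f\<in>hcarrier H. \<forall>g\<in>hcarrier H. hinner H (P f) g = hinner H f (P g))"

definition projection_valued_measure ::
    "'x hilbert \<Rightarrow> (real set \<Rightarrow> ('x \<Rightarrow> complex) \<Rightarrow> ('x \<Rightarrow> complex)) \<Rightarrow> bool" where
  "projection_valued_measure H E \<longleftrightarrow>
     (\<forall>S\<in>sets borel. orthogonal_projection H (E S)) \<and>
     (\<forall>f\<in>hcarrier H. heq H (E UNIV f) f) \<and>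
     (\<forall>A. range A \<subseteq> sets borel \<longrightarrow> disjoint_family A \<longrightarrow>
        (\<forall>f\<in>hcarrier H. (\<lambda>n::nat. hinner H (E (A n) f) f) sums hinner H (E (\<Union>n. A n) f) f))"

definition scalar_spectral_measure ::
    "'x hilbert \<Rightarrow> (real set \<Rightarrow> ('x \<Rightarrow> complex) \<Rightarrow> ('x \<Rightarrow> complex)) \<Rightarrow>
     ('x \<Rightarrow> complex) \<Rightarrow> real measure" where
  "scalar_spectral_measure H E h =
     measure_of UNIV (sets borel) (\<lambda>S. ennreal (Re (hinner H (E S h) h)))"

text \<open>
  The operator \<open>\<integral> \<phi> dE\<close> on its natural domain of all \<open>h\<close> with
  \<open>\<integral> \<phi>\<^sup>2 d\<langle>E h, h\<rangle> < \<infinity>\<close>. The condition on \<open>g\<close> says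
  \<open>\<langle>g, k\<rangle> = \<integral> \<phi> d\<langle>E h, k\<rangle>\<close> for all \<open>k\<close> in that (dense) domain, the integral
  against the complex measure \<open>\<langle>E h, k\<rangle>\<close> being written out by polarization.
\<close>

definition in_spectral_domain ::
    "'x hilbert \<Rightarrow> (real set \<Rightarrow> ('x \<Rightarrow> complex) \<Rightarrow> ('x \<Rightarrow> complex)) \<Rightarrow> (real \<Rightarrow> real) \<Rightarrow>
     ('x \<Rightarrow> complex) \<Rightarrow> bool" where
  "in_spectral_domain H E \<phi> h \<longleftrightarrow>
     h \<in> hcarrier H \<and> (\<integral>\<^sup>+ t. ennreal ((\<phi> t)\<^sup>2) \<partial>scalar_spectral_measure H E h) < \<infinity>"

definition spectral_integral ::
    "'x hilbert \<Rightarrow> (real set \<Rightarrow> ('x \<Rightarrow> complex) \<Rightarrow> ('x \<Rightarrow> complex)) \<Rightarrow> (real \<Rightarrow> real) \<Rightarrow>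
     'x graph" where
  "spectral_integral H E \<phi> =
     {(h, g). in_spectral_domain H E \<phi> h \<and> g \<in> hcarrier H \<and>
        (\<forall>k. in_spectral_domain H E \<phi> k \<longrightarrow>
           hinner H g k =
             (\<Sum>j<4. \<i> ^ j * of_real
                (LINT t|scalar_spectral_measure H E (\<lambda>x. h x + \<i> ^ j * k x). \<phi> t)) / 4)}"

definition spectral_resolution ::
    "'x hilbert \<Rightarrow> 'x graph \<Rightarrow> (real set \<Rightarrow> ('x \<Rightarrow> complex) \<Rightarrow> ('x \<Rightarrow> complex)) \<Rightarrow> bool" where
  "spectral_resolution H D E \<longleftrightarrow>
     projection_valued_measure H E \<and> D = spectral_integral H E (\<lambda>t. t)"

text \<open>\<open>\<phi>(D)\<close> for self-adjoint \<open>D\<close>; the resolution \<open>E\<close> is unique up to equality of vectors.\<close>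

definition functional_calculus :: "'x hilbert \<Rightarrow> 'x graph \<Rightarrow> (real \<Rightarrow> real) \<Rightarrow> 'x graph" where
  "functional_calculus H D \<phi> = spectral_integral H (SOME E. spectral_resolution H D E) \<phi>"

text \<open>
  Trace of a positive, everywhere defined operator, computed in an arbitrary orthonormal basis
  (the value does not depend on it); the sum takes values in \<open>[0, \<infinity>]\<close>.
\<close>

definition positive_trace :: "'x hilbert \<Rightarrow> 'x graph \<Rightarrow> ennreal" where
  "positive_trace H P =
     (let B = (SOME B. orthonormal_basis H B)
      in \<integral>\<^sup>+ e. ennreal (Re (hinner H (SOME g. (e, g) \<in> P) e)) \<partial>count_space B)"


subsection \<open>Spectral triples\<close>

record ('p, 'x) spectral_triple =
  st_algebra :: "('p \<Rightarrow> complex) set"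
  st_space :: "'x hilbert"
  st_rep :: "('p \<Rightarrow> complex) \<Rightarrow> ('x \<Rightarrow> complex) \<Rightarrow> ('x \<Rightarrow> complex)"
  st_dirac :: "'x graph"

text \<open>The summands are meant to have the same algebra, which the intersection then recovers.\<close>

definition triple_sum :: "(nat \<Rightarrow> ('p, 'x) spectral_triple) \<Rightarrow> ('p, nat \<times> 'x) spectral_triple" where
  "triple_sum S =
     \<lparr> st_algebra = (\<Inter>j. st_algebra (S j)),
       st_space = hilbert_sum (\<lambda>j. st_space (S j)),
       st_rep = (\<lambda>f h (j, x). st_rep (S j) f (\<lambda>y. h (j, y)) x),
       st_dirac = operator_sum (\<lambda>j. st_space (S j)) (\<lambda>j. st_dirac (S j)) \<rparr>"

text \<open>\<open>(I + D\<^sup>2)\<close> to the power \<open>-p/2\<close> is \<open>\<phi>(D)\<close> with \<open>\<phi>(t) = (1 + t\<^sup>2) powr (-p/2)\<close>.\<close>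

definition spectral_dimension :: "('p, 'x) spectral_triple \<Rightarrow> ereal" where
  "spectral_dimension S =
     Inf {ereal p | p. 0 < p \<and>
       positive_trace (st_space S)
         (functional_calculus (st_space S) (st_dirac S) (\<lambda>t. (1 + t\<^sup>2) powr (- p / 2))) < \<infinity>}"

definition curve_space :: "real \<Rightarrow> real hilbert" where
  "curve_space l = L2_space (scale_measure (ennreal (1 / (2 * l))) (lebesgue_on {- l..l}))"

definition trig_poly :: "real \<Rightarrow> (real \<Rightarrow> complex) set" where
  "trig_poly l =
     {\<lambda>x. \<Sum>k\<in>S. c k * exp (\<i> * of_real (pi * of_int k * x / l)) | (S :: int set) c. finite S}"

definition curve_dirac :: "real \<Rightarrow> real graph" where
  "curve_dirac l =
     {(h, \<lambda>x. g x + of_real (pi / (2 * l)) * h x) | h g.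
        (h, g) \<in> op_closure (curve_space l)
                   {(u, \<lambda>x. - \<i> * vector_derivative u (at x)) | u. u \<in> trig_poly l}}"

text \<open>Elements of \<open>C(X)\<close> are represented by extensional functions, i.e. \<open>undefined\<close> off \<open>X\<close>.\<close>

definition curve_triple ::
    "'p::topological_space set \<Rightarrow> real \<Rightarrow> (real \<Rightarrow> 'p) \<Rightarrow> ('p, real) spectral_triple" where
  "curve_triple X l R =
     \<lparr> st_algebra = {f \<in> extensional X. continuous_on X f},
       st_space = curve_space l,
       st_rep = (\<lambda>f h x. f (R \<bar>x\<bar>) * h x),
       st_dirac = curve_dirac l \<rparr>"


subsection \<open>The stretched Sierpinski gasket\<close>

definition gasket_pt :: "nat \<Rightarrow> real^2" where
  "gasket_pt j =
     (let p1 = vector [0, 0]; p2 = vector [1 / 2, sqrt 3 / 2]; p3 = vector [1, 0]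
      in if j = 1 then p1 else if j = 2 then p2 else if j = 3 then p3
         else if j = 4 then (1 / 2) *\<^sub>R (p2 + p3)
         else if j = 5 then (1 / 2) *\<^sub>R (p1 + p3)
         else (1 / 2) *\<^sub>R (p1 + p2))"

definition gasket_mat :: "real \<Rightarrow> nat \<Rightarrow> real^2^2" where
  "gasket_mat \<alpha> j =
     (if j \<in> {1, 2, 3} then ((1 - \<alpha>) / 2) *\<^sub>R mat 1
      else if j = 4 then (\<alpha> / 4) *\<^sub>R vector [vector [1, - sqrt 3], vector [- sqrt 3, 3]]
      else if j = 5 then \<alpha> *\<^sub>R vector [vector [1, 0], vector [0, 0]]
      else (\<alpha> / 4) *\<^sub>R vector [vector [1, sqrt 3], vector [sqrt 3, 3]])"

definition gasket_map :: "real \<Rightarrow> nat \<Rightarrow> real^2 \<Rightarrow> real^2" where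
  "gasket_map \<alpha> j x = gasket_mat \<alpha> j *v (x - gasket_pt j) + gasket_pt j"

definition stretched_gasket :: "real \<Rightarrow> (real^2) set" where
  "stretched_gasket \<alpha> =
     (THE K. compact K \<and> K \<noteq> {} \<and> K = (\<Union>j\<in>{1..6}. gasket_map \<alpha> j ` K))"

definition words :: "nat \<Rightarrow> nat list set" where
  "words n = {w. length w = n \<and> set w \<subseteq> {1, 2, 3}}"

text \<open>The first letter is applied first: \<open>F\<^sub>w = F\<^sub>w\<^sub>n \<circ> \<dots> \<circ> F\<^sub>w\<^sub>1\<close>.\<close>

definition word_map :: "real \<Rightarrow> nat list \<Rightarrow> real^2 \<Rightarrow> real^2" where
  "word_map \<alpha> w = fold (gasket_map \<alpha>) w"

definition base_triangle :: "(real^2) set" where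
  "base_triangle = convex hull {gasket_pt 1, gasket_pt 2, gasket_pt 3}"

definition triangle_edges :: "real \<Rightarrow> nat \<Rightarrow> (real^2) set set" where
  "triangle_edges \<alpha> n =
     {closed_segment x y | x y. x \<noteq> y \<and>
        (\<exists>w\<in>words n. {x, y} \<subseteq> word_map \<alpha> w ` {gasket_pt 1, gasket_pt 2, gasket_pt 3})}"

definition joining_edges :: "real \<Rightarrow> nat \<Rightarrow> (real^2) set set" where
  "joining_edges \<alpha> n =
     (\<Union>m<n. \<Union>w\<in>words m.
        {word_map \<alpha> w ` (gasket_map \<alpha> (i + 3) ` base_triangle) | i. i \<in> {1, 2, 3}})"

definition gasket_edges :: "real \<Rightarrow> (real^2) set set" where
  "gasket_edges \<alpha> = (\<Union>n. triangle_edges \<alpha> n \<union> joining_edges \<alpha> n)"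

definition segment_length :: "'a::real_normed_vector set \<Rightarrow> real" where
  "segment_length e = (THE l. \<exists>x y. e = closed_segment x y \<and> l = dist x y)"

text \<open>
  There are two such parametrizations of a segment, one for each orientation. Only the values
  on \<open>[0, segment_length e]\<close> matter.
\<close>

definition arclength_param :: "'a::real_normed_vector set \<Rightarrow> (real \<Rightarrow> 'a) \<Rightarrow> bool" where
  "arclength_param e R \<longleftrightarrow>
     (\<exists>x y. e = closed_segment x y \<and>
        (\<forall>t\<in>{0..segment_length e}. R t = x + (t / segment_length e) *\<^sub>R (y - x)))"

definition gasket_triple ::
    "real \<Rightarrow> (nat \<Rightarrow> (real^2) set) \<Rightarrow> (nat \<Rightarrow> real \<Rightarrow> real^2) \<Rightarrow>
     (real^2, nat \<times> real) spectral_triple" where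
  "gasket_triple \<alpha> \<epsilon> R =
     triple_sum (\<lambda>j. curve_triple (stretched_gasket \<alpha>) (segment_length (\<epsilon> j)) (R j))"


subsection \<open>Hausdorff dimension\<close>

definition hausdorff_premeasure :: "real \<Rightarrow> real \<Rightarrow> 'a::metric_space set \<Rightarrow> ennreal" where
  "hausdorff_premeasure s \<delta> A =
     Inf {(\<Sum>i. ennreal (diameter (U i) powr s)) | U :: nat \<Rightarrow> 'a set.
            A \<subseteq> (\<Union>i. U i) \<and> (\<forall>i. bounded (U i) \<and> diameter (U i) \<le> \<delta>)}"

definition hausdorff_measure :: "real \<Rightarrow> 'a::metric_space set \<Rightarrow> ennreal" where
  "hausdorff_measure s A = (SUP \<delta>\<in>{0<..}. hausdorff_premeasure s \<delta> A)"

text \<open>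
  Restricting to \<open>s > 0\<close> does not change the infimum and avoids \<open>0 powr 0 = 0\<close>.
\<close>

definition hausdorff_dimension :: "'a::metric_space set \<Rightarrow> ereal" where
  "hausdorff_dimension A = Inf {ereal s | s. 0 < s \<and> hausdorff_measure s A = 0}"

end

(*
  The eigenfunctions exp(i pi k x / l) form an orthonormal basis of each L2([-l, l]), by
  Stone-Weierstrass on the circle and a Dynkin argument, so the Dirac operator of the direct sum is
  diagonal with explicit eigenvalues. Any spectral resolution of a diagonal operator fixes the
  eigenvectors, and by Parseval the trace may be computed in any orthonormal basis; hence the trace
  of the power -p of sqrt(I + D^2) is the sum, over all edges, of a zeta-like series in the length l
  of the edge. For p > 1 this series is of order l^p, and there are of the order of 3^n edges of
  length of the order of r^n with r = (1 - alpha)/2, so the trace is finite iff 3 r^p < 1, that is,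
  iff p > d. (alpha < 1/3 enters through d > 1, which makes the single series converge.)

  The gasket is covered by 3^n copies of itself of size r^n and finitely many segments, which have
  dimension 1 < d; this bounds the Hausdorff dimension from above. The copies of the same level that
  part at level m are at distance at least r^m alpha / 2, so the equidistribution on words gives the
  lower bound by mass distribution.
*)

theory Submission
  imports Defs
begin

subsection \<open>Complex Hilbert spaces and orthonormal bases\<close>

text \<open>The functional calculus and the trace are defined through an unspecified choice of a
  resolution and of a basis. Exhibiting convenient ones therefore does not suffice: every admissible
  choice has to be evaluated, which is why projection-valued measures are developed from their
  axioms. Vectors are functions and the form is only semidefinite, so operators are described by
  coefficients, and equality of vectors is replaced by a difference of norm 0. The geometry rests on
  one constant: two corner cells are separated by 1 - 2 r = \<alpha> in a barycentric coordinate,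
  and these coordinates are 2-Lipschitz, whence \<alpha> / 2. This separation also makes the sides
  belonging to different words distinct, so that the lower bound for the trace may count one edge
  per word. No measure on the gasket is constructed for the mass distribution: words of one
  sufficiently large length are counted, after compactness has reduced a countable cover to finitely
  many open sets.\<close>

lemma sum_powers_ii:
  "(\<Sum>j<4. \<i> ^ j * f (\<i> ^ j)) = f 1 + \<i> * f \<i> + (- 1) * f (-1) + (- \<i>) * f (- \<i>)"
proof -
  have "{..<4::nat} = {0, 1, 2, 3}" by auto
  then show ?thesis by (simp add: power3_eq_cube)
qed

text \<open>Positivity is only semidefinite, because a function that vanishes almost everywhere has
  norm 0 without being the zero function. Limits and images are unique only up to norm 0, so later
  results compare inner products and coefficients.\<close>

locale hilbert_space =
  fixes H :: "'x hilbert"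
  assumes zero_closed: "(\<lambda>x. 0) \<in> hcarrier H"
    and add_closed: "\<lbrakk>f \<in> hcarrier H; g \<in> hcarrier H\<rbrakk> \<Longrightarrow> (\<lambda>x. f x + g x) \<in> hcarrier H"
    and scale_closed: "f \<in> hcarrier H \<Longrightarrow> (\<lambda>x. c * f x) \<in> hcarrier H"
    and inner_add_left: "\<lbrakk>f \<in> hcarrier H; g \<in> hcarrier H; h \<in> hcarrier H\<rbrakk> \<Longrightarrow>
          hinner H (\<lambda>x. f x + g x) h = hinner H f h + hinner H g h"
    and inner_scale_left: "\<lbrakk>f \<in> hcarrier H; g \<in> hcarrier H\<rbrakk> \<Longrightarrow>
          hinner H (\<lambda>x. c * f x) g = c * hinner H f g"
    and inner_commute: "\<lbrakk>f \<in> hcarrier H; g \<in> hcarrier H\<rbrakk> \<Longrightarrow> hinner H g f = cnj (hinner H f g)"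
    and inner_self_nonneg: "f \<in> hcarrier H \<Longrightarrow> 0 \<le> Re (hinner H f f)"
    and complete: "\<lbrakk>\<And>n::nat. u n \<in> hcarrier H;
          \<And>e. 0 < e \<Longrightarrow> \<exists>N. \<forall>m\<ge>N. \<forall>n\<ge>N. hnorm H (\<lambda>x. u m x - u n x) < e\<rbrakk> \<Longrightarrow>
          \<exists>h\<in>hcarrier H. (\<lambda>n. hnorm H (\<lambda>x. u n x - h x)) \<longlonglongrightarrow> 0"
begin

lemma minus_closed: "f \<in> hcarrier H \<Longrightarrow> (\<lambda>x. - f x) \<in> hcarrier H"
  using scale_closed[of f "-1"] by simp

lemma diff_closed: "\<lbrakk>f \<in> hcarrier H; g \<in> hcarrier H\<rbrakk> \<Longrightarrow> (\<lambda>x. f x - g x) \<in> hcarrier H"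
  using add_closed[of f "\<lambda>x. - g x"] minus_closed[of g] by simp

lemma sum_closed:
  "(\<And>i. i \<in> F \<Longrightarrow> f i \<in> hcarrier H) \<Longrightarrow> (\<lambda>x. \<Sum>i\<in>F. c i * f i x) \<in> hcarrier H"
proof (induction F rule: infinite_finite_induct)
  case (insert i F)
  then show ?case using add_closed[OF scale_closed[of "f i" "c i"]] by simp
qed (auto intro: zero_closed)

lemma inner_zero_left: "f \<in> hcarrier H \<Longrightarrow> hinner H (\<lambda>x. 0) f = 0"
  using inner_scale_left[of f f 0] by simp

lemma inner_minus_left:
  "\<lbrakk>f \<in> hcarrier H; g \<in> hcarrier H\<rbrakk> \<Longrightarrow> hinner H (\<lambda>x. - f x) g = - hinner H f g"
  using inner_scale_left[of f g "-1"] by simp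

lemma inner_diff_left:
  "\<lbrakk>f \<in> hcarrier H; g \<in> hcarrier H; h \<in> hcarrier H\<rbrakk> \<Longrightarrow>
    hinner H (\<lambda>x. f x - g x) h = hinner H f h - hinner H g h"
  using inner_add_left[of f "\<lambda>x. - g x" h] inner_minus_left[of g h] minus_closed[of g] by simp

lemma inner_sum_left:
  "\<lbrakk>\<And>i. i \<in> F \<Longrightarrow> f i \<in> hcarrier H; g \<in> hcarrier H\<rbrakk> \<Longrightarrow>
    hinner H (\<lambda>x. \<Sum>i\<in>F. c i * f i x) g = (\<Sum>i\<in>F. c i * hinner H (f i) g)"
proof (induction F rule: infinite_finite_induct)
  case (insert i F)
  then show ?case
    using inner_add_left[OF scale_closed[of "f i" "c i"] sum_closed[of F f c]]
    by (simp add: inner_scale_left)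
qed (auto intro: inner_zero_left)

lemma inner_add_right:
  assumes "f \<in> hcarrier H" "g \<in> hcarrier H" "h \<in> hcarrier H"
  shows "hinner H h (\<lambda>x. f x + g x) = hinner H h f + hinner H h g"
  using assms inner_add_left[of f g h] inner_commute[of "\<lambda>x. f x + g x" h]
  by (simp add: add_closed inner_commute[of f h] inner_commute[of g h])

lemma inner_scale_right:
  assumes "f \<in> hcarrier H" "h \<in> hcarrier H"
  shows "hinner H h (\<lambda>x. c * f x) = cnj c * hinner H h f"
  using assms inner_scale_left[of f h c] inner_commute[of "\<lambda>x. c * f x" h]
  by (simp add: scale_closed inner_commute[of f h])

lemma inner_diff_right:
  assumes "f \<in> hcarrier H" "g \<in> hcarrier H" "h \<in> hcarrier H"
  shows "hinner H h (\<lambda>x. f x - g x) = hinner H h f - hinner H h g"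
  using assms inner_diff_left[of f g h] inner_commute[of "\<lambda>x. f x - g x" h]
  by (simp add: diff_closed inner_commute[of f h] inner_commute[of g h])

lemma hnorm_power2: "f \<in> hcarrier H \<Longrightarrow> (hnorm H f)\<^sup>2 = Re (hinner H f f)"
  by (simp add: hnorm_def inner_self_nonneg)

lemma hnorm_nonneg: "f \<in> hcarrier H \<Longrightarrow> 0 \<le> hnorm H f"
  by (simp add: hnorm_def inner_self_nonneg)

lemma inner_self: "f \<in> hcarrier H \<Longrightarrow> hinner H f f = of_real ((hnorm H f)\<^sup>2)"
  using inner_commute[of f f] by (auto simp: hnorm_power2 complex_eq_iff)

lemmas closed = zero_closed add_closed scale_closed minus_closed diff_closed sum_closed

lemma cauchy_schwarz:
  assumes f: "f \<in> hcarrier H" and g: "g \<in> hcarrier H"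
  shows "cmod (hinner H f g) \<le> hnorm H f * hnorm H g"
proof -
  define A B c where "A = (hnorm H f)\<^sup>2" and "B = (hnorm H g)\<^sup>2" and "c = hinner H f g"
  have ff: "hinner H f f = of_real A" and gg: "hinner H g g = of_real B"
    using assms by (auto simp: A_def B_def inner_self)
  have gf: "hinner H g f = cnj c" using inner_commute[OF f g] by (simp add: c_def)
  have key: "0 \<le> Re (s * cnj s * A - s * cnj t * c - t * cnj s * cnj c + t * cnj t * B)" for s t
  proof -
    have "0 \<le> Re (hinner H (\<lambda>x. s * f x - t * g x) (\<lambda>x. s * f x - t * g x))"
      by (intro inner_self_nonneg closed assms)
    also have "hinner H (\<lambda>x. s * f x - t * g x) (\<lambda>x. s * f x - t * g x) =
        s * cnj s * A - s * cnj t * c - t * cnj s * cnj c + t * cnj t * B"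
      using assms by (simp add: inner_diff_left inner_diff_right inner_scale_left inner_scale_right
          closed ff gg gf c_def[symmetric] algebra_simps)
    finally show ?thesis .
  qed
  have A0: "0 \<le> A" and B0: "0 \<le> B" by (auto simp: A_def B_def)
  have cc: "c * cnj c = of_real ((cmod c)\<^sup>2)" by (rule complex_norm_square[symmetric])
  have "(cmod c)\<^sup>2 \<le> A * B"
  proof (cases "B = 0")
    case True
    have "c = 0"
    proof (rule ccontr)
      assume "c \<noteq> 0"
      \<comment> \<open>Chosen so that 2 r |c|^2 = 2 (A + 1) exceeds A. A vector of norm 0 need not
        be the zero function, so orthogonality to it has to be proved.\<close>
      define r where "r = (A + 1) / (cmod c)\<^sup>2"
      have "0 \<le> Re (A - cnj (r * c) * c - (r * c) * cnj c)" using key[of 1 "r * c"] True by simp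
      also have "\<dots> = A - 2 * r * Re (c * cnj c)" by (simp add: algebra_simps)
      also have "\<dots> = A - 2 * r * (cmod c)\<^sup>2" using cc by simp
      also have "\<dots> = A - 2 * (A + 1)" using \<open>c \<noteq> 0\<close> by (simp add: r_def)
      finally show False using A0 by simp
    qed
    then show ?thesis using True by simp
  next
    case False
    \<comment> \<open>This is the squared norm of B f - c g, which is B times the component of f
      orthogonal to g.\<close>
    have "0 \<le> Re (B * B * A - B * (c * cnj c) - B * (c * cnj c) + B * (c * cnj c))"
      using key[of B c] by (simp add: algebra_simps)
    also have "\<dots> = B * (A * B - (cmod c)\<^sup>2)" unfolding cc by (simp add: algebra_simps)
    finally have "0 \<le> A * B - (cmod c)\<^sup>2" using False B0 by (simp add: zero_le_mult_iff)
    then show ?thesis by simp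
  qed
  then have "(cmod c)\<^sup>2 \<le> (hnorm H f * hnorm H g)\<^sup>2"
    by (simp add: A_def B_def power_mult_distrib)
  then show ?thesis
    unfolding c_def by (rule power2_le_imp_le) (simp add: hnorm_nonneg assms)
qed

lemma inner_null_left:
  "\<lbrakk>f \<in> hcarrier H; g \<in> hcarrier H; hnorm H f = 0\<rbrakk> \<Longrightarrow> hinner H f g = 0"
  using cauchy_schwarz[of f g] by simp

lemma hnorm_scale: "f \<in> hcarrier H \<Longrightarrow> hnorm H (\<lambda>x. c * f x) = cmod c * hnorm H f"
proof -
  assume f: "f \<in> hcarrier H"
  have "(hnorm H (\<lambda>x. c * f x))\<^sup>2 = Re (hinner H (\<lambda>x. c * f x) (\<lambda>x. c * f x))"
    using f by (simp add: hnorm_power2 closed)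
  also have "hinner H (\<lambda>x. c * f x) (\<lambda>x. c * f x) = c * cnj c * hinner H f f"
    using f by (simp add: closed inner_scale_left inner_scale_right)
  also have "Re \<dots> = (cmod c * hnorm H f)\<^sup>2"
    unfolding inner_self[OF f] complex_norm_square[symmetric] of_real_mult[symmetric] Re_complex_of_real
    by (simp add: power_mult_distrib)
  finally show ?thesis
    by (rule power2_eq_imp_eq) (auto simp: hnorm_nonneg f closed)
qed

lemma hnorm_add_le:
  assumes f: "f \<in> hcarrier H" and g: "g \<in> hcarrier H"
  shows "hnorm H (\<lambda>x. f x + g x) \<le> hnorm H f + hnorm H g"
proof -
  have "(hnorm H (\<lambda>x. f x + g x))\<^sup>2 = (hnorm H f)\<^sup>2 + (hnorm H g)\<^sup>2 + 2 * Re (hinner H f g)"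
    using assms inner_commute[of f g]
    by (simp add: hnorm_power2 closed inner_add_left inner_add_right)
  also have "\<dots> \<le> (hnorm H f)\<^sup>2 + (hnorm H g)\<^sup>2 + 2 * (hnorm H f * hnorm H g)"
    using cauchy_schwarz[OF f g] complex_Re_le_cmod[of "hinner H f g"] by linarith
  also have "\<dots> = (hnorm H f + hnorm H g)\<^sup>2" by (simp add: power2_sum)
  finally show ?thesis by (rule power2_le_imp_le) (simp add: hnorm_nonneg assms)
qed

lemma hnorm_diff_commute:
  "\<lbrakk>f \<in> hcarrier H; g \<in> hcarrier H\<rbrakk> \<Longrightarrow> hnorm H (\<lambda>x. f x - g x) = hnorm H (\<lambda>x. g x - f x)"
  using hnorm_scale[of "\<lambda>x. f x - g x" "-1"] by (simp add: closed)

lemma abs_hnorm_diff_le: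
  assumes "f \<in> hcarrier H" "g \<in> hcarrier H"
  shows "\<bar>hnorm H f - hnorm H g\<bar> \<le> hnorm H (\<lambda>x. f x - g x)"
  using hnorm_add_le[of "\<lambda>x. f x - g x" g] hnorm_add_le[of "\<lambda>x. g x - f x" f] assms
    hnorm_diff_commute[of f g]
  by (simp add: closed)

lemma tendsto_inner_left:
  assumes u: "\<And>n. u n \<in> hcarrier H" and h: "h \<in> hcarrier H" and g: "g \<in> hcarrier H"
    and lim: "(\<lambda>n. hnorm H (\<lambda>x. u n x - h x)) \<longlonglongrightarrow> 0"
  shows "(\<lambda>n. hinner H (u n) g) \<longlonglongrightarrow> hinner H h g"
proof -
  have "(\<lambda>n. hinner H (u n) g - hinner H h g) \<longlonglongrightarrow> 0"
  proof (rule Lim_null_comparison)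
    show "(\<lambda>n. hnorm H (\<lambda>x. u n x - h x) * hnorm H g) \<longlonglongrightarrow> 0"
      using tendsto_mult_right[OF lim, of "hnorm H g"] by simp
    show "\<forall>\<^sub>F n in sequentially. norm (hinner H (u n) g - hinner H h g)
        \<le> hnorm H (\<lambda>x. u n x - h x) * hnorm H g"
      using cauchy_schwarz[of "\<lambda>x. u _ x - h x" g] u h g
      by (simp add: closed inner_diff_left[symmetric])
  qed
  then show ?thesis by (simp add: LIM_zero_iff)
qed

lemma tendsto_hnorm:
  assumes u: "\<And>n. u n \<in> hcarrier H" and h: "h \<in> hcarrier H"
    and lim: "(\<lambda>n. hnorm H (\<lambda>x. u n x - h x)) \<longlonglongrightarrow> 0"
  shows "(\<lambda>n. hnorm H (u n)) \<longlonglongrightarrow> hnorm H h"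
proof -
  have "(\<lambda>n. hnorm H (u n) - hnorm H h) \<longlonglongrightarrow> 0"
    by (rule Lim_null_comparison[OF _ lim]) (simp add: abs_hnorm_diff_le u h)
  then show ?thesis by (simp add: LIM_zero_iff)
qed

section \<open>Orthonormal families: Bessel, Riesz-Fischer, Parseval\<close>

definition orthonormal :: "('i \<Rightarrow> 'x \<Rightarrow> complex) \<Rightarrow> 'i set \<Rightarrow> bool" where
  "orthonormal b I \<longleftrightarrow> (\<forall>i\<in>I. b i \<in> hcarrier H) \<and>
     (\<forall>i\<in>I. \<forall>j\<in>I. hinner H (b i) (b j) = (if i = j then 1 else 0))"

definition total :: "('i \<Rightarrow> 'x \<Rightarrow> complex) \<Rightarrow> 'i set \<Rightarrow> bool" where
  "total b I \<longleftrightarrow> (\<forall>h\<in>hcarrier H. (\<forall>i\<in>I. hinner H h (b i) = 0) \<longrightarrow> hnorm H h = 0)"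

lemma orthonormal_closed: "\<lbrakk>orthonormal b I; i \<in> I\<rbrakk> \<Longrightarrow> b i \<in> hcarrier H"
  by (simp add: orthonormal_def)

lemma inner_orthonormal:
  "\<lbrakk>orthonormal b I; i \<in> I; j \<in> I\<rbrakk> \<Longrightarrow> hinner H (b i) (b j) = (if i = j then 1 else 0)"
  by (simp add: orthonormal_def)

lemma inner_orthonormal_sum:
  assumes "orthonormal b I" "finite F" "F \<subseteq> I" "j \<in> I"
  shows "hinner H (\<lambda>x. \<Sum>i\<in>F. c i * b i x) (b j) = (if j \<in> F then c j else 0)"
proof -
  have "hinner H (\<lambda>x. \<Sum>i\<in>F. c i * b i x) (b j) = (\<Sum>i\<in>F. c i * hinner H (b i) (b j))"
    using assms by (intro inner_sum_left) (auto simp: orthonormal_closed)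
  also have "\<dots> = (\<Sum>i\<in>F. if i = j then c j else 0)"
    using assms by (intro sum.cong) (auto simp: inner_orthonormal)
  finally show ?thesis using assms by simp
qed

lemma hnorm_orthonormal_sum:
  assumes b: "orthonormal b I" and F: "finite F" "F \<subseteq> I"
  shows "(hnorm H (\<lambda>x. \<Sum>i\<in>F. c i * b i x))\<^sup>2 = (\<Sum>i\<in>F. (cmod (c i))\<^sup>2)"
proof -
  let ?s = "\<lambda>x. \<Sum>i\<in>F. c i * b i x"
  have s: "?s \<in> hcarrier H" using assms by (intro sum_closed) (auto simp: orthonormal_closed)
  have "hinner H ?s ?s = (\<Sum>i\<in>F. c i * hinner H (b i) ?s)"
    using assms s by (intro inner_sum_left) (auto simp: orthonormal_closed)
  also have "\<dots> = (\<Sum>i\<in>F. c i * cnj (c i))"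
  proof (intro sum.cong refl)
    fix i assume "i \<in> F"
    then show "c i * hinner H (b i) ?s = c i * cnj (c i)"
      using inner_orthonormal_sum[OF b F, of i c] inner_commute[OF s, of "b i"] F
      by (auto simp: orthonormal_closed[OF b])
  qed
  also have "\<dots> = of_real (\<Sum>i\<in>F. (cmod (c i))\<^sup>2)" by (simp only: complex_norm_square of_real_sum)
  finally show ?thesis by (simp add: hnorm_power2 s)
qed

lemma hnorm_diff_projection:
  assumes b: "orthonormal b I" and F: "finite F" "F \<subseteq> I" and f: "f \<in> hcarrier H"
  shows "(hnorm H (\<lambda>x. f x - (\<Sum>i\<in>F. hinner H f (b i) * b i x)))\<^sup>2 =
    (hnorm H f)\<^sup>2 - (\<Sum>i\<in>F. (cmod (hinner H f (b i)))\<^sup>2)"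
proof -
  let ?s = "\<lambda>x. \<Sum>i\<in>F. hinner H f (b i) * b i x"
  have s: "?s \<in> hcarrier H" using b F by (intro sum_closed) (auto simp: orthonormal_closed)
  have "hinner H ?s f = (\<Sum>i\<in>F. hinner H f (b i) * hinner H (b i) f)"
    using b F f by (intro inner_sum_left) (auto simp: orthonormal_closed)
  also have "\<dots> = (\<Sum>i\<in>F. of_real ((cmod (hinner H f (b i)))\<^sup>2))"
  proof (intro sum.cong refl)
    fix i assume "i \<in> F"
    then show "hinner H f (b i) * hinner H (b i) f = of_real ((cmod (hinner H f (b i)))\<^sup>2)"
      using F inner_commute[OF f orthonormal_closed[OF b], of i]
      by (auto simp: complex_norm_square simp del: of_real_power)
  qed
  finally have sf: "hinner H ?s f = of_real (\<Sum>i\<in>F. (cmod (hinner H f (b i)))\<^sup>2)" by simp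
  have fs: "hinner H f ?s = of_real (\<Sum>i\<in>F. (cmod (hinner H f (b i)))\<^sup>2)"
    using inner_commute[OF s f] sf by simp
  have ss: "hinner H ?s ?s = of_real (\<Sum>i\<in>F. (cmod (hinner H f (b i)))\<^sup>2)"
    unfolding inner_self[OF s] hnorm_orthonormal_sum[OF b F] ..
  show ?thesis
    using s f by (simp add: hnorm_power2 closed inner_diff_left inner_diff_right sf fs ss)
qed

lemma bessel:
  assumes b: "orthonormal b I" and f: "f \<in> hcarrier H"
  shows "(\<lambda>i. (cmod (hinner H f (b i)))\<^sup>2) summable_on I"
proof (rule nonneg_bdd_above_summable_on)
  show "bdd_above (sum (\<lambda>i. (cmod (hinner H f (b i)))\<^sup>2) ` {F. F \<subseteq> I \<and> finite F})"
  proof (rule bdd_aboveI2)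
    fix F assume "F \<in> {F. F \<subseteq> I \<and> finite F}"
    then show "(\<Sum>i\<in>F. (cmod (hinner H f (b i)))\<^sup>2) \<le> (hnorm H f)\<^sup>2"
      using hnorm_diff_projection[OF b _ _ f, of F]
        zero_le_power2[of "hnorm H (\<lambda>x. f x - (\<Sum>i\<in>F. hinner H f (b i) * b i x))"]
      by auto
  qed
qed auto

text \<open>The index set may be uncountable, since the basis picked in
  \<open>positive_trace\<close> is arbitrary. Instead of an enumeration, finite sets
  \<open>F n\<close> are chosen outside of which the squares weigh less than 1 / (n + 1); the
  corresponding sums form a Cauchy sequence. The norm identity is included because it is what yields
  Parseval.\<close>

theorem riesz_fischer:
  assumes b: "orthonormal b I" and a: "(\<lambda>i. (cmod (a i))\<^sup>2) summable_on I"
  obtains h where "h \<in> hcarrier H" "\<And>i. i \<in> I \<Longrightarrow> hinner H h (b i) = a i"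
    "((\<lambda>i. (cmod (a i))\<^sup>2) has_sum (hnorm H h)\<^sup>2) I"
proof -
  let ?q = "\<lambda>i. (cmod (a i))\<^sup>2"
  define A where "A = infsum ?q I"
  have A: "(?q has_sum A) I" using a by (simp add: A_def)
  have "\<exists>F. finite F \<and> F \<subseteq> I \<and> A - sum ?q F < 1 / real (Suc n)" for n
  proof -
    have "\<forall>\<^sub>F F in finite_subsets_at_top I. dist (sum ?q F) A < 1 / real (Suc n)"
      using A unfolding has_sum_def by (rule tendstoD) simp
    then obtain F where "finite F" "F \<subseteq> I" "dist (sum ?q F) A < 1 / real (Suc n)"
      by (force simp: eventually_finite_subsets_at_top)
    then show ?thesis by (intro exI[of _ F]) (auto simp: dist_real_def)
  qed
  then obtain F where F: "\<And>n. finite (F n)" "\<And>n. F n \<subseteq> I"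
    and Fle: "\<And>n. A - sum ?q (F n) < 1 / real (Suc n)"
    by metis
  have le: "sum ?q G \<le> A" if "finite G" "G \<subseteq> I" for G
    using finite_sum_le_has_sum[OF A that] by simp
  have out: "sum ?q (G - F n) < 1 / real (Suc n)" if "finite G" "G \<subseteq> I" for G n
  proof -
    have "sum ?q (G \<union> F n) = sum ?q (G - F n) + sum ?q (F n)"
      using that F[of n] sum.subset_diff[of "F n" "G \<union> F n" ?q] by (simp add: Un_Diff)
    moreover have "sum ?q (G \<union> F n) \<le> A" using that F[of n] by (intro le) auto
    ultimately show ?thesis using Fle[of n] by linarith
  qed
  define u where "u n = (\<lambda>x. \<Sum>i\<in>F n. a i * b i x)" for n
  have u: "u n \<in> hcarrier H" for n
    unfolding u_def using F b by (intro sum_closed) (auto intro: orthonormal_closed)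
  have dist: "(hnorm H (\<lambda>x. u m x - u n x))\<^sup>2 < 1 / real (Suc n) + 1 / real (Suc m)" for m n
  proof -
    \<comment> \<open>Writes the difference as one orthonormal sum over the union: the coefficients
      cancel on the intersection, so only the symmetric difference contributes.\<close>
    let ?c = "\<lambda>i. (if i \<in> F m then a i else 0) - (if i \<in> F n then a i else 0)"
    have "u m x - u n x = (\<Sum>i\<in>F m \<union> F n. ?c i * b i x)" for x
    proof -
      have "u m x = (\<Sum>i\<in>F m \<union> F n. (if i \<in> F m then a i else 0) * b i x)"
        unfolding u_def using F by (intro sum.mono_neutral_cong_left) auto
      moreover have "u n x = (\<Sum>i\<in>F m \<union> F n. (if i \<in> F n then a i else 0) * b i x)"
        unfolding u_def using F by (intro sum.mono_neutral_cong_left) auto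
      ultimately show ?thesis by (simp add: sum_subtractf algebra_simps)
    qed
    then have "(hnorm H (\<lambda>x. u m x - u n x))\<^sup>2 = (\<Sum>i\<in>F m \<union> F n. (cmod (?c i))\<^sup>2)"
      using hnorm_orthonormal_sum[OF b, of "F m \<union> F n" ?c] F by simp
    also have "\<dots> = (\<Sum>i\<in>(F m - F n) \<union> (F n - F m). ?q i)"
      using F by (intro sum.mono_neutral_cong_right) auto
    also have "\<dots> = sum ?q (F m - F n) + sum ?q (F n - F m)"
      using F by (intro sum.union_disjoint) auto
    also have "\<dots> < 1 / real (Suc n) + 1 / real (Suc m)"
      using out[of "F m" n] out[of "F n" m] F by (intro add_strict_mono) auto
    finally show ?thesis .
  qed
  have "\<exists>N. \<forall>m\<ge>N. \<forall>n\<ge>N. hnorm H (\<lambda>x. u m x - u n x) < e" if e: "0 < e" for e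
  proof -
    obtain N where N: "1 / real (Suc N) < e\<^sup>2 / 2"
      using e nat_approx_posE[of "e\<^sup>2 / 2"] by auto
    have "hnorm H (\<lambda>x. u m x - u n x) < e" if "N \<le> m" "N \<le> n" for m n
    proof -
      have "1 / real (Suc n) \<le> 1 / real (Suc N)" "1 / real (Suc m) \<le> 1 / real (Suc N)"
        using that by (auto simp: field_simps)
      then have "(hnorm H (\<lambda>x. u m x - u n x))\<^sup>2 < e\<^sup>2" using dist[of m n] N by linarith
      then show ?thesis using e by (simp add: power2_less_imp_less)
    qed
    then show ?thesis by blast
  qed
  from complete[OF u this] obtain h where h: "h \<in> hcarrier H"
    and lim: "(\<lambda>n. hnorm H (\<lambda>x. u n x - h x)) \<longlonglongrightarrow> 0" by blast
  have inv: "(\<lambda>n. 1 / real (Suc n)) \<longlonglongrightarrow> 0" using LIMSEQ_inverse_real_of_nat by (simp add: inverse_eq_divide)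
  have coef: "hinner H h (b i) = a i" if i: "i \<in> I" for i
  proof (rule LIMSEQ_unique)
    show "(\<lambda>n. hinner H (u n) (b i)) \<longlonglongrightarrow> hinner H h (b i)"
      using u h lim b i by (intro tendsto_inner_left) (auto simp: orthonormal_closed)
    have "(\<lambda>n. (cmod (hinner H (u n) (b i) - a i))\<^sup>2) \<longlonglongrightarrow> 0"
    proof (rule Lim_null_comparison[OF _ inv], rule always_eventually, intro allI)
      fix n
      have "hinner H (u n) (b i) = (if i \<in> F n then a i else 0)"
        unfolding u_def using b F i by (intro inner_orthonormal_sum) auto
      then show "norm ((cmod (hinner H (u n) (b i) - a i))\<^sup>2) \<le> 1 / real (Suc n)"
        using out[of "{i}" n] i by (auto simp: insert_Diff_if less_imp_le)
    qed
    then have "(\<lambda>n. sqrt ((cmod (hinner H (u n) (b i) - a i))\<^sup>2)) \<longlonglongrightarrow> sqrt 0"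
      by (rule tendsto_real_sqrt)
    then show "(\<lambda>n. hinner H (u n) (b i)) \<longlonglongrightarrow> a i"
      by (simp add: tendsto_norm_zero_iff LIM_zero_iff)
  qed
  have "(\<lambda>n. sum ?q (F n)) \<longlonglongrightarrow> A"
  proof -
    have "(\<lambda>n. sum ?q (F n) - A) \<longlonglongrightarrow> 0"
      by (rule Lim_null_comparison[OF _ inv], rule always_eventually, intro allI)
        (use Fle le F in \<open>force simp: less_imp_le\<close>)
    then show ?thesis by (simp add: LIM_zero_iff)
  qed
  moreover have "(\<lambda>n. sum ?q (F n)) \<longlonglongrightarrow> (hnorm H h)\<^sup>2"
    using tendsto_power[OF tendsto_hnorm[OF u h lim], of 2] hnorm_orthonormal_sum[OF b F, where c = a]
    by (simp add: u_def)
  ultimately have "(hnorm H h)\<^sup>2 = A" using LIMSEQ_unique by blast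
  with that h coef A show ?thesis by blast
qed

lemma hnorm_zero_if_coef_eq:
  assumes b: "orthonormal b I" and t: "total b I"
    and f: "f \<in> hcarrier H" and g: "g \<in> hcarrier H"
    and eq: "\<And>i. i \<in> I \<Longrightarrow> hinner H f (b i) = hinner H g (b i)"
  shows "hnorm H (\<lambda>x. f x - g x) = 0"
  using t f g eq b unfolding total_def by (auto simp: closed inner_diff_left orthonormal_closed)

text \<open>Riesz-Fischer produces a vector with the same coefficients for which the identity holds;
  totality makes its difference from \<open>f\<close> a null vector, so the norms agree.\<close>

theorem parseval:
  assumes b: "orthonormal b I" and t: "total b I" and f: "f \<in> hcarrier H"
  shows "((\<lambda>i. (cmod (hinner H f (b i)))\<^sup>2) has_sum (hnorm H f)\<^sup>2) I"
proof -
  obtain h where h: "h \<in> hcarrier H" "\<And>i. i \<in> I \<Longrightarrow> hinner H h (b i) = hinner H f (b i)"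
    "((\<lambda>i. (cmod (hinner H f (b i)))\<^sup>2) has_sum (hnorm H h)\<^sup>2) I"
    using riesz_fischer[OF b bessel[OF b f]] by blast
  have "hnorm H (\<lambda>x. f x - h x) = 0" using hnorm_zero_if_coef_eq[OF b t f h(1)] h(2) by simp
  then have "hnorm H f = hnorm H h" using abs_hnorm_diff_le[OF f h(1)] by simp
  with h(3) show ?thesis by simp
qed

lemma polarization:
  assumes f: "f \<in> hcarrier H" and g: "g \<in> hcarrier H"
  shows "hinner H f g = (\<Sum>j<4. \<i> ^ j * of_real ((hnorm H (\<lambda>x. f x + \<i> ^ j * g x))\<^sup>2)) / 4"
proof -
  have key: "of_real ((hnorm H (\<lambda>x. f x + c * g x))\<^sup>2) = hinner H f f + cnj c * hinner H f g
      + c * cnj (hinner H f g) + c * cnj c * hinner H g g" for c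
    unfolding inner_self[OF add_closed[OF f scale_closed[OF g]], symmetric]
    using f g by (simp add: closed inner_add_left inner_add_right
        inner_scale_left inner_scale_right inner_commute[OF f g] distrib_left)
  show ?thesis
    unfolding sum_powers_ii[where f = "\<lambda>z. of_real ((hnorm H (\<lambda>x. f x + z * g x))\<^sup>2)"] unfolding key
    by (simp add: algebra_simps)
qed

text \<open>Polarizing the quadratic identity on both sides gives the sesquilinear one, including
  the unconditional convergence.\<close>

theorem parseval_inner:
  assumes b: "orthonormal b I" and t: "total b I" and f: "f \<in> hcarrier H" and g: "g \<in> hcarrier H"
  shows "((\<lambda>i. hinner H f (b i) * cnj (hinner H g (b i))) has_sum hinner H f g) I"
proof -
  have "((\<lambda>i. (\<Sum>j<4. \<i> ^ j * of_real ((cmod (hinner H (\<lambda>x. f x + \<i> ^ j * g x) (b i)))\<^sup>2)) / 4)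
      has_sum (\<Sum>j<4. \<i> ^ j * of_real ((hnorm H (\<lambda>x. f x + \<i> ^ j * g x))\<^sup>2)) / 4) I"
    unfolding divide_inverse sum_powers_ii[where f = "\<lambda>z. of_real ((hnorm H (\<lambda>x. f x + z * g x))\<^sup>2)"]
      sum_powers_ii[where f = "\<lambda>z. of_real ((cmod (hinner H (\<lambda>x. f x + z * g x) (b i)))\<^sup>2)" for i]
    by (intro has_sum_cmult_left has_sum_add  has_sum_cmult_right has_sum_of_real
        parseval[OF b t] add_closed scale_closed f g)
  moreover have "(\<Sum>j<4. \<i> ^ j * of_real ((cmod (hinner H (\<lambda>x. f x + \<i> ^ j * g x) (b i)))\<^sup>2)) / 4
      = hinner H f (b i) * cnj (hinner H g (b i))" if "i \<in> I" for i
    using orthonormal_closed[OF b that] f g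
    by (subst sum_powers_ii[where f = "\<lambda>z. of_real ((cmod (hinner H (\<lambda>x. f x + z * g x) (b i)))\<^sup>2)"])
      (simp add: complex_norm_square closed inner_add_left inner_diff_left inner_scale_left algebra_simps
        del: of_real_power)
  ultimately show ?thesis
    unfolding polarization[OF f g] by (simp only: cong: has_sum_cong)
qed

end


subsection \<open>Functional calculus of diagonal operators\<close>

text \<open>Traces and spectral measures are integrals against counting measure, whereas
  coefficients are summed with \<open>has_sum\<close>; this and the next two lemmas translate
  between the two.\<close>

lemma nn_integral_count_space_has_sum:
  fixes f :: "'i \<Rightarrow> real"
  assumes s: "(f has_sum s) I" and pos: "\<And>i. i \<in> I \<Longrightarrow> 0 \<le> f i"
  shows "(\<integral>\<^sup>+ i. ennreal (f i) \<partial>count_space I) = ennreal s"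
proof -
  have "Infinite_Set_Sum.abs_summable_on f I"
    using s abs_summable_equivalent has_sum_imp_summable summable_on_iff_abs_summable_on_real by blast
  then show ?thesis
    using nn_integral_conv_infsetsum[of f I] pos infsetsum_infsum[of f I] infsumI[OF s] by simp
qed

lemma summable_on_if_nn_integral_finite:
  fixes f :: "'i \<Rightarrow> real"
  assumes fin: "(\<integral>\<^sup>+ i. ennreal (f i) \<partial>count_space I) < \<infinity>" and pos: "\<And>i. i \<in> I \<Longrightarrow> 0 \<le> f i"
  shows "f summable_on I"
proof -
  have "integrable (count_space I) f"
    using fin pos by (intro integrableI_nonneg) (auto simp: AE_count_space)
  then have "Infinite_Set_Sum.abs_summable_on f I"
    by (simp only: Infinite_Set_Sum.abs_summable_on_def)
  then show ?thesis
    using abs_summable_equivalent summable_on_iff_abs_summable_on_real by blast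
qed

lemma integral_count_space_has_sum:
  fixes f :: "'i \<Rightarrow> real"
  assumes s: "(f has_sum s) I"
  shows "(LINT i|count_space I. f i) = s"
proof -
  have "Infinite_Set_Sum.abs_summable_on f I"
    using s abs_summable_equivalent has_sum_imp_summable summable_on_iff_abs_summable_on_real by blast
  then show ?thesis
    using infsetsum_infsum[of f I] infsumI[OF s] by (simp add: infsetsum_def)
qed

locale hilbert_basis = hilbert_space H
  for H :: "'x hilbert" +
  fixes b :: "'i \<Rightarrow> 'x \<Rightarrow> complex" and I :: "'i set"
  assumes onb: "orthonormal b I" and total: "total b I"
begin

abbreviation coef :: "('x \<Rightarrow> complex) \<Rightarrow> 'i \<Rightarrow> complex" where
  "coef h i \<equiv> hinner H h (b i)"

text \<open>The natural domain is implicit: a vector \<open>g\<close> with these coefficients exists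
  only if they are square summable. Since only coefficients are tested, the graph is saturated under
  equality of vectors.\<close>

definition diag_op :: "('i \<Rightarrow> real) \<Rightarrow> 'x graph" where
  "diag_op a = {(h, g). h \<in> hcarrier H \<and> g \<in> hcarrier H \<and>
     (\<forall>i\<in>I. coef g i = of_real (a i) * coef h i)}"

text \<open>Prescribing coefficients instead of functions leaves the values free up to norm 0, so
  that an arbitrary resolution can be shown to satisfy the condition.\<close>

definition diag_projections ::
    "('i \<Rightarrow> real) \<Rightarrow> (real set \<Rightarrow> ('x \<Rightarrow> complex) \<Rightarrow> ('x \<Rightarrow> complex)) \<Rightarrow> bool" where
  "diag_projections a E \<longleftrightarrow> (\<forall>S\<in>sets borel. \<forall>h\<in>hcarrier H. E S h \<in> hcarrier H \<and>
     (\<forall>i\<in>I. coef (E S h) i = (if a i \<in> S then coef h i else 0)))"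

text \<open>The sum of point masses |coef h i|^2 at the eigenvalues a i: the explicit form of the
  scalar spectral measure of \<open>h\<close>.\<close>

definition coef_measure :: "('i \<Rightarrow> real) \<Rightarrow> ('x \<Rightarrow> complex) \<Rightarrow> real measure" where
  "coef_measure a h = distr (density (count_space I) (\<lambda>i. ennreal ((cmod (coef h i))\<^sup>2))) borel a"

lemma b_closed: "i \<in> I \<Longrightarrow> b i \<in> hcarrier H"
  using onb by (rule orthonormal_closed)

lemma coef_basis: "\<lbrakk>i \<in> I; j \<in> I\<rbrakk> \<Longrightarrow> coef (b i) j = (if i = j then 1 else 0)"
  using onb by (rule inner_orthonormal)

lemma coef_summable: "h \<in> hcarrier H \<Longrightarrow> (\<lambda>i. (cmod (coef h i))\<^sup>2) summable_on I"
  by (rule bessel[OF onb])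

lemma sets_coef_measure [simp, measurable_cong]: "sets (coef_measure a h) = sets borel"
  by (simp add: coef_measure_def)

lemma space_coef_measure [simp]: "space (coef_measure a h) = UNIV"
  by (simp add: coef_measure_def)

lemma nn_integral_coef_measure:
  assumes [measurable]: "f \<in> borel_measurable borel"
  shows "(\<integral>\<^sup>+ t. f t \<partial>coef_measure a h) = (\<integral>\<^sup>+ i. ennreal ((cmod (coef h i))\<^sup>2) * f (a i) \<partial>count_space I)"
  by (simp add: coef_measure_def nn_integral_distr nn_integral_density)

lemma emeasure_coef_measure:
  assumes A: "A \<in> sets borel" and s: "((\<lambda>i. if a i \<in> A then (cmod (coef h i))\<^sup>2 else 0) has_sum s) I"
  shows "emeasure (coef_measure a h) A = ennreal s"
proof -
  have "emeasure (coef_measure a h) A = (\<integral>\<^sup>+ t. indicator A t \<partial>coef_measure a h)"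
    using A by simp
  also have "\<dots> = (\<integral>\<^sup>+ i. ennreal (if a i \<in> A then (cmod (coef h i))\<^sup>2 else 0) \<partial>count_space I)"
    using A by (subst nn_integral_coef_measure) (auto intro!: nn_integral_cong)
  also have "\<dots> = ennreal s"
    using s by (rule nn_integral_count_space_has_sum) auto
  finally show ?thesis .
qed

lemma finite_measure_coef_measure: "h \<in> hcarrier H \<Longrightarrow> finite_measure (coef_measure a h)"
  using emeasure_coef_measure[of UNIV a h] parseval[OF onb total, of h]
  by (intro finite_measureI) simp

lemma integral_coef_measure:
  assumes [measurable]: "\<phi> \<in> borel_measurable borel"
    and s: "((\<lambda>i. \<phi> (a i) * (cmod (coef h i))\<^sup>2) has_sum s) I"
  shows "(LINT t|coef_measure a h. \<phi> t) = s"
proof -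
  have "(LINT t|coef_measure a h. \<phi> t) = (LINT i|count_space I. (cmod (coef h i))\<^sup>2 *\<^sub>R \<phi> (a i))"
    unfolding coef_measure_def by (subst integral_distr) (auto simp: integral_density)
  also have "\<dots> = s"
    using integral_count_space_has_sum[OF s] by (simp add: mult.commute)
  finally show ?thesis .
qed

section \<open>Integrals against diagonal projections\<close>

context
  fixes a :: "'i \<Rightarrow> real" and E
  assumes E: "diag_projections a E"
begin

lemma E_closed: "\<lbrakk>S \<in> sets borel; h \<in> hcarrier H\<rbrakk> \<Longrightarrow> E S h \<in> hcarrier H"
  using E by (simp add: diag_projections_def)

lemma coef_E:
  "\<lbrakk>S \<in> sets borel; h \<in> hcarrier H; i \<in> I\<rbrakk> \<Longrightarrow> coef (E S h) i = (if a i \<in> S then coef h i else 0)"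
  using E by (simp add: diag_projections_def)

lemma inner_E_self:
  assumes S: "S \<in> sets borel" and h: "h \<in> hcarrier H"
  shows "hinner H (E S h) h = of_real (measure (coef_measure a h) S)"
proof -
  have "((\<lambda>i. if a i \<in> S then (cmod (coef h i))\<^sup>2 else 0) has_sum (hnorm H (E S h))\<^sup>2) I"
    using parseval[OF onb total E_closed[OF S h]]
    by (rule has_sum_cong[THEN iffD1, rotated]) (simp add: coef_E S h)
  then have sum: "((\<lambda>i. if a i \<in> S then (cmod (coef h i))\<^sup>2 else 0) has_sum (hnorm H (E S h))\<^sup>2) I" .
  have "emeasure (coef_measure a h) S = ennreal ((hnorm H (E S h))\<^sup>2)"
    by (rule emeasure_coef_measure[OF S sum])
  then have m: "measure (coef_measure a h) S = (hnorm H (E S h))\<^sup>2"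
    by (simp add: measure_def)
  have "((\<lambda>i. coef (E S h) i * cnj (coef h i)) has_sum of_real ((hnorm H (E S h))\<^sup>2)) I"
    by (rule has_sum_cong[THEN iffD1, OF _ has_sum_of_real[OF sum]])
      (simp add: coef_E S h complex_norm_square del: of_real_power)
  with parseval_inner[OF onb total E_closed[OF S h] h] show ?thesis
    unfolding m by (rule has_sum_unique)
qed

lemma scalar_spectral_measure_diag:
  assumes h: "h \<in> hcarrier H"
  shows "scalar_spectral_measure H E h = coef_measure a h"
proof -
  interpret finite_measure "coef_measure a h" by (rule finite_measure_coef_measure[OF h])
  have "scalar_spectral_measure H E h = measure_of UNIV (sets borel) (emeasure (coef_measure a h))"
    unfolding scalar_spectral_measure_def
  proof (rule measure_of_eq)
    fix S :: "real set" assume "S \<in> sigma_sets UNIV (sets borel)"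
    then have "S \<in> sets borel" using sets.sigma_sets_eq[of "borel :: real measure"] by simp
    then show "ennreal (Re (hinner H (E S h) h)) = emeasure (coef_measure a h) S"
      by (simp add: inner_E_self h emeasure_eq_measure)
  qed simp
  also have "\<dots> = coef_measure a h"
    using measure_of_of_measure[of "coef_measure a h"] by simp
  finally show ?thesis .
qed

lemma projection_valued_measure_diag: "projection_valued_measure H E"
  unfolding projection_valued_measure_def orthogonal_projection_def heq_def
proof (intro conjI ballI allI impI)
  fix S :: "real set" and f assume S: "S \<in> sets borel" and f: "f \<in> hcarrier H"
  show "E S f \<in> hcarrier H" using S f by (rule E_closed)
  show "hnorm H (\<lambda>x. E S (E S f) x - E S f x) = 0"
    using S f by (intro hnorm_zero_if_coef_eq[OF onb total]) (auto simp: E_closed coef_E)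
  fix g assume g: "g \<in> hcarrier H"
  have "((\<lambda>i. if a i \<in> S then coef f i * cnj (coef g i) else 0) has_sum hinner H (E S f) g) I"
    using parseval_inner[OF onb total E_closed[OF S f] g]
    by (rule has_sum_cong[THEN iffD1, rotated]) (simp add: coef_E S f)
  moreover have "((\<lambda>i. if a i \<in> S then coef f i * cnj (coef g i) else 0) has_sum hinner H f (E S g)) I"
    using parseval_inner[OF onb total f E_closed[OF S g]]
    by (rule has_sum_cong[THEN iffD1, rotated]) (simp add: coef_E S g)
  ultimately show "hinner H (E S f) g = hinner H f (E S g)" by (rule has_sum_unique)
next
  fix f assume f: "f \<in> hcarrier H"
  show "hnorm H (\<lambda>x. E UNIV f x - f x) = 0"
    using f by (intro hnorm_zero_if_coef_eq[OF onb total]) (auto simp: E_closed coef_E)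
  fix A :: "nat \<Rightarrow> real set" assume A: "range A \<subseteq> sets borel" "disjoint_family A"
  interpret finite_measure "coef_measure a f" by (rule finite_measure_coef_measure[OF f])
  have "(\<lambda>n. measure (coef_measure a f) (A n)) sums measure (coef_measure a f) (\<Union>n. A n)"
    using A by (intro finite_measure_UNION) auto
  then have "(\<lambda>n. complex_of_real (measure (coef_measure a f) (A n))) sums
      of_real (measure (coef_measure a f) (\<Union>n. A n))"
    by (rule sums_of_real)
  moreover have "A n \<in> sets borel" for n using A by auto
  ultimately show "(\<lambda>n. hinner H (E (A n) f) f) sums hinner H (E (\<Union>n. A n) f) f"
    by (simp add: inner_E_self f sets.countable_UN)
qed

lemma in_spectral_domain_diag:
  assumes [measurable]: "\<phi> \<in> borel_measurable borel"
  shows "in_spectral_domain H E \<phi> h \<longleftrightarrow>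
    h \<in> hcarrier H \<and> (\<lambda>i. (\<phi> (a i))\<^sup>2 * (cmod (coef h i))\<^sup>2) summable_on I"
proof -
  have "(\<integral>\<^sup>+ t. ennreal ((\<phi> t)\<^sup>2) \<partial>scalar_spectral_measure H E h) < \<infinity> \<longleftrightarrow>
      (\<lambda>i. (\<phi> (a i))\<^sup>2 * (cmod (coef h i))\<^sup>2) summable_on I" if "h \<in> hcarrier H"
  proof -
    have "(\<integral>\<^sup>+ t. ennreal ((\<phi> t)\<^sup>2) \<partial>scalar_spectral_measure H E h) =
        (\<integral>\<^sup>+ i. ennreal ((\<phi> (a i))\<^sup>2 * (cmod (coef h i))\<^sup>2) \<partial>count_space I)"
      unfolding scalar_spectral_measure_diag[OF that]
      by (subst nn_integral_coef_measure) (auto simp: ennreal_mult mult.commute)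
    then show ?thesis
      using summable_on_if_nn_integral_finite[where f = "\<lambda>i. (\<phi> (a i))\<^sup>2 * (cmod (coef h i))\<^sup>2" and I = I]
        nn_integral_count_space_has_sum[where f = "\<lambda>i. (\<phi> (a i))\<^sup>2 * (cmod (coef h i))\<^sup>2" and I = I]
      by (auto simp: summable_on_def)
  qed
  then show ?thesis by (auto simp: in_spectral_domain_def)
qed

lemma spectral_sum_diag:
  assumes [measurable]: "\<phi> \<in> borel_measurable borel"
    and h: "in_spectral_domain H E \<phi> h" and k: "in_spectral_domain H E \<phi> k"
  shows "((\<lambda>i. of_real (\<phi> (a i)) * coef h i * cnj (coef k i)) has_sum
    (\<Sum>j<4. \<i> ^ j * of_real (LINT t|scalar_spectral_measure H E (\<lambda>x. h x + \<i> ^ j * k x). \<phi> t)) / 4) I"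
proof -
  have hC: "h \<in> hcarrier H" and kC: "k \<in> hcarrier H"
    and hs: "(\<lambda>i. (\<phi> (a i))\<^sup>2 * (cmod (coef h i))\<^sup>2) summable_on I"
    and ks: "(\<lambda>i. (\<phi> (a i))\<^sup>2 * (cmod (coef k i))\<^sup>2) summable_on I"
    using h k by (auto simp: in_spectral_domain_diag)
  define s where "s c = infsum (\<lambda>i. \<phi> (a i) * (cmod (coef (\<lambda>x. h x + c * k x) i))\<^sup>2) I" for c
  have s: "((\<lambda>i. \<phi> (a i) * (cmod (coef (\<lambda>x. h x + c * k x) i))\<^sup>2) has_sum s c) I"
    if c: "cmod c = 1" for c
  proof -
    \<comment> \<open>Combines |x + c y|^2 \<le> 2 (|x|^2 + |y|^2) with |\<phi>| \<le> 1 + \<phi>^2,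
      so that the square-integrability in the domain condition dominates the first power of
      \<phi>.\<close>
    let ?m = "\<lambda>i. 2 * ((1 + (\<phi> (a i))\<^sup>2) * ((cmod (coef h i))\<^sup>2 + (cmod (coef k i))\<^sup>2))"
    have "?m summable_on I"
    proof -
      have "(\<lambda>i. 2 * (((cmod (coef h i))\<^sup>2 + (\<phi> (a i))\<^sup>2 * (cmod (coef h i))\<^sup>2)
          + ((cmod (coef k i))\<^sup>2 + (\<phi> (a i))\<^sup>2 * (cmod (coef k i))\<^sup>2))) summable_on I"
        by (intro summable_on_cmult_right summable_on_add hs ks coef_summable hC kC)
      then show ?thesis by (simp add: algebra_simps)
    qed
    moreover have "norm (\<phi> (a i) * (cmod (coef (\<lambda>x. h x + c * k x) i))\<^sup>2) \<le> ?m i" if i: "i \<in> I" for i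
    proof -
      have "cmod (coef (\<lambda>x. h x + c * k x) i) \<le> cmod (coef h i) + cmod (coef k i)"
        using norm_triangle_ineq[of "coef h i" "c * coef k i"] hC kC c b_closed[OF i]
        by (simp add: closed inner_add_left inner_scale_left norm_mult)
      then have "(cmod (coef (\<lambda>x. h x + c * k x) i))\<^sup>2 \<le> (cmod (coef h i) + cmod (coef k i))\<^sup>2"
        by (intro power_mono) auto
      also have "\<dots> \<le> 2 * ((cmod (coef h i))\<^sup>2 + (cmod (coef k i))\<^sup>2)"
        using sum_squares_bound[of "cmod (coef h i)" "cmod (coef k i)"] by (simp add: power2_sum)
      finally have 1: "(cmod (coef (\<lambda>x. h x + c * k x) i))\<^sup>2 \<le>
          2 * ((cmod (coef h i))\<^sup>2 + (cmod (coef k i))\<^sup>2)" .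
      have 2: "\<bar>\<phi> (a i)\<bar> \<le> 1 + (\<phi> (a i))\<^sup>2"
        using sum_squares_bound[of 1 "\<bar>\<phi> (a i)\<bar>"] by simp
      show ?thesis using mult_mono[OF 2 1] by (simp add: abs_mult algebra_simps)
    qed
    ultimately have "(\<lambda>i. norm (\<phi> (a i) * (cmod (coef (\<lambda>x. h x + c * k x) i))\<^sup>2)) summable_on I"
      by (rule summable_on_comparison_test) auto
    then show ?thesis
      unfolding s_def by (intro has_sum_infsum) (rule abs_summable_summable)
  qed
  have L: "(LINT t|scalar_spectral_measure H E (\<lambda>x. h x + c * k x). \<phi> t) = s c" if "cmod c = 1" for c
    using integral_coef_measure[OF assms(1) s[OF that]] hC kC
    by (simp add: scalar_spectral_measure_diag closed)
  have eq: "(\<Sum>j<4. \<i> ^ j * of_real (LINT t|scalar_spectral_measure H E (\<lambda>x. h x + \<i> ^ j * k x). \<phi> t))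
      = (\<Sum>j<4. \<i> ^ j * complex_of_real (s (\<i> ^ j)))"
    by (intro sum.cong refl) (simp add: L norm_power)
  have "((\<lambda>i. (\<Sum>j<4. \<i> ^ j * of_real (\<phi> (a i) * (cmod (coef (\<lambda>x. h x + \<i> ^ j * k x) i))\<^sup>2)) / 4)
      has_sum (\<Sum>j<4. \<i> ^ j * of_real (s (\<i> ^ j))) / 4) I"
    unfolding divide_inverse sum_powers_ii[where f = "\<lambda>z. of_real (s z)"]
      sum_powers_ii[where f = "\<lambda>z. of_real (\<phi> (a i) * (cmod (coef (\<lambda>x. h x + z * k x) i))\<^sup>2)" for i]
    by (intro has_sum_cmult_left has_sum_add has_sum_cmult_right has_sum_of_real s) auto
  moreover have "(\<Sum>j<4. \<i> ^ j * of_real (\<phi> (a i) * (cmod (coef (\<lambda>x. h x + \<i> ^ j * k x) i))\<^sup>2)) / 4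
      = of_real (\<phi> (a i)) * coef h i * cnj (coef k i)" if "i \<in> I" for i
    using b_closed[OF that] hC kC
    by (subst sum_powers_ii[where f = "\<lambda>z. of_real (\<phi> (a i) * (cmod (coef (\<lambda>x. h x + z * k x) i))\<^sup>2)"])
      (simp add: complex_norm_square closed inner_add_left inner_diff_left inner_scale_left algebra_simps
        del: of_real_power)
  ultimately show ?thesis
    unfolding eq by (simp only: cong: has_sum_cong)
qed

text \<open>In one direction the weak identity is tested against the basis vectors, which lie in
  every spectral domain. In the other, the domain condition is the square summability of the
  coefficients of \<open>g\<close>, and the weak identity is Parseval.\<close>

theorem spectral_integral_diag:
  assumes [measurable]: "\<phi> \<in> borel_measurable borel"
  shows "spectral_integral H E \<phi> = diag_op (\<lambda>i. \<phi> (a i))"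
proof (intro equalityI subsetI)
  fix hg assume "hg \<in> spectral_integral H E \<phi>"
  then obtain h g where hg: "hg = (h, g)" "in_spectral_domain H E \<phi> h" "g \<in> hcarrier H"
    and eq: "\<And>k. in_spectral_domain H E \<phi> k \<Longrightarrow> hinner H g k = (\<Sum>j<4. \<i> ^ j * of_real
        (LINT t|scalar_spectral_measure H E (\<lambda>x. h x + \<i> ^ j * k x). \<phi> t)) / 4"
    by (auto simp: spectral_integral_def)
  have hC: "h \<in> hcarrier H" using hg by (simp add: in_spectral_domain_def)
  have "coef g i = of_real (\<phi> (a i)) * coef h i" if i: "i \<in> I" for i
  proof -
    have "(\<lambda>j. (\<phi> (a j))\<^sup>2 * (cmod (coef (b i) j))\<^sup>2) summable_on I"
      by (rule has_sum_imp_summable, rule has_sum_finite_neutralI[of "{i}", OF _ _ _ refl])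
        (use i in \<open>auto simp: coef_basis\<close>)
    then have dom: "in_spectral_domain H E \<phi> (b i)"
      by (simp add: in_spectral_domain_diag b_closed[OF i])
    have "((\<lambda>j. of_real (\<phi> (a j)) * coef h j * cnj (coef (b i) j)) has_sum hinner H g (b i)) I"
      unfolding eq[OF dom] by (rule spectral_sum_diag[OF assms hg(2) dom])
    moreover have "((\<lambda>j. of_real (\<phi> (a j)) * coef h j * cnj (coef (b i) j)) has_sum
        of_real (\<phi> (a i)) * coef h i) I"
      by (rule has_sum_finite_neutralI[of "{i}"]) (use i in \<open>auto simp: coef_basis\<close>)
    ultimately show ?thesis by (rule has_sum_unique)
  qed
  then show "hg \<in> diag_op (\<lambda>i. \<phi> (a i))" using hg hC by (simp add: diag_op_def)
next
  fix hg assume "hg \<in> diag_op (\<lambda>i. \<phi> (a i))"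
  then obtain h g where hg: "hg = (h, g)" "h \<in> hcarrier H" "g \<in> hcarrier H"
    and c: "\<And>i. i \<in> I \<Longrightarrow> coef g i = of_real (\<phi> (a i)) * coef h i"
    by (auto simp: diag_op_def)
  have "(\<lambda>i. (\<phi> (a i))\<^sup>2 * (cmod (coef h i))\<^sup>2) summable_on I"
    using coef_summable[OF hg(3)]
    by (rule summable_on_cong[THEN iffD1, rotated]) (simp add: c norm_mult power_mult_distrib)
  then have dom: "in_spectral_domain H E \<phi> h" by (simp add: in_spectral_domain_diag hg)
  have "hinner H g k = (\<Sum>j<4. \<i> ^ j * of_real
        (LINT t|scalar_spectral_measure H E (\<lambda>x. h x + \<i> ^ j * k x). \<phi> t)) / 4"
    if k: "in_spectral_domain H E \<phi> k" for k
  proof (rule has_sum_unique[OF _ spectral_sum_diag[OF assms dom k]])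
    have kC: "k \<in> hcarrier H" using k by (simp add: in_spectral_domain_def)
    show "((\<lambda>i. of_real (\<phi> (a i)) * coef h i * cnj (coef k i)) has_sum hinner H g k) I"
      using parseval_inner[OF onb total hg(3) kC]
      by (rule has_sum_cong[THEN iffD1, rotated]) (simp add: c)
  qed
  then show "hg \<in> spectral_integral H E \<phi>"
    unfolding spectral_integral_def using hg dom by auto
qed

end

lemma diag_projections_exist: "\<exists>E. diag_projections a E"
proof -
  have "\<exists>k. k \<in> hcarrier H \<and> (\<forall>i\<in>I. coef k i = (if a i \<in> S then coef h i else 0))"
    if h: "h \<in> hcarrier H" for S h
  proof -
    have "(\<lambda>i. (cmod (if a i \<in> S then coef h i else 0))\<^sup>2) summable_on I"
      using coef_summable[OF h] by (rule summable_on_comparison_test) auto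
    from riesz_fischer[OF onb this] show ?thesis by metis
  qed
  then have "\<forall>S h. \<exists>k. h \<in> hcarrier H \<longrightarrow> k \<in> hcarrier H \<and>
      (\<forall>i\<in>I. coef k i = (if a i \<in> S then coef h i else 0))"
    by blast
  then obtain E where "\<forall>S h. h \<in> hcarrier H \<longrightarrow>
      E S h \<in> hcarrier H \<and> (\<forall>i\<in>I. coef (E S h) i = (if a i \<in> S then coef h i else 0))"
    unfolding choice_iff by blast
  then have "diag_projections a E" unfolding diag_projections_def by blast
  then show ?thesis by blast
qed

end


section \<open>Arbitrary projection-valued measures\<close>

locale spectral_measure = hilbert_space H
  for H :: "'x hilbert" +
  fixes E :: "real set \<Rightarrow> ('x \<Rightarrow> complex) \<Rightarrow> ('x \<Rightarrow> complex)"
  assumes pvm: "projection_valued_measure H E"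
begin

lemma proj_closed: "\<lbrakk>S \<in> sets borel; f \<in> hcarrier H\<rbrakk> \<Longrightarrow> E S f \<in> hcarrier H"
  using pvm by (auto simp: projection_valued_measure_def orthogonal_projection_def)

lemma proj_sym:
  "\<lbrakk>S \<in> sets borel; f \<in> hcarrier H; g \<in> hcarrier H\<rbrakk> \<Longrightarrow> hinner H (E S f) g = hinner H f (E S g)"
  using pvm by (auto simp: projection_valued_measure_def orthogonal_projection_def)

lemma inner_eq_if_null_diff:
  assumes "f \<in> hcarrier H" "g \<in> hcarrier H" "k \<in> hcarrier H" "hnorm H (\<lambda>x. f x - g x) = 0"
  shows "hinner H f k = hinner H g k"
  using inner_null_left[of "\<lambda>x. f x - g x" k] assms by (simp add: closed inner_diff_left)

lemma proj_idem:
  assumes "S \<in> sets borel" "f \<in> hcarrier H" "g \<in> hcarrier H"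
  shows "hinner H (E S (E S f)) g = hinner H (E S f) g"
proof (rule inner_eq_if_null_diff)
  show "hnorm H (\<lambda>x. E S (E S f) x - E S f x) = 0"
    using pvm assms by (auto simp: projection_valued_measure_def orthogonal_projection_def heq_def)
qed (auto intro: proj_closed assms)

lemma proj_UNIV:
  assumes "f \<in> hcarrier H" "g \<in> hcarrier H"
  shows "hinner H (E UNIV f) g = hinner H f g"
proof (rule inner_eq_if_null_diff)
  show "hnorm H (\<lambda>x. E UNIV f x - f x) = 0"
    using pvm assms by (auto simp: projection_valued_measure_def heq_def)
qed (auto intro: proj_closed assms)

text \<open>The axioms give countable additivity only for the diagonal values <E S f, f>. These
  equal the squared norms of E S f, and every further property of \<open>E\<close> is extracted from
  this nonnegative set function.\<close>

definition q :: "('x \<Rightarrow> complex) \<Rightarrow> real set \<Rightarrow> real" where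
  "q f S = (hnorm H (E S f))\<^sup>2"

lemma q_nonneg: "0 \<le> q f S"
  by (simp add: q_def)

lemma inner_proj_proj:
  assumes "S \<in> sets borel" "f \<in> hcarrier H" "g \<in> hcarrier H"
  shows "hinner H (E S f) (E S g) = hinner H (E S f) g"
  using assms proj_sym[of S "E S f" g] proj_idem[of S f g] by (simp add: proj_closed)

lemma inner_proj_self:
  assumes "S \<in> sets borel" "f \<in> hcarrier H"
  shows "hinner H (E S f) f = of_real (q f S)"
  using assms inner_proj_proj[of S f f] by (simp add: q_def inner_self proj_closed)

lemma q_le: assumes "S \<in> sets borel" "f \<in> hcarrier H" shows "q f S \<le> (hnorm H f)\<^sup>2"
proof -
  have "q f S \<le> hnorm H (E S f) * hnorm H f"
    using cauchy_schwarz[OF proj_closed[OF assms] assms(2)] inner_proj_self[OF assms] q_nonneg[of f S]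
    by simp
  then have "hnorm H (E S f) * (hnorm H f - hnorm H (E S f)) \<ge> 0"
    by (simp add: q_def power2_eq_square algebra_simps)
  then have "hnorm H (E S f) \<le> hnorm H f"
    using hnorm_nonneg[OF proj_closed[OF assms]] hnorm_nonneg[OF assms(2)]
    by (cases "hnorm H (E S f) = 0") (auto simp: zero_le_mult_iff)
  then show ?thesis
    unfolding q_def by (intro power_mono hnorm_nonneg proj_closed assms)
qed

lemma q_sums:
  assumes A: "range A \<subseteq> sets borel" "disjoint_family A" and f: "f \<in> hcarrier H"
  shows "(\<lambda>n::nat. q f (A n)) sums q f (\<Union>n. A n)"
proof -
  have "(\<lambda>n::nat. hinner H (E (A n) f) f) sums hinner H (E (\<Union>n. A n) f) f"
    using pvm A f by (auto simp: projection_valued_measure_def)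
  moreover have "A n \<in> sets borel" for n using A by auto
  ultimately have "(\<lambda>n. complex_of_real (q f (A n))) sums of_real (q f (\<Union>n. A n))"
    using f A by (simp add: inner_proj_self sets.countable_UN)
  then show ?thesis by (simp only: sums_of_real_iff)
qed

text \<open>The empty set is a disjoint union of infinitely many copies of itself, and a constant
  series converges only if its terms vanish.\<close>

lemma q_empty: assumes f: "f \<in> hcarrier H" shows "q f {} = 0"
proof -
  have "(\<lambda>n::nat. q f {}) sums q f {}"
    using q_sums[of "\<lambda>_. {}" f] f by (simp add: disjoint_family_on_def)
  then show ?thesis using sums_summable summable_const_iff by blast
qed

lemma q_Un:
  assumes "A \<in> sets borel" "B \<in> sets borel" "A \<inter> B = {}" "f \<in> hcarrier H"
  shows "q f (A \<union> B) = q f A + q f B"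
proof -
  have "(\<lambda>n. q f (binaryset A B n)) sums q f (\<Union>n. binaryset A B n)"
    using assms by (intro q_sums) (auto simp: range_binaryset_eq disjoint_family_on_def binaryset_def)
  moreover have "(\<lambda>n. q f (binaryset A B n)) sums (q f A + q f B)"
    by (rule binaryset_sums) (rule q_empty[OF assms(4)])
  ultimately show ?thesis using sums_unique2 by (simp add: UN_binaryset_eq) blast
qed

lemma q_split:
  assumes "A \<in> sets borel" "S \<in> sets borel" "f \<in> hcarrier H"
  shows "q f A = q f (A \<inter> S) + q f (A - S)"
  using q_Un[of "A \<inter> S" "A - S" f] assms by (simp add: Int_Diff_disjoint Int_Diff_Un)

lemma q_mono:
  assumes "A \<in> sets borel" "S \<in> sets borel" "f \<in> hcarrier H" "A \<subseteq> S"
  shows "q f A \<le> q f S"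
  using q_split[of S A f] assms q_nonneg[of f "S - A"] by (simp add: Int_absorb1)

text \<open>By idempotence \<open>E A f\<close> already has its full squared norm on
  \<open>A\<close>; additivity and \<open>q_le\<close> leave nothing for a set disjoint from
  \<open>A\<close>.\<close>

lemma q_disjoint:
  assumes "A \<in> sets borel" "B \<in> sets borel" "A \<inter> B = {}" and f: "f \<in> hcarrier H"
  shows "q (E A f) B = 0"
proof -
  have k: "E A f \<in> hcarrier H" using assms by (simp add: proj_closed)
  have "of_real (q (E A f) A) = hinner H (E A f) (E A f)"
    using inner_proj_self[of A "E A f"] proj_idem[of A f "E A f"] assms k by simp
  then have "q (E A f) A = (hnorm H (E A f))\<^sup>2"
    by (simp only: inner_self[OF k] of_real_eq_iff)
  moreover have "q (E A f) (A \<union> B) = q (E A f) A + q (E A f) B"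
    using assms k by (intro q_Un)
  moreover have "q (E A f) (A \<union> B) \<le> (hnorm H (E A f))\<^sup>2"
    using assms k by (intro q_le) auto
  ultimately show ?thesis using q_nonneg[of "E A f" B] by simp
qed

text \<open>The squared norm of E S k - k expands to the squared norm of k minus
  \<open>q k S\<close>, which is the mass of k off S.\<close>

lemma proj_absorb:
  assumes S: "S \<in> sets borel" and k: "k \<in> hcarrier H" and g: "g \<in> hcarrier H"
    and null: "q k (- S) = 0"
  shows "hinner H (E S k) g = hinner H k g"
proof (rule inner_eq_if_null_diff)
  have kE: "E S k \<in> hcarrier H" using S k by (rule proj_closed)
  have "q k UNIV = (hnorm H k)\<^sup>2"
    using proj_UNIV[OF k k] inner_proj_self[of UNIV k] k inner_self[OF k]
    by (simp del: of_real_power)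
  then have qS: "q k S = (hnorm H k)\<^sup>2"
    using q_split[of UNIV S k] S k null by (simp add: Compl_eq_Diff_UNIV)
  have "hinner H k (E S k) = of_real (q k S)"
    using proj_sym[OF S k k] inner_proj_self[OF S k] by simp
  then have "(hnorm H (\<lambda>x. E S k x - k x))\<^sup>2 = q k S - q k S - (q k S - (hnorm H k)\<^sup>2)"
    using k kE inner_proj_self[OF S k] inner_proj_proj[OF S k k]
    by (subst hnorm_power2) (simp_all add: closed inner_diff_left inner_diff_right inner_self q_def)
  then show "hnorm H (\<lambda>x. E S k x - k x) = 0" using qS by simp
qed (auto intro: proj_closed assms)

text \<open>Multiplicativity is not among the axioms; it follows from additivity and idempotence. It
  is stated against a test vector because values of \<open>E\<close> are determined only up to norm
  0.\<close>

lemma proj_mult: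
  assumes A: "A \<in> sets borel" and S: "S \<in> sets borel" and f: "f \<in> hcarrier H" and g: "g \<in> hcarrier H"
  shows "hinner H (E A (E S f)) g = hinner H (E (A \<inter> S) f) g"
proof -
  have AS: "A \<inter> S \<in> sets borel" using A S by simp
  define k where "k = E S f"
  have k: "k \<in> hcarrier H" using S f by (simp add: k_def proj_closed)
  have sub: "hinner H (E B (E C h)) g = hinner H (E C h) g"
    if "B \<in> sets borel" "C \<in> sets borel" "C \<subseteq> B" "h \<in> hcarrier H" "g \<in> hcarrier H" for B C h g
    using that by (intro proj_absorb q_disjoint proj_closed) auto
  \<comment> \<open>The opposite order of the projections is obtained from \<open>sub\<close> by
    taking adjoints.\<close>
  have sub': "hinner H (E C (E B h)) g = hinner H (E C h) g"
    if "B \<in> sets borel" "C \<in> sets borel" "C \<subseteq> B" "h \<in> hcarrier H" "g \<in> hcarrier H" for B C h g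
  proof -
    have "hinner H (E C (E B h)) g = hinner H h (E B (E C g))"
      using that by (simp add: proj_sym proj_closed)
    also have "\<dots> = cnj (hinner H (E B (E C g)) h)"
      using that inner_commute[of "E B (E C g)" h] by (simp add: proj_closed)
    also have "\<dots> = hinner H h (E C g)"
      using that inner_commute[of "E C g" h] by (simp add: proj_closed sub)
    finally show ?thesis using that by (simp add: proj_sym)
  qed
  \<comment> \<open>The vector k = E S f carries no mass off S, so A and its intersection with S
    give k the same mass; hence the two projections of k differ by a null vector.\<close>
  have "q k (A - S) \<le> q k (- S)" using A S k by (intro q_mono) auto
  also have "\<dots> = 0" unfolding k_def using S f by (intro q_disjoint) auto
  finally have qk: "q k A = q k (A \<inter> S)"
    using q_split[OF A S k] q_nonneg[of k "A - S"] by simp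
  have EA: "E A k \<in> hcarrier H" and EAS: "E (A \<inter> S) k \<in> hcarrier H"
    using A AS k by (auto intro: proj_closed)
  have c1: "hinner H (E (A \<inter> S) k) (E A k) = of_real (q k (A \<inter> S))"
    using proj_sym[OF A EAS k] sub[OF A AS _ k k] inner_proj_self[OF AS k] by simp
  then have c2: "hinner H (E A k) (E (A \<inter> S) k) = of_real (q k (A \<inter> S))"
    using inner_commute[OF EAS EA] by simp
  have "(hnorm H (\<lambda>x. E A k x - E (A \<inter> S) k x))\<^sup>2 = q k A - q k (A \<inter> S)"
    using EA EAS by (simp add: hnorm_power2 closed inner_diff_left inner_diff_right c1 c2)
      (simp add: inner_self q_def)
  then have "hinner H (E A k) g = hinner H (E (A \<inter> S) k) g"
    using qk by (intro inner_eq_if_null_diff EA EAS g) simp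
  also have "\<dots> = hinner H (E (A \<inter> S) f) g"
    unfolding k_def using S AS f g by (intro sub') auto
  finally show ?thesis by (simp add: k_def)
qed

lemma emeasure_scalar_spectral_measure:
  assumes f: "f \<in> hcarrier H" and A: "A \<in> sets borel"
  shows "emeasure (scalar_spectral_measure H E f) A = ennreal (q f A)"
proof -
  have eq: "Re (hinner H (E S f) f) = q f S" if "S \<in> sets borel" for S
    using inner_proj_self[OF that f] by simp
  have "emeasure (scalar_spectral_measure H E f) A = ennreal (Re (hinner H (E A f) f))"
  proof (rule emeasure_measure_of[OF scalar_spectral_measure_def])
    show "positive (sets (scalar_spectral_measure H E f)) (\<lambda>S. ennreal (Re (hinner H (E S f) f)))"
      using f by (simp add: positive_def eq q_empty)
    show "countably_additive (sets (scalar_spectral_measure H E f)) (\<lambda>S. ennreal (Re (hinner H (E S f) f)))"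
    proof (rule countably_additiveI)
      fix B :: "nat \<Rightarrow> real set"
      assume B: "range B \<subseteq> sets (scalar_spectral_measure H E f)" "disjoint_family B"
      have sets: "sets (scalar_spectral_measure H E f) = sets borel"
        using sets.sigma_sets_eq[of "borel :: real measure"]
        by (simp add: scalar_spectral_measure_def)
      with B have B': "range B \<subseteq> sets borel" "\<And>n. B n \<in> sets borel" by auto
      have "(\<lambda>n. q f (B n)) sums q f (\<Union>n. B n)" using B B' f by (intro q_sums)
      then have "(\<Sum>n. ennreal (q f (B n))) = ennreal (q f (\<Union>n. B n))"
        using q_nonneg by (intro suminf_ennreal_eq) auto
      then show "(\<Sum>n. ennreal (Re (hinner H (E (B n) f) f))) =
          ennreal (Re (hinner H (E (\<Union>n. B n) f) f))"
        using B' by (simp add: eq sets.countable_UN)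
    qed
    show "A \<in> sets (scalar_spectral_measure H E f)"
      using A sets.sigma_sets_eq[of "borel :: real measure"] by (simp add: scalar_spectral_measure_def)
  qed auto
  then show ?thesis using eq[OF A] by simp
qed

lemma sets_scalar_spectral_measure [simp, measurable_cong]:
  "sets (scalar_spectral_measure H E f) = sets borel"
  using sets.sigma_sets_eq[of "borel :: real measure"] by (simp add: scalar_spectral_measure_def)

lemma space_scalar_spectral_measure [simp]: "space (scalar_spectral_measure H E f) = UNIV"
  by (simp add: scalar_spectral_measure_def)

text \<open>The vector f + c E S f is (1 + c) f on S and f off S, whence the density. With it, all
  four measures in the polarized weak identity for k = E S f become densities with respect to the
  single measure of \<open>f\<close>.\<close>

lemma scalar_spectral_measure_combination:
  assumes S: "S \<in> sets borel" and f: "f \<in> hcarrier H"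
  shows "scalar_spectral_measure H E (\<lambda>x. f x + c * E S f x) =
    density (scalar_spectral_measure H E f) (\<lambda>t. if t \<in> S then ennreal ((cmod (1 + c))\<^sup>2) else 1)"
proof (rule measure_eqI)
  fix A assume "A \<in> sets (scalar_spectral_measure H E (\<lambda>x. f x + c * E S f x))"
  then have A: "A \<in> sets borel" by simp
  let ?g = "\<lambda>x. f x + c * E S f x" and ?\<mu> = "scalar_spectral_measure H E f"
  have k: "E S f \<in> hcarrier H" using S f by (rule proj_closed)
  have g: "?g \<in> hcarrier H" using k f by (intro closed)
  have AS: "A \<inter> S \<in> sets borel" "S \<inter> A \<in> sets borel" using A S by auto
  have lin: "hinner H (E A ?g) h = hinner H (E A f) h + c * hinner H (E A (E S f)) h"
    if "h \<in> hcarrier H" for h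
    using that A f k proj_sym[of A ?g h] proj_closed[of A h]
    by (simp add: closed proj_closed proj_sym inner_add_left inner_scale_left)
  have 1: "hinner H (E A f) (E S f) = of_real (q f (A \<inter> S))"
    using proj_sym[of S "E A f" f] proj_mult[OF S A f f] inner_proj_self[OF AS(2) f] A S f
    by (simp add: proj_closed Int_commute)
  have 2: "hinner H (E A (E S f)) f = of_real (q f (A \<inter> S))"
    using proj_mult[OF A S f f] inner_proj_self[OF AS(1) f] by simp
  have 3: "hinner H (E A (E S f)) (E S f) = of_real (q f (A \<inter> S))"
    using proj_mult[OF A S f k] proj_sym[OF S proj_closed[OF AS(1) f] f] proj_mult[OF S AS(1) f f]
      inner_proj_self[OF AS(1) f]
    by (simp add: Int_commute Int_left_commute)
  have "of_real (q ?g A) = hinner H (E A ?g) ?g" using inner_proj_self[OF A g] by simp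
  also have "\<dots> = hinner H (E A f) ?g + c * hinner H (E A (E S f)) ?g" by (rule lin[OF g])
  also have "\<dots> = of_real (q f A) + cnj c * of_real (q f (A \<inter> S)) +
      c * (of_real (q f (A \<inter> S)) + cnj c * of_real (q f (A \<inter> S)))"
    using A f k by (simp add: inner_add_right inner_scale_right closed proj_closed 1 2 3
        inner_proj_self)
  also have "\<dots> = of_real (q f (A - S)) + ((1 + c) * cnj (1 + c)) * of_real (q f (A \<inter> S))"
    by (simp add: q_split[OF A S f] algebra_simps)
  also have "\<dots> = of_real (q f (A - S) + (cmod (1 + c))\<^sup>2 * q f (A \<inter> S))"
    by (simp only: complex_norm_square[symmetric] of_real_add of_real_mult)
  finally have qg: "q ?g A = (cmod (1 + c))\<^sup>2 * q f (A \<inter> S) + q f (A - S)"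
    by (simp only: of_real_eq_iff)
  have "emeasure (density ?\<mu> (\<lambda>t. if t \<in> S then ennreal ((cmod (1 + c))\<^sup>2) else 1)) A =
      (\<integral>\<^sup>+ t. ennreal ((cmod (1 + c))\<^sup>2) * indicator (A \<inter> S) t + indicator (A - S) t \<partial>?\<mu>)"
    using A S by (subst emeasure_density) (auto intro!: nn_integral_cong split: split_indicator)
  also have "\<dots> = ennreal ((cmod (1 + c))\<^sup>2) * ennreal (q f (A \<inter> S)) + ennreal (q f (A - S))"
    using A S f by (subst nn_integral_add)
      (auto simp: nn_integral_cmult_indicator emeasure_scalar_spectral_measure)
  also have "\<dots> = ennreal (q ?g A)"
    unfolding qg by (simp add: ennreal_plus ennreal_mult q_nonneg)
  finally show "emeasure (scalar_spectral_measure H E ?g) A =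
      emeasure (density ?\<mu> (\<lambda>t. if t \<in> S then ennreal ((cmod (1 + c))\<^sup>2) else 1)) A"
    using A g by (simp add: emeasure_scalar_spectral_measure)
qed simp

lemma scalar_spectral_measure_proj:
  assumes S: "S \<in> sets borel" and f: "f \<in> hcarrier H"
  shows "scalar_spectral_measure H E (E S f) = density (scalar_spectral_measure H E f) (indicator S)"
proof (rule measure_eqI)
  fix A assume "A \<in> sets (scalar_spectral_measure H E (E S f))"
  then have A: "A \<in> sets borel" by simp
  have AS: "A \<inter> S \<in> sets borel" using A S by auto
  have k: "E S f \<in> hcarrier H" using S f by (rule proj_closed)
  have "of_real (q (E S f) A) = hinner H (E A (E S f)) (E S f)"
    using inner_proj_self[OF A k] by simp
  also have "\<dots> = of_real (q f (A \<inter> S))"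
    using proj_mult[OF A S f k] proj_sym[OF S proj_closed[OF AS f] f] proj_mult[OF S AS f f]
      inner_proj_self[OF AS f]
    by (simp add: Int_commute Int_left_commute)
  finally have "q (E S f) A = q f (A \<inter> S)" by (simp only: of_real_eq_iff)
  moreover have "emeasure (density (scalar_spectral_measure H E f) (indicator S)) A =
      emeasure (scalar_spectral_measure H E f) (A \<inter> S)"
    using A S by (subst emeasure_density) (auto simp: indicator_inter_arith[symmetric] Int_commute
        intro!: nn_integral_indicator)
  ultimately show "emeasure (scalar_spectral_measure H E (E S f)) A =
      emeasure (density (scalar_spectral_measure H E f) (indicator S)) A"
    using A AS f k by (simp add: emeasure_scalar_spectral_measure)
qed simp

text \<open>An eigenvector is fixed by the projection to its eigenvalue: testing the weak identity
  against \<open>E S f\<close> shows that the integral of \<open>t - \<lambda>\<close> over \<open>S\<close> vanishes for every Borel set \<open>S\<close>.\<close>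

lemma eigenvector_concentrated:
  assumes eig: "(f, \<lambda>x. of_real l * f x) \<in> spectral_integral H E (\<lambda>t. t)"
  shows "q f (- {l}) = 0"
proof -
  let ?\<mu> = "scalar_spectral_measure H E f"
  have dom: "in_spectral_domain H E (\<lambda>t. t) f"
    and weak: "\<And>k. in_spectral_domain H E (\<lambda>t. t) k \<Longrightarrow> hinner H (\<lambda>x. of_real l * f x) k =
        (\<Sum>j<4. \<i> ^ j * of_real (LINT t|scalar_spectral_measure H E (\<lambda>x. f x + \<i> ^ j * k x). t)) / 4"
    using eig by (auto simp: spectral_integral_def)
  have f: "f \<in> hcarrier H" and sq: "(\<integral>\<^sup>+ t. ennreal (t\<^sup>2) \<partial>?\<mu>) < \<infinity>"
    using dom by (auto simp: in_spectral_domain_def)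
  interpret finite_measure ?\<mu>
    by (rule finite_measureI) (simp add: emeasure_scalar_spectral_measure f)
  have int2: "integrable ?\<mu> (\<lambda>t. t\<^sup>2)"
    using sq by (intro integrableI_nonneg) auto
  have int: "integrable ?\<mu> (\<lambda>t. t)"
  proof (rule Bochner_Integration.integrable_bound)
    show "integrable ?\<mu> (\<lambda>t. 1 + t\<^sup>2)" using int2 by simp
    have "\<bar>t\<bar> \<le> 1 + t\<^sup>2" for t :: real using sum_squares_bound[of 1 "\<bar>t\<bar>"] by simp
    then show "AE t in ?\<mu>. norm t \<le> norm (1 + t\<^sup>2)" by (auto intro!: AE_I2 order_trans[OF _ abs_ge_self])
  qed simp
  have key: "(LINT t|?\<mu>. indicator S t * (t - l)) = 0" if S: "S \<in> sets borel" for S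
  proof -
    have k: "E S f \<in> hcarrier H" using S f by (rule proj_closed)
    have "(\<integral>\<^sup>+ t. ennreal (t\<^sup>2) \<partial>scalar_spectral_measure H E (E S f)) \<le> (\<integral>\<^sup>+ t. ennreal (t\<^sup>2) \<partial>?\<mu>)"
      unfolding scalar_spectral_measure_proj[OF S f] using S
      by (subst nn_integral_density) (auto intro!: nn_integral_mono split: split_indicator)
    then have domk: "in_spectral_domain H E (\<lambda>t. t) (E S f)"
      using k sq by (auto simp: in_spectral_domain_def)
    define W where "W c t = (if t \<in> S then (cmod (1 + c))\<^sup>2 else 1)" for c and t :: real
    have [measurable]: "W c \<in> borel_measurable borel" for c unfolding W_def using S by measurable
    have intW: "integrable ?\<mu> (\<lambda>t. W c t * t)" for c
    proof (rule Bochner_Integration.integrable_bound)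
      show "integrable ?\<mu> (\<lambda>t. (1 + (cmod (1 + c))\<^sup>2) * t)" using int by simp
      have "\<bar>W c t\<bar> \<le> \<bar>1 + (cmod (1 + c))\<^sup>2\<bar>" for t by (simp add: W_def)
      then show "AE t in ?\<mu>. norm (W c t * t) \<le> norm ((1 + (cmod (1 + c))\<^sup>2) * t)"
        unfolding real_norm_def abs_mult by (intro AE_I2 mult_right_mono) auto
    qed simp
    have L: "(LINT t|scalar_spectral_measure H E (\<lambda>x. f x + c * E S f x). t) = (LINT t|?\<mu>. W c t * t)"
      for c
    proof -
      have "scalar_spectral_measure H E (\<lambda>x. f x + c * E S f x) = density ?\<mu> (\<lambda>t. ennreal (W c t))"
        unfolding scalar_spectral_measure_combination[OF S f]
        by (rule arg_cong[where f = "density _"]) (auto simp: W_def fun_eq_iff)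
      moreover have "0 \<le> W c t" for t by (simp add: W_def)
      ultimately show ?thesis by (simp add: integral_density)
    qed
    \<comment> \<open>Both weights are 2 on S and 1 off S, so the two imaginary terms of the
      polarization cancel. The weights for c = 1 and c = -1 are 4 and 0 on S and agree off S; a
      quarter of their difference is the indicator of S.\<close>
    have "W \<i> = W (- \<i>)" by (auto simp: W_def fun_eq_iff cmod_def)
    then have "of_real l * of_real (q f S) = complex_of_real ((LINT t|?\<mu>. W 1 t * t) - (LINT t|?\<mu>. W (- 1) t * t)) / 4"
    proof -
      have "hinner H f (E S f) = of_real (q f S)"
        using proj_sym[OF S f f] inner_proj_self[OF S f] by simp
      then have "of_real l * of_real (q f S) = hinner H (\<lambda>x. of_real l * f x) (E S f)"
        using f k by (simp add: inner_scale_left)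
      also have "\<dots> = (\<Sum>j<4. \<i> ^ j * of_real (LINT t|?\<mu>. W (\<i> ^ j) t * t)) / 4"
        unfolding weak[OF domk] L ..
      also have "\<dots> = complex_of_real ((LINT t|?\<mu>. W 1 t * t) - (LINT t|?\<mu>. W (- 1) t * t)) / 4"
        unfolding sum_powers_ii[where f = "\<lambda>z. of_real (LINT t|?\<mu>. W z t * t)"]
        using \<open>W \<i> = W (- \<i>)\<close> by simp
      finally show ?thesis .
    qed
    then have "l * q f S = ((LINT t|?\<mu>. W 1 t * t) - (LINT t|?\<mu>. W (- 1) t * t)) / 4"
      by (metis (no_types) of_real_divide of_real_eq_iff of_real_mult of_real_numeral)
    also have "\<dots> = (LINT t|?\<mu>. (W 1 t * t - W (- 1) t * t) / 4)"
      using intW by simp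
    also have "\<dots> = (LINT t|?\<mu>. indicator S t * t)"
      by (intro Bochner_Integration.integral_cong) (auto simp: W_def)
    finally have 1: "l * q f S = (LINT t|?\<mu>. indicator S t * t)" .
    have 2: "(LINT t|?\<mu>. indicator S t) = q f S"
      using S by (simp add: measure_def emeasure_scalar_spectral_measure f q_nonneg)
    have i1: "integrable ?\<mu> (\<lambda>t. indicator S t * t)"
      using integrable_mult_indicator[OF _ int, of S] S by simp
    have i2: "integrable ?\<mu> (\<lambda>t. indicator S t * l)"
      using S by (simp add: emeasure_scalar_spectral_measure f)
    have "(LINT t|?\<mu>. indicator S t * (t - l)) = (LINT t|?\<mu>. indicator S t * t - indicator S t * l)"
      by (simp add: right_diff_distrib)
    also have "\<dots> = l * q f S - l * q f S"
      unfolding Bochner_Integration.integral_diff[OF i1 i2] 1[symmetric] using 2 by simp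
    finally show ?thesis by simp
  qed
  \<comment> \<open>The factor s only adjusts the sign: s = 1 serves the half-line above l and s =
    -1 the one below. A nonnegative integrand of integral 0 vanishes almost everywhere.\<close>
  have null: "q f S = 0" if S: "S \<in> sets borel" and sgn: "\<And>t. t \<in> S \<Longrightarrow> 0 < s * (t - l)" for S s
  proof -
    have "AE t in ?\<mu>. s * (indicator S t * (t - l)) = 0"
    proof (subst integral_nonneg_eq_0_iff_AE[symmetric])
      have "integrable ?\<mu> (\<lambda>t. t - l)" using int by simp
      then show "integrable ?\<mu> (\<lambda>t. s * (indicator S t * (t - l)))"
        using integrable_mult_indicator[of S ?\<mu> "\<lambda>t. t - l"] S by simp
      show "AE t in ?\<mu>. 0 \<le> s * (indicator S t * (t - l))"
        using sgn by (auto split: split_indicator intro: less_imp_le)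
      show "(LINT t|?\<mu>. s * (indicator S t * (t - l))) = 0" using key[OF S] by simp
    qed
    then have "AE t in ?\<mu>. t \<notin> S"
      by eventually_elim (use sgn in \<open>force split: split_indicator_asm\<close>)
    then have "emeasure ?\<mu> S = 0" using S by (subst (asm) AE_iff_measurable[of S]) auto
    then show ?thesis
      using S q_nonneg[of f S] by (simp add: emeasure_scalar_spectral_measure f)
  qed
  have "- {l} = {l<..} \<union> {..<l}" by auto
  moreover have "q f ({l<..} \<union> {..<l}) = q f {l<..} + q f {..<l}"
    using f by (intro q_Un) auto
  ultimately have "q f (- {l}) = q f {l<..} + q f {..<l}" by (simp only:)
  also have "\<dots> = 0" using null[of "{l<..}" 1] null[of "{..<l}" "-1"] by simp
  finally show ?thesis .
qed

end

section \<open>Functional calculus and trace for an unspecified choice\<close>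

context hilbert_basis begin

lemma basis_in_diag_op: "i \<in> I \<Longrightarrow> (b i, \<lambda>x. of_real (a i) * b i x) \<in> diag_op a"
  by (auto simp: diag_op_def b_closed closed inner_scale_left coef_basis)

text \<open>Uniqueness of the resolution. The spectral measure of b i sits at the point a i, so
  \<open>E S\<close> either fixes b i or annihilates it, up to norm 0; symmetry of
  \<open>E S\<close> transfers this to the coefficients of every h.\<close>

lemma resolution_imp_diag_projections:
  assumes res: "spectral_resolution H (diag_op a) E"
  shows "diag_projections a E"
proof -
  interpret spectral_measure H E
    using res by unfold_locales (simp add: spectral_resolution_def)
  have "coef (E S h) i = (if a i \<in> S then coef h i else 0)"
    if S: "S \<in> sets borel" and h: "h \<in> hcarrier H" and i: "i \<in> I" for S h i
  proof -
    have bi: "b i \<in> hcarrier H" using i by (rule b_closed)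
    have 0: "q (b i) (- {a i}) = 0"
      using res basis_in_diag_op[OF i, of a]
      by (intro eigenvector_concentrated) (simp add: spectral_resolution_def)
    have E: "E S (b i) \<in> hcarrier H" using S bi by (rule proj_closed)
    show ?thesis
    proof (cases "a i \<in> S")
      case True
      have "q (b i) (- S) \<le> q (b i) (- {a i})"
        using S bi True by (intro q_mono) auto
      then have "q (b i) (- S) = 0" using 0 q_nonneg[of "b i" "- S"] by simp
      then have "hinner H (E S (b i)) h = hinner H (b i) h" by (rule proj_absorb[OF S bi h])
      then have "hinner H h (E S (b i)) = hinner H h (b i)"
        using inner_commute[OF E h] inner_commute[OF bi h] by simp
      then show ?thesis using True proj_sym[OF S h bi] by simp
    next
      case False
      have "q (b i) S \<le> q (b i) (- {a i})"
        using S bi False by (intro q_mono) auto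
      then have "hnorm H (E S (b i)) = 0" using 0 by (simp add: q_def)
      then have "hinner H h (E S (b i)) = 0"
        using inner_null_left[OF E h] inner_commute[OF E h] by simp
      then show ?thesis using False proj_sym[OF S h bi] by simp
    qed
  qed
  then show ?thesis by (auto simp: diag_projections_def proj_closed)
qed

text \<open>Existence makes the choice in \<open>functional_calculus\<close> meaningful; uniqueness
  shows that any resolution it may return yields the same integral.\<close>

theorem functional_calculus_diag:
  assumes "\<phi> \<in> borel_measurable borel"
  shows "functional_calculus H (diag_op a) \<phi> = diag_op (\<lambda>i. \<phi> (a i))"
proof -
  obtain E where E: "diag_projections a E" using diag_projections_exist by blast
  have "spectral_resolution H (diag_op a) E"
    using projection_valued_measure_diag[OF E] spectral_integral_diag[OF E, of "\<lambda>t. t"]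
    by (simp add: spectral_resolution_def)
  then have "spectral_resolution H (diag_op a) (SOME E. spectral_resolution H (diag_op a) E)"
    by (rule someI[where P = "spectral_resolution H (diag_op a)"])
  from spectral_integral_diag[OF resolution_imp_diag_projections[OF this] assms]
  show ?thesis by (simp add: functional_calculus_def)
qed

text \<open>Both traces are iterated sums of a i |<e, b i>|^2, once with e and once with i outside,
  and Tonelli identifies them. The bound by 1 makes the operator everywhere defined, so that each
  vector of the chosen basis has an image.\<close>

theorem positive_trace_diag:
  assumes a: "\<And>i. i \<in> I \<Longrightarrow> 0 \<le> a i" "\<And>i. i \<in> I \<Longrightarrow> a i \<le> 1"
  shows "positive_trace H (diag_op a) = (\<integral>\<^sup>+ i. ennreal (a i) \<partial>count_space I)"
proof -
  define B where "B = (SOME B. orthonormal_basis H B)"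
  have "inj_on b I"
    by (rule inj_onI) (metis coef_basis zero_neq_one)
  then have "orthonormal_basis H (b ` I)"
    unfolding orthonormal_basis_def using total coef_basis
    by (auto simp: b_closed total_def inj_on_eq_iff)
  then have "orthonormal_basis H B" unfolding B_def by (rule someI)
  then have B: "orthonormal (\<lambda>e. e) B" "total (\<lambda>e. e) B"
    by (auto simp: orthonormal_basis_def orthonormal_def total_def)
  have BC: "e \<in> hcarrier H" if "e \<in> B" for e using orthonormal_closed[OF B(1) that] .
  have tr: "ennreal (Re (hinner H (SOME g. (e, g) \<in> diag_op a) e)) =
      (\<integral>\<^sup>+ i. ennreal (a i * (cmod (coef e i))\<^sup>2) \<partial>count_space I)" if "e \<in> B" for e
  proof -
    have e: "e \<in> hcarrier H" using that by (rule BC)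
    have "(\<lambda>i. (cmod (of_real (a i) * coef e i))\<^sup>2) summable_on I"
      using coef_summable[OF e]
    proof (rule summable_on_comparison_test)
      fix i assume "i \<in> I"
      then show "(cmod (of_real (a i) * coef e i))\<^sup>2 \<le> (cmod (coef e i))\<^sup>2"
        using a[of i] by (simp add: norm_mult power_mult_distrib mult_left_le_one_le power_le_one)
    qed auto
    from riesz_fischer[OF onb this] obtain g where "g \<in> hcarrier H"
      "\<And>i. i \<in> I \<Longrightarrow> coef g i = of_real (a i) * coef e i" by blast
    then have "(e, g) \<in> diag_op a" using e by (simp add: diag_op_def)
    then have "\<exists>g. (e, g) \<in> diag_op a" by blast
    \<comment> \<open>Whatever image is chosen, its coefficients are prescribed, and the inner
      product with e depends on nothing else.\<close>
    then have "(e, SOME g. (e, g) \<in> diag_op a) \<in> diag_op a" by (rule someI_ex)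
    then obtain g where gdef: "g = (SOME g. (e, g) \<in> diag_op a)" and g: "g \<in> hcarrier H"
      and c: "\<And>i. i \<in> I \<Longrightarrow> coef g i = of_real (a i) * coef e i"
      by (auto simp: diag_op_def)
    have "((\<lambda>i. complex_of_real (a i * (cmod (coef e i))\<^sup>2)) has_sum hinner H g e) I"
      using parseval_inner[OF onb total g e]
      by (rule has_sum_cong[THEN iffD1, rotated])
        (simp add: c complex_norm_square mult.assoc del: of_real_power)
    from has_sum_Re[OF this] have "((\<lambda>i. a i * (cmod (coef e i))\<^sup>2) has_sum Re (hinner H g e)) I"
      by simp
    then show ?thesis
      unfolding gdef[symmetric] using a by (intro nn_integral_count_space_has_sum[symmetric]) auto
  qed
  \<comment> \<open>The sum over \<open>B\<close> is Parseval for the unit vector b i in the chosen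
    basis.\<close>
  have row: "(\<integral>\<^sup>+ e. ennreal (a i * (cmod (coef e i))\<^sup>2) \<partial>count_space B) = ennreal (a i)"
    if i: "i \<in> I" for i
  proof (rule nn_integral_count_space_has_sum)
    have "(hnorm H (b i))\<^sup>2 = 1"
      using coef_basis[OF i i] by (simp add: hnorm_power2 b_closed[OF i])
    then have "((\<lambda>e. (cmod (hinner H (b i) e))\<^sup>2) has_sum 1) B"
      using parseval[OF B b_closed[OF i]] by (simp only:)
    moreover have "cmod (hinner H (b i) e) = cmod (coef e i)" if "e \<in> B" for e
      using inner_commute[OF b_closed[OF i] BC[OF that]] by simp
    ultimately have "((\<lambda>e. (cmod (coef e i))\<^sup>2) has_sum 1) B"
      by (simp only: cong: has_sum_cong)
    from has_sum_cmult_right[OF this, of "a i"]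
    show "((\<lambda>e. a i * (cmod (coef e i))\<^sup>2) has_sum a i) B" by simp
  qed (use a i in auto)
  \<comment> \<open>Indicators extend both sums to the full types, where the interchange of counting
    measures is applied.\<close>
  let ?F = "\<lambda>(e, i). ennreal (a i * (cmod (coef e i))\<^sup>2) * indicator I i * indicator B e"
  have "positive_trace H (diag_op a) =
      (\<integral>\<^sup>+ e. (\<integral>\<^sup>+ i. ennreal (a i * (cmod (coef e i))\<^sup>2) \<partial>count_space I) \<partial>count_space B)"
    unfolding positive_trace_def Let_def B_def[symmetric] by (intro nn_integral_cong) (simp add: tr)
  also have "\<dots> = (\<integral>\<^sup>+ e. \<integral>\<^sup>+ i. ?F (e, i) \<partial>count_space UNIV \<partial>count_space UNIV)"
    by (simp add: nn_integral_count_space_indicator nn_integral_multc)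
  also have "\<dots> = (\<integral>\<^sup>+ i. \<integral>\<^sup>+ e. ?F (e, i) \<partial>count_space UNIV \<partial>count_space UNIV)"
    unfolding nn_integral_fst_count_space nn_integral_snd_count_space ..
  also have "\<dots> = (\<integral>\<^sup>+ i. (\<integral>\<^sup>+ e. ennreal (a i * (cmod (coef e i))\<^sup>2) \<partial>count_space B) \<partial>count_space I)"
    by (simp add: nn_integral_count_space_indicator nn_integral_cmult mult_ac)
  also have "\<dots> = (\<integral>\<^sup>+ i. ennreal (a i) \<partial>count_space I)"
    by (intro nn_integral_cong) (simp add: row)
  finally show ?thesis .
qed

end


subsection \<open>L2 spaces and Hilbert sums\<close>

lemma integrable_mult_cnj:
  fixes f g :: "'x \<Rightarrow> complex"
  assumes [measurable]: "f \<in> borel_measurable M" "g \<in> borel_measurable M"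
    and "integrable M (\<lambda>x. (cmod (f x))\<^sup>2)" "integrable M (\<lambda>x. (cmod (g x))\<^sup>2)"
  shows "integrable M (\<lambda>x. f x * cnj (g x))"
proof (rule Bochner_Integration.integrable_bound)
  have [measurable]: "cnj \<in> borel_measurable borel"
    by (intro borel_measurable_continuous_onI continuous_intros)
  show "(\<lambda>x. f x * cnj (g x)) \<in> borel_measurable M" by measurable
  show "integrable M (\<lambda>x. (cmod (f x))\<^sup>2 + (cmod (g x))\<^sup>2)" using assms by simp
  have "cmod (f x) * cmod (g x) \<le> (cmod (f x))\<^sup>2 + (cmod (g x))\<^sup>2" for x
  proof -
    have "0 \<le> cmod (f x) * cmod (g x)" by simp
    with sum_squares_bound[of "cmod (f x)" "cmod (g x)"] show ?thesis by linarith
  qed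
  then show "AE x in M. norm (f x * cnj (g x)) \<le> norm ((cmod (f x))\<^sup>2 + (cmod (g x))\<^sup>2)"
    by (auto simp: norm_mult)
qed

lemma norm_add_power2_le: "(norm (x + y))\<^sup>2 \<le> 2 * (norm x)\<^sup>2 + 2 * (norm y)\<^sup>2"
  for x y :: "'a::real_normed_vector"
proof -
  have "(norm (x + y))\<^sup>2 \<le> (norm x + norm y)\<^sup>2" by (intro power_mono norm_triangle_ineq) simp
  also have "\<dots> \<le> 2 * (norm x)\<^sup>2 + 2 * (norm y)\<^sup>2"
    using sum_squares_bound[of "norm x" "norm y"] by (simp add: power2_sum)
  finally show ?thesis .
qed

lemma integrable_norm_add_power2:
  fixes f g :: "'x \<Rightarrow> complex"
  assumes [measurable]: "f \<in> borel_measurable M" "g \<in> borel_measurable M"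
    and "integrable M (\<lambda>x. (cmod (f x))\<^sup>2)" "integrable M (\<lambda>x. (cmod (g x))\<^sup>2)"
  shows "integrable M (\<lambda>x. (cmod (f x + g x))\<^sup>2)"
proof (rule Bochner_Integration.integrable_bound)
  show "integrable M (\<lambda>x. 2 * (cmod (f x))\<^sup>2 + 2 * (cmod (g x))\<^sup>2)" using assms by simp
  show "AE x in M. norm ((cmod (f x + g x))\<^sup>2) \<le> norm (2 * (cmod (f x))\<^sup>2 + 2 * (cmod (g x))\<^sup>2)"
    using norm_add_power2_le by (intro AE_I2) (auto intro: order_trans[OF _ abs_ge_self])
qed simp

lemma hnorm_L2_space: "hnorm (L2_space M) f = sqrt (LINT x|M. (cmod (f x))\<^sup>2)"
proof -
  have "(LINT x|M. f x * cnj (f x)) = of_real (LINT x|M. (cmod (f x))\<^sup>2)"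
    by (simp add: complex_norm_square[symmetric] flip: integral_complex_of_real)
  then show ?thesis by (simp add: hnorm_def L2_space_def)
qed

text \<open>On a finite measure space a Cauchy sequence in L2 is Cauchy in L1, hence has an almost
  everywhere convergent subsequence. Fatou's lemma turns its pointwise limit into an L2 limit of the
  whole sequence.\<close>

lemma (in finite_measure) L2_complete:
  fixes u :: "nat \<Rightarrow> 'a \<Rightarrow> complex"
  assumes [measurable]: "\<And>n. u n \<in> borel_measurable M"
    and int: "\<And>n. integrable M (\<lambda>x. (cmod (u n x))\<^sup>2)"
    and cauchy: "\<And>e. 0 < e \<Longrightarrow> \<exists>N. \<forall>m\<ge>N. \<forall>n\<ge>N. sqrt (LINT x|M. (cmod (u m x - u n x))\<^sup>2) < e"
  obtains h where "h \<in> borel_measurable M" "integrable M (\<lambda>x. (cmod (h x))\<^sup>2)"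
    "(\<lambda>n. sqrt (LINT x|M. (cmod (u n x - h x))\<^sup>2)) \<longlonglongrightarrow> 0"
proof -
  have intd: "integrable M (\<lambda>x. (cmod (u m x - u n x))\<^sup>2)" for m n
    using integrable_norm_add_power2[of "u m" M "\<lambda>x. - u n x"] int by simp
  have int1: "integrable M (u n)" for n
  proof (rule Bochner_Integration.integrable_bound)
    show "integrable M (\<lambda>x. 1 + (cmod (u n x))\<^sup>2)" using int by simp
    have "cmod (u n x) \<le> 1 + (cmod (u n x))\<^sup>2" for x
      using sum_squares_bound[of 1 "cmod (u n x)"] norm_ge_zero[of "u n x"]
      by (simp del: norm_ge_zero)
    then show "AE x in M. norm (u n x) \<le> norm (1 + (cmod (u n x))\<^sup>2)"
      by (intro AE_I2) (auto intro: order_trans[OF _ abs_ge_self])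
  qed simp
  define c where "c = measure M (space M) + 1"
  have "\<exists>N. \<forall>i\<ge>N. \<forall>j\<ge>N. (LINT x|M. norm (u i x - u j x)) < e" if e: "0 < e" for e
  proof -
    have c: "1 \<le> c" by (simp add: c_def)
    define d where "d = e / c"
    have d: "0 < d" using e c by (simp add: d_def)
    obtain N where N: "\<And>m n. N \<le> m \<Longrightarrow> N \<le> n \<Longrightarrow> sqrt (LINT x|M. (cmod (u m x - u n x))\<^sup>2) < d"
      using cauchy[OF d] by blast
    have "(LINT x|M. norm (u i x - u j x)) < e" if "N \<le> i" "N \<le> j" for i j
    proof -
      let ?I = "LINT x|M. (cmod (u i x - u j x))\<^sup>2"
      have "sqrt ?I < d" using N that by simp
      moreover have "0 \<le> ?I" by (rule Bochner_Integration.integral_nonneg) simp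
      ultimately have I: "?I < d\<^sup>2"
        using power_strict_mono[of "sqrt ?I" d 2] by simp
      \<comment> \<open>A weighted arithmetic-geometric mean inequality in place of Cauchy-Schwarz.
        With d = e / c the two terms integrate to less than (1 + total mass) d / 2 = e / 2; the
        summand 1 in c is the contribution of the quadratic term.\<close>
      have "norm (u i x - u j x) \<le> (cmod (u i x - u j x))\<^sup>2 / (2 * d) + d / 2" for x
        using sum_squares_bound[of "cmod (u i x - u j x)" d] d
        by (simp add: field_simps power2_eq_square)
      then have "(LINT x|M. norm (u i x - u j x)) \<le> (LINT x|M. (cmod (u i x - u j x))\<^sup>2 / (2 * d) + d / 2)"
        using intd int1 by (intro integral_mono) auto
      also have "\<dots> = ?I / (2 * d) + measure M (space M) * d / 2" using intd by simp
      also have "\<dots> < d\<^sup>2 / (2 * d) + measure M (space M) * d / 2"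
        using I d by (intro add_strict_right_mono divide_strict_right_mono) auto
      also have "\<dots> = c * d / 2" using d by (simp add: c_def power2_eq_square field_simps)
      also have "\<dots> \<le> e" using c e by (simp add: d_def)
      finally show ?thesis .
    qed
    then show ?thesis by blast
  qed
  then obtain r where r: "strict_mono r" and ae: "AE x in M. Cauchy (\<lambda>i. u (r i) x)"
    using cauchy_L1_AE_cauchy_subseq[where s = u] int1 by blast
  define h where "h x = lim (\<lambda>i. u (r i) x)" for x
  have hm [measurable]: "h \<in> borel_measurable M" unfolding h_def by measurable
  have lim: "AE x in M. (\<lambda>i. u (r i) x) \<longlonglongrightarrow> h x"
    using ae by eventually_elim (simp add: h_def Cauchy_convergent_iff convergent_LIMSEQ_iff)
  have bound: "(\<integral>\<^sup>+ x. ennreal ((cmod (u n x - h x))\<^sup>2) \<partial>M) \<le> ennreal (e\<^sup>2)"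
    if e: "0 < e" and N: "\<And>m n. N \<le> m \<Longrightarrow> N \<le> n \<Longrightarrow> sqrt (LINT x|M. (cmod (u m x - u n x))\<^sup>2) < e"
      and n: "N \<le> n" for e N n
  proof -
    have "(\<integral>\<^sup>+ x. ennreal ((cmod (u n x - h x))\<^sup>2) \<partial>M) =
        (\<integral>\<^sup>+ x. liminf (\<lambda>i. ennreal ((cmod (u n x - u (r i) x))\<^sup>2)) \<partial>M)"
      using lim
    proof (intro nn_integral_cong_AE, eventually_elim)
      fix x assume "(\<lambda>i. u (r i) x) \<longlonglongrightarrow> h x"
      then have "(\<lambda>i. ennreal ((cmod (u n x - u (r i) x))\<^sup>2)) \<longlonglongrightarrow> ennreal ((cmod (u n x - h x))\<^sup>2)"
        by (intro tendsto_intros)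
      then show "ennreal ((cmod (u n x - h x))\<^sup>2) = liminf (\<lambda>i. ennreal ((cmod (u n x - u (r i) x))\<^sup>2))"
        by (rule lim_imp_Liminf[OF sequentially_bot, THEN sym])
    qed
    also have "\<dots> \<le> liminf (\<lambda>i. \<integral>\<^sup>+ x. ennreal ((cmod (u n x - u (r i) x))\<^sup>2) \<partial>M)"
      by (rule nn_integral_liminf) simp
    also have "\<dots> \<le> ennreal (e\<^sup>2)"
    proof (rule Liminf_le)
      have "\<forall>\<^sub>F i in sequentially. N \<le> i" by (rule eventually_ge_at_top)
      then show "\<forall>\<^sub>F i in sequentially. (\<integral>\<^sup>+ x. ennreal ((cmod (u n x - u (r i) x))\<^sup>2) \<partial>M) \<le> ennreal (e\<^sup>2)"
      proof eventually_elim
        fix i assume "N \<le> i"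
        then have "N \<le> r i" using seq_suble[OF r, of i] by simp
        then have "sqrt (LINT x|M. (cmod (u n x - u (r i) x))\<^sup>2) < e" using N n by simp
        then have "(LINT x|M. (cmod (u n x - u (r i) x))\<^sup>2) \<le> e\<^sup>2"
          by (meson less_imp_le sqrt_le_D)
        then show "(\<integral>\<^sup>+ x. ennreal ((cmod (u n x - u (r i) x))\<^sup>2) \<partial>M) \<le> ennreal (e\<^sup>2)"
          by (subst nn_integral_eq_integral[OF intd]) (auto intro: ennreal_leI)
      qed
    qed simp
    finally show ?thesis .
  qed
  have inth: "integrable M (\<lambda>x. (cmod (u n x - h x))\<^sup>2)"
    if "0 < e" "\<And>m n. N \<le> m \<Longrightarrow> N \<le> n \<Longrightarrow> sqrt (LINT x|M. (cmod (u m x - u n x))\<^sup>2) < e" "N \<le> n"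
    for e N n
    using bound[OF that] by (intro integrableI_nonneg) (auto simp: le_less_trans[OF _ ennreal_less_top])
  obtain N1 where N1: "\<And>m n. N1 \<le> m \<Longrightarrow> N1 \<le> n \<Longrightarrow> sqrt (LINT x|M. (cmod (u m x - u n x))\<^sup>2) < 1"
    using cauchy[of 1] by auto
  \<comment> \<open>Recovers h as a difference of two square-integrable functions.\<close>
  have "integrable M (\<lambda>x. (cmod (u N1 x - (u N1 x - h x)))\<^sup>2)"
    using integrable_norm_add_power2[of "u N1" M "\<lambda>x. - (u N1 x - h x)"] int
      inth[of 1 N1 N1] N1
    by (simp add: norm_minus_commute)
  then have hint: "integrable M (\<lambda>x. (cmod (h x))\<^sup>2)" by simp
  have "(\<lambda>n. sqrt (LINT x|M. (cmod (u n x - h x))\<^sup>2)) \<longlonglongrightarrow> 0"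
  proof (rule LIMSEQ_I)
    fix e :: real assume e: "0 < e"
    then have e2: "0 < e / 2" by simp
    obtain N where N: "\<And>m n. N \<le> m \<Longrightarrow> N \<le> n \<Longrightarrow> sqrt (LINT x|M. (cmod (u m x - u n x))\<^sup>2) < e / 2"
      using cauchy[OF e2] by blast
    have "norm (sqrt (LINT x|M. (cmod (u n x - h x))\<^sup>2) - 0) < e" if n: "N \<le> n" for n
    proof -
      have "ennreal (LINT x|M. (cmod (u n x - h x))\<^sup>2) \<le> ennreal ((e / 2)\<^sup>2)"
        using bound[OF e2 N n] nn_integral_eq_integral[OF inth[OF e2 N n]] by simp
      then have "(LINT x|M. (cmod (u n x - h x))\<^sup>2) \<le> (e / 2)\<^sup>2"
        by (simp add: ennreal_le_iff)
      then have "sqrt (LINT x|M. (cmod (u n x - h x))\<^sup>2) \<le> e / 2"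
        using e by (intro real_le_lsqrt) auto
      then show ?thesis using e by (simp add: Bochner_Integration.integral_nonneg)
    qed
    then show "\<exists>N. \<forall>n\<ge>N. norm (sqrt (LINT x|M. (cmod (u n x - h x))\<^sup>2) - 0) < e" by blast
  qed
  then show ?thesis using that[of h] hm hint by simp
qed

theorem (in finite_measure) hilbert_space_L2_space: "hilbert_space (L2_space M)"
proof
  fix f g :: "'a \<Rightarrow> complex" and c :: complex
  show "(\<lambda>x. 0) \<in> hcarrier (L2_space M)" by (simp add: L2_space_def)
  show "(\<lambda>x. f x + g x) \<in> hcarrier (L2_space M)"
    if "f \<in> hcarrier (L2_space M)" "g \<in> hcarrier (L2_space M)"
    using that by (auto simp: L2_space_def intro: integrable_norm_add_power2)
  show "(\<lambda>x. c * f x) \<in> hcarrier (L2_space M)" if "f \<in> hcarrier (L2_space M)"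
    using that by (auto simp: L2_space_def norm_mult power_mult_distrib)
  show "hinner (L2_space M) (\<lambda>x. c * f x) g = c * hinner (L2_space M) f g"
    by (simp add: L2_space_def mult.assoc)
  show "hinner (L2_space M) g f = cnj (hinner (L2_space M) f g)"
    using Bochner_Integration.integral_cnj[of M "\<lambda>x. f x * cnj (g x)"] by (simp add: L2_space_def mult.commute)
  have "hinner (L2_space M) f f = of_real (LINT x|M. (cmod (f x))\<^sup>2)"
    by (simp add: L2_space_def complex_norm_square[symmetric] flip: integral_complex_of_real)
  then show "0 \<le> Re (hinner (L2_space M) f f)" by simp
  show "hinner (L2_space M) (\<lambda>x. f x + g x) h = hinner (L2_space M) f h + hinner (L2_space M) g h"
    if "f \<in> hcarrier (L2_space M)" "g \<in> hcarrier (L2_space M)" "h \<in> hcarrier (L2_space M)" for h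
    using that integrable_mult_cnj[of f M h] integrable_mult_cnj[of g M h]
    by (simp add: L2_space_def distrib_right)
next
  fix u :: "nat \<Rightarrow> 'a \<Rightarrow> complex"
  assume u: "\<And>n. u n \<in> hcarrier (L2_space M)"
    and cauchy: "\<And>e. 0 < e \<Longrightarrow> \<exists>N. \<forall>m\<ge>N. \<forall>n\<ge>N. hnorm (L2_space M) (\<lambda>x. u m x - u n x) < e"
  obtain h where "h \<in> borel_measurable M" "integrable M (\<lambda>x. (cmod (h x))\<^sup>2)"
    "(\<lambda>n. sqrt (LINT x|M. (cmod (u n x - h x))\<^sup>2)) \<longlonglongrightarrow> 0"
  proof (rule L2_complete[of u])
    show "u n \<in> borel_measurable M" "integrable M (\<lambda>x. (cmod (u n x))\<^sup>2)" for n
      using u[of n] by (auto simp: L2_space_def)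
  qed (rule cauchy[unfolded hnorm_L2_space])
  then show "\<exists>h\<in>hcarrier (L2_space M). (\<lambda>n. hnorm (L2_space M) (\<lambda>x. u n x - h x)) \<longlonglongrightarrow> 0"
    unfolding hnorm_L2_space by (auto simp: L2_space_def)
qed

section \<open>Countable Hilbert sums\<close>

locale hilbert_family =
  fixes H :: "nat \<Rightarrow> 'x hilbert"
  assumes component: "\<And>j. hilbert_space (H j)"
begin

abbreviation comp :: "(nat \<times> 'x \<Rightarrow> complex) \<Rightarrow> nat \<Rightarrow> 'x \<Rightarrow> complex" where
  "comp f j \<equiv> \<lambda>x. f (j, x)"

lemma comp_closed: "f \<in> hcarrier (hilbert_sum H) \<Longrightarrow> comp f j \<in> hcarrier (H j)"
  by (simp add: hilbert_sum_def)

lemma comp_summable: "f \<in> hcarrier (hilbert_sum H) \<Longrightarrow> summable (\<lambda>j. (hnorm (H j) (comp f j))\<^sup>2)"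
  by (simp add: hilbert_sum_def)

lemma inner_summable:
  assumes f: "f \<in> hcarrier (hilbert_sum H)" and g: "g \<in> hcarrier (hilbert_sum H)"
  shows "summable (\<lambda>j. hinner (H j) (comp f j) (comp g j))"
proof (rule summable_comparison_test)
  show "summable (\<lambda>j. (hnorm (H j) (comp f j))\<^sup>2 + (hnorm (H j) (comp g j))\<^sup>2)"
    using f g by (intro summable_add comp_summable)
  have "norm (hinner (H j) (comp f j) (comp g j)) \<le> (hnorm (H j) (comp f j))\<^sup>2 + (hnorm (H j) (comp g j))\<^sup>2"
    for j
  proof -
    interpret hilbert_space "H j" by (rule component)
    have "0 \<le> hnorm (H j) (comp f j) * hnorm (H j) (comp g j)"
      using f g by (simp add: hnorm_nonneg comp_closed)
    then show ?thesis
      using cauchy_schwarz[OF comp_closed[OF f] comp_closed[OF g]]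
        sum_squares_bound[of "hnorm (H j) (comp f j)" "hnorm (H j) (comp g j)"] by linarith
  qed
  then show "\<exists>N. \<forall>n\<ge>N. norm (hinner (H n) (comp f n) (comp g n))
      \<le> (hnorm (H n) (comp f n))\<^sup>2 + (hnorm (H n) (comp g n))\<^sup>2" by blast
qed

lemma hnorm_hilbert_sum_power2:
  assumes f: "f \<in> hcarrier (hilbert_sum H)"
  shows "(\<lambda>j. (hnorm (H j) (comp f j))\<^sup>2) sums (hnorm (hilbert_sum H) f)\<^sup>2"
    and "hinner (hilbert_sum H) f f = of_real ((hnorm (hilbert_sum H) f)\<^sup>2)"
proof -
  have eq: "hinner (H j) (comp f j) (comp f j) = of_real ((hnorm (H j) (comp f j))\<^sup>2)" for j
    by (rule hilbert_space.inner_self[OF component comp_closed[OF f]])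
  have in_eq: "hinner (hilbert_sum H) f f = of_real (\<Sum>j. (hnorm (H j) (comp f j))\<^sup>2)"
    using suminf_of_real[OF comp_summable[OF f], where 'a = complex]
    by (simp add: hilbert_sum_def eq del: of_real_power)
  have "0 \<le> (\<Sum>j. (hnorm (H j) (comp f j))\<^sup>2)"
    using comp_summable[OF f] by (rule suminf_nonneg) simp
  then have "(hnorm (hilbert_sum H) f)\<^sup>2 = (\<Sum>j. (hnorm (H j) (comp f j))\<^sup>2)"
    by (simp add: hnorm_def[of "hilbert_sum H"] in_eq del: of_real_power)
  with in_eq comp_summable[OF f] show "(\<lambda>j. (hnorm (H j) (comp f j))\<^sup>2) sums (hnorm (hilbert_sum H) f)\<^sup>2"
    "hinner (hilbert_sum H) f f = of_real ((hnorm (hilbert_sum H) f)\<^sup>2)"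
    by (auto simp: summable_sums)
qed

lemma sum_add_closed:
  assumes f: "f \<in> hcarrier (hilbert_sum H)" and g: "g \<in> hcarrier (hilbert_sum H)"
  shows "(\<lambda>x. f x + g x) \<in> hcarrier (hilbert_sum H)"
proof -
  have "comp (\<lambda>x. f x + g x) j \<in> hcarrier (H j)" for j
    using hilbert_space.add_closed[OF component comp_closed[OF f] comp_closed[OF g]] .
  moreover have "summable (\<lambda>j. (hnorm (H j) (comp (\<lambda>x. f x + g x) j))\<^sup>2)"
  proof (rule summable_comparison_test)
    show "summable (\<lambda>j. 2 * (hnorm (H j) (comp f j))\<^sup>2 + 2 * (hnorm (H j) (comp g j))\<^sup>2)"
      using f g by (intro summable_add summable_mult comp_summable)
    have "norm ((hnorm (H j) (comp (\<lambda>x. f x + g x) j))\<^sup>2)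
      \<le> 2 * (hnorm (H j) (comp f j))\<^sup>2 + 2 * (hnorm (H j) (comp g j))\<^sup>2" for j
    proof -
      interpret hilbert_space "H j" by (rule component)
      have fj: "comp f j \<in> hcarrier (H j)" and gj: "comp g j \<in> hcarrier (H j)"
        using f g by (auto simp: comp_closed)
      have "(hnorm (H j) (\<lambda>x. f (j, x) + g (j, x)))\<^sup>2 \<le> (hnorm (H j) (comp f j) + hnorm (H j) (comp g j))\<^sup>2"
        using hnorm_add_le[OF fj gj] by (intro power_mono hnorm_nonneg add_closed fj gj)
      also have "\<dots> \<le> 2 * (hnorm (H j) (comp f j))\<^sup>2 + 2 * (hnorm (H j) (comp g j))\<^sup>2"
        using sum_squares_bound[of "hnorm (H j) (comp f j)" "hnorm (H j) (comp g j)"]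
        by (simp add: power2_sum)
      finally show ?thesis by simp
    qed
    then show "\<exists>N. \<forall>n\<ge>N. norm ((hnorm (H n) (comp (\<lambda>x. f x + g x) n))\<^sup>2)
      \<le> 2 * (hnorm (H n) (comp f n))\<^sup>2 + 2 * (hnorm (H n) (comp g n))\<^sup>2" by blast
  qed
  ultimately show ?thesis by (simp add: hilbert_sum_def)
qed

lemma sum_scale_closed:
  assumes f: "f \<in> hcarrier (hilbert_sum H)"
  shows "(\<lambda>x. c * f x) \<in> hcarrier (hilbert_sum H)"
proof -
  have "hnorm (H j) (\<lambda>x. c * f (j, x)) = cmod c * hnorm (H j) (comp f j)" for j
    using hilbert_space.hnorm_scale[OF component comp_closed[OF f]] .
  then show ?thesis
    using comp_summable[OF f] hilbert_space.scale_closed[OF component comp_closed[OF f]]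
    by (simp add: hilbert_sum_def power_mult_distrib summable_mult)
qed

text \<open>Each component converges because its norm is dominated by the norm of the sum. Square
  summability of the limit and convergence in the full norm both come from one tail
  estimate.\<close>

lemma hilbert_sum_complete:
  assumes u: "\<And>n::nat. u n \<in> hcarrier (hilbert_sum H)"
    and cauchy: "\<And>e. 0 < e \<Longrightarrow> \<exists>N. \<forall>m\<ge>N. \<forall>n\<ge>N. hnorm (hilbert_sum H) (\<lambda>x. u m x - u n x) < e"
  shows "\<exists>h\<in>hcarrier (hilbert_sum H). (\<lambda>n. hnorm (hilbert_sum H) (\<lambda>x. u n x - h x)) \<longlonglongrightarrow> 0"
proof -
  have diff: "(\<lambda>x. f x - g x) \<in> hcarrier (hilbert_sum H)"
    if "f \<in> hcarrier (hilbert_sum H)" "g \<in> hcarrier (hilbert_sum H)" for f g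
    using sum_add_closed[OF that(1) sum_scale_closed[OF that(2), of "-1"]] by simp
  have nonneg: "0 \<le> hnorm (hilbert_sum H) f" if "f \<in> hcarrier (hilbert_sum H)" for f
  proof -
    have "0 \<le> Re (hinner (hilbert_sum H) f f)" using hnorm_hilbert_sum_power2(2)[OF that] by simp
    then show ?thesis by (simp add: hnorm_def)
  qed
  have partial: "(\<Sum>j<J. (hnorm (H j) (comp f j))\<^sup>2) \<le> (hnorm (hilbert_sum H) f)\<^sup>2"
    if "f \<in> hcarrier (hilbert_sum H)" for f J
    using hnorm_hilbert_sum_power2(1)[OF that]
      sum_le_suminf[of "\<lambda>j. (hnorm (H j) (comp f j))\<^sup>2" "{..<J}"]
    by (simp add: sums_iff)
  have single: "hnorm (H j) (comp f j) \<le> hnorm (hilbert_sum H) f"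
    if "f \<in> hcarrier (hilbert_sum H)" for f j
  proof (rule power2_le_imp_le)
    have "(hnorm (H j) (comp f j))\<^sup>2 \<le> (\<Sum>j<Suc j. (hnorm (H j) (comp f j))\<^sup>2)"
      by (rule member_le_sum) auto
    then show "(hnorm (H j) (comp f j))\<^sup>2 \<le> (hnorm (hilbert_sum H) f)\<^sup>2"
      using partial[OF that, of "Suc j"] by linarith
  qed (rule nonneg[OF that])
  have "\<exists>h\<in>hcarrier (H j). (\<lambda>n. hnorm (H j) (\<lambda>x. u n (j, x) - h x)) \<longlonglongrightarrow> 0" for j
  proof (rule hilbert_space.complete[OF component])
    show "comp (u n) j \<in> hcarrier (H j)" for n using u by (rule comp_closed)
    fix e :: real assume "0 < e"
    then show "\<exists>N. \<forall>m\<ge>N. \<forall>n\<ge>N. hnorm (H j) (\<lambda>x. u m (j, x) - u n (j, x)) < e"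
      using cauchy[of e] single[OF diff[OF u u], of j] by (meson le_less_trans)
  qed
  then have "\<forall>j. \<exists>h. h \<in> hcarrier (H j) \<and> (\<lambda>n. hnorm (H j) (\<lambda>x. u n (j, x) - h x)) \<longlonglongrightarrow> 0"
    by blast
  then obtain h' where "\<forall>j. h' j \<in> hcarrier (H j) \<and>
      (\<lambda>n. hnorm (H j) (\<lambda>x. u n (j, x) - h' j x)) \<longlonglongrightarrow> 0"
    unfolding choice_iff by blast
  then have h': "h' j \<in> hcarrier (H j)" "(\<lambda>n. hnorm (H j) (\<lambda>x. u n (j, x) - h' j x)) \<longlonglongrightarrow> 0" for j
    by auto
  define h where "h = (\<lambda>(j, x). h' j x)"
  have tail: "(\<lambda>x. u n x - h x) \<in> hcarrier (hilbert_sum H) \<and> hnorm (hilbert_sum H) (\<lambda>x. u n x - h x) \<le> e"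
    if e: "0 < e" and N: "\<forall>m\<ge>N. \<forall>n\<ge>N. hnorm (hilbert_sum H) (\<lambda>x. u m x - u n x) < e" and n: "N \<le> n" for e N n
  proof -
    \<comment> \<open>The limit in m is taken for finitely many components at a time; the bound does
      not depend on J, so it survives J going to infinity.\<close>
    have bound: "(\<Sum>j<J. (hnorm (H j) (\<lambda>x. u n (j, x) - h' j x))\<^sup>2) \<le> e\<^sup>2" for J
    proof (rule LIMSEQ_le_const2)
      have "(\<lambda>m. hnorm (H j) (\<lambda>x. u n (j, x) - u m (j, x))) \<longlonglongrightarrow> hnorm (H j) (\<lambda>x. u n (j, x) - h' j x)" for j
      proof -
        interpret hilbert_space "H j" by (rule component)
        have cl: "comp (u m) j \<in> hcarrier (H j)" for m using u by (rule comp_closed)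
        show ?thesis
        proof (rule tendsto_hnorm)
          have "hnorm (H j) (\<lambda>x. u n (j, x) - u m (j, x) - (u n (j, x) - h' j x)) =
              hnorm (H j) (\<lambda>x. u m (j, x) - h' j x)" for m
            using hnorm_diff_commute[OF cl h'(1)] by simp
          then show "(\<lambda>m. hnorm (H j) (\<lambda>x. u n (j, x) - u m (j, x) - (u n (j, x) - h' j x))) \<longlonglongrightarrow> 0"
            using h'(2)[of j] by simp
        qed (auto intro: diff_closed cl h')
      qed
      then show "(\<lambda>m. \<Sum>j<J. (hnorm (H j) (\<lambda>x. u n (j, x) - u m (j, x)))\<^sup>2) \<longlonglongrightarrow>
          (\<Sum>j<J. (hnorm (H j) (\<lambda>x. u n (j, x) - h' j x))\<^sup>2)"
        by (intro tendsto_sum tendsto_power)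
      have "(\<Sum>j<J. (hnorm (H j) (\<lambda>x. u n (j, x) - u m (j, x)))\<^sup>2) \<le> e\<^sup>2" if "N \<le> m" for m
      proof -
        have "(hnorm (hilbert_sum H) (\<lambda>x. u n x - u m x))\<^sup>2 \<le> e\<^sup>2"
          using N n that nonneg[OF diff[OF u u]] by (intro power_mono) (auto intro: less_imp_le)
        then show ?thesis using partial[OF diff[OF u[of n] u[of m]], of J] by simp
      qed
      then show "\<exists>N. \<forall>m\<ge>N. (\<Sum>j<J. (hnorm (H j) (\<lambda>x. u n (j, x) - u m (j, x)))\<^sup>2) \<le> e\<^sup>2" by blast
    qed
    have cl: "(\<lambda>x. u n (j, x) - h' j x) \<in> hcarrier (H j)" for j
      using hilbert_space.diff_closed[OF component comp_closed[OF u] h'(1)] .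
    have sm: "summable (\<lambda>j. (hnorm (H j) (\<lambda>x. u n (j, x) - h' j x))\<^sup>2)"
      using bound by (intro summableI_nonneg_bounded) auto
    have c: "(\<lambda>x. u n x - h x) \<in> hcarrier (hilbert_sum H)"
      using cl sm by (simp add: hilbert_sum_def h_def)
    have "(hnorm (hilbert_sum H) (\<lambda>x. u n x - h x))\<^sup>2 \<le> e\<^sup>2"
      using hnorm_hilbert_sum_power2(1)[OF c] suminf_le_const[OF sm bound]
      by (simp add: h_def sums_iff)
    then have "hnorm (hilbert_sum H) (\<lambda>x. u n x - h x) \<le> e"
      by (rule power2_le_imp_le) (use e in simp)
    with c show ?thesis ..
  qed
  obtain N1 where N1: "\<forall>m\<ge>N1. \<forall>n\<ge>N1. hnorm (hilbert_sum H) (\<lambda>x. u m x - u n x) < 1"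
    using cauchy[of 1] by auto
  have "(\<lambda>x. u N1 x - (u N1 x - h x)) \<in> hcarrier (hilbert_sum H)"
    by (rule diff[OF u conjunct1[OF tail[OF zero_less_one N1 order_refl]]])
  then have hC: "h \<in> hcarrier (hilbert_sum H)" by simp
  moreover have "(\<lambda>n. hnorm (hilbert_sum H) (\<lambda>x. u n x - h x)) \<longlonglongrightarrow> 0"
  proof (rule LIMSEQ_I)
    fix e :: real assume "0 < e"
    then have e2: "0 < e / 2" by simp
    then obtain N where N: "\<forall>m\<ge>N. \<forall>n\<ge>N. hnorm (hilbert_sum H) (\<lambda>x. u m x - u n x) < e / 2"
      using cauchy[of "e / 2"] by blast
    have "norm (hnorm (hilbert_sum H) (\<lambda>x. u n x - h x) - 0) < e" if "N \<le> n" for n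
      using tail[OF e2 N that] nonneg[of "\<lambda>x. u n x - h x"] \<open>0 < e\<close> by auto
    then show "\<exists>N. \<forall>n\<ge>N. norm (hnorm (hilbert_sum H) (\<lambda>x. u n x - h x) - 0) < e" by blast
  qed
  ultimately show ?thesis by blast
qed

sublocale hs: hilbert_space "hilbert_sum H"
proof
  fix f g :: "nat \<times> 'x \<Rightarrow> complex" and c :: complex
  have "hnorm (H j) (\<lambda>x. 0) = 0" for j
    using hilbert_space.inner_zero_left[OF component hilbert_space.zero_closed[OF component]]
    by (simp add: hnorm_def)
  then show "(\<lambda>x. 0) \<in> hcarrier (hilbert_sum H)"
    using hilbert_space.zero_closed[OF component] by (simp add: hilbert_sum_def)
  assume f: "f \<in> hcarrier (hilbert_sum H)"
  show "(\<lambda>x. c * f x) \<in> hcarrier (hilbert_sum H)" using f by (rule sum_scale_closed)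
  show "0 \<le> Re (hinner (hilbert_sum H) f f)" using hnorm_hilbert_sum_power2(2)[OF f] by simp
  assume g: "g \<in> hcarrier (hilbert_sum H)"
  show "(\<lambda>x. f x + g x) \<in> hcarrier (hilbert_sum H)" using f g by (rule sum_add_closed)
  show "hinner (hilbert_sum H) (\<lambda>x. c * f x) g = c * hinner (hilbert_sum H) f g"
    using inner_summable[OF f g] hilbert_space.inner_scale_left[OF component comp_closed[OF f] comp_closed[OF g]]
    by (simp add: hilbert_sum_def suminf_mult)
  have "hinner (hilbert_sum H) g f = (\<Sum>j. cnj (hinner (H j) (comp f j) (comp g j)))"
    using hilbert_space.inner_commute[OF component comp_closed[OF f] comp_closed[OF g]]
    by (simp add: hilbert_sum_def)
  also have "\<dots> = cnj (hinner (hilbert_sum H) f g)"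
    using sums_cnj[THEN iffD2, OF summable_sums[OF inner_summable[OF f g]], THEN sums_unique]
    by (simp add: hilbert_sum_def)
  finally show "hinner (hilbert_sum H) g f = cnj (hinner (hilbert_sum H) f g)" .
  show "hinner (hilbert_sum H) (\<lambda>x. f x + g x) h = hinner (hilbert_sum H) f h + hinner (hilbert_sum H) g h"
    if h: "h \<in> hcarrier (hilbert_sum H)" for h
    using suminf_add[OF inner_summable[OF f h] inner_summable[OF g h]]
      hilbert_space.inner_add_left[OF component comp_closed[OF f] comp_closed[OF g] comp_closed[OF h]]
    by (simp add: hilbert_sum_def)
qed (rule hilbert_sum_complete)

end

definition sum_basis :: "(nat \<Rightarrow> 'i \<Rightarrow> 'x \<Rightarrow> complex) \<Rightarrow> nat \<times> 'i \<Rightarrow> nat \<times> 'x \<Rightarrow> complex" where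
  "sum_basis b = (\<lambda>(j, i) (j', x). if j' = j then b j i x else 0)"

locale hilbert_basis_family =
  fixes H :: "nat \<Rightarrow> 'x hilbert" and b :: "nat \<Rightarrow> 'i \<Rightarrow> 'x \<Rightarrow> complex"
  assumes basis: "\<And>j. hilbert_basis (H j) (b j) UNIV"
begin

sublocale hilbert_family H
  by (rule hilbert_family.intro) (rule hilbert_basis.axioms(1)[OF basis])

lemma comp_sum_basis: "comp (sum_basis b (j, i)) j' = (if j' = j then b j i else (\<lambda>x. 0))"
  by (simp add: sum_basis_def)

lemma sum_basis_closed: "sum_basis b (j, i) \<in> hcarrier (hilbert_sum H)"
proof -
  have "hnorm (H j') (\<lambda>x. 0) = 0" for j'
    using hilbert_space.inner_zero_left[OF component hilbert_space.zero_closed[OF component]]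
    by (simp add: hnorm_def)
  then have "summable (\<lambda>j'. (hnorm (H j') (comp (sum_basis b (j, i)) j'))\<^sup>2)"
    unfolding comp_sum_basis by (intro summable_finite[of "{j}"]) auto
  then show ?thesis
    using hilbert_basis.b_closed[OF basis] hilbert_space.zero_closed[OF component]
    unfolding hilbert_sum_def by (auto simp: comp_sum_basis)
qed

lemma inner_sum_basis:
  assumes f: "f \<in> hcarrier (hilbert_sum H)"
  shows "hinner (hilbert_sum H) f (sum_basis b (j, i)) = hinner (H j) (comp f j) (b j i)"
proof -
  have 0: "hinner (H j') (comp f j') (\<lambda>x. 0) = 0" for j'
    using hilbert_space.inner_zero_left[OF component comp_closed[OF f], of j']
      hilbert_space.inner_commute[OF component comp_closed[OF f] hilbert_space.zero_closed[OF component], of j']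
    by simp
  have "hinner (hilbert_sum H) f (sum_basis b (j, i)) =
      (\<Sum>j'. hinner (H j') (comp f j') (comp (sum_basis b (j, i)) j'))"
    by (simp add: hilbert_sum_def)
  also have "\<dots> = (\<Sum>j'\<in>{j}. hinner (H j') (comp f j') (comp (sum_basis b (j, i)) j'))"
    by (rule suminf_finite) (auto simp: comp_sum_basis 0)
  finally show ?thesis by (simp add: comp_sum_basis)
qed

sublocale sb: hilbert_basis "hilbert_sum H" "sum_basis b" UNIV
proof
  have "hinner (hilbert_sum H) (sum_basis b (j, i)) (sum_basis b (j', i')) =
      (if (j, i) = (j', i') then 1 else 0)" for j i j' i'
    using hilbert_basis.coef_basis[OF basis, of i i' j]
      hilbert_space.inner_zero_left[OF component hilbert_basis.b_closed[OF basis], of i' j']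
    by (auto simp: inner_sum_basis sum_basis_closed comp_sum_basis split: if_splits)
  then show "hs.orthonormal (sum_basis b) UNIV"
    unfolding hs.orthonormal_def using sum_basis_closed by (simp add: split_paired_all)
  show "hs.total (sum_basis b) UNIV"
    unfolding hs.total_def
  proof (intro ballI impI)
    fix h assume h: "h \<in> hcarrier (hilbert_sum H)"
      and 0: "\<forall>i\<in>UNIV. hinner (hilbert_sum H) h (sum_basis b i) = 0"
    have "hnorm (H j) (comp h j) = 0" for j
    proof -
      interpret hilbert_basis "H j" "b j" UNIV by (rule basis)
      show ?thesis
        using total comp_closed[OF h, of j] 0 by (auto simp: total_def inner_sum_basis[OF h])
    qed
    then show "hnorm (hilbert_sum H) h = 0"
      using hnorm_hilbert_sum_power2(1)[OF h] by (simp add: sums_iff)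
  qed
qed

lemma operator_sum_diag:
  "operator_sum H (\<lambda>j. hilbert_basis.diag_op (H j) (b j) UNIV (a j)) = sb.diag_op (\<lambda>(j, i). a j i)"
proof -
  have "hilbert_basis.diag_op (H j) (b j) UNIV (a j) =
      {(h, g). h \<in> hcarrier (H j) \<and> g \<in> hcarrier (H j) \<and>
        (\<forall>i. hinner (H j) g (b j i) = of_real (a j i) * hinner (H j) h (b j i))}" for j
    using hilbert_basis.diag_op_def[OF basis, of j "a j"] by simp
  then show ?thesis
    by (auto simp: operator_sum_def sb.diag_op_def comp_closed inner_sum_basis)
qed

end


subsection \<open>Completeness of the trigonometric system\<close>

lemma scale_measure_eq_density: "scale_measure r M = density M (\<lambda>_. r)"
  by (rule measure_eqI) (auto simp: emeasure_density_const)

lemma integral_scale_measure: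
  fixes f :: "'x \<Rightarrow> 'b::{banach, second_countable_topology}"
  assumes "f \<in> borel_measurable M" "0 \<le> c"
  shows "(LINT x|scale_measure (ennreal c) M. f x) = c *\<^sub>R (LINT x|M. f x)"
  unfolding scale_measure_eq_density using assms by (subst integral_density) auto

lemma integrable_scale_measure:
  fixes f :: "'x \<Rightarrow> 'b::{banach, second_countable_topology}"
  assumes "f \<in> borel_measurable M" "0 < c"
  shows "integrable (scale_measure (ennreal c) M) f \<longleftrightarrow> integrable M f"
  unfolding scale_measure_eq_density using assms integrable_scaleR_right[of "inverse c" M "\<lambda>x. c *\<^sub>R f x"]
  by (subst integrable_density) auto

definition circ :: "real \<Rightarrow> int \<Rightarrow> real \<Rightarrow> complex" where
  "circ l k x = exp (\<i> * of_real (pi * of_int k * x / l))"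

lemma circ_0 [simp]: "circ l 0 x = 1"
  by (simp add: circ_def)

lemma norm_circ [simp]: "cmod (circ l k x) = 1"
  by (simp add: circ_def norm_exp_i_times)

lemma circ_add: "circ l (k + m) x = circ l k x * circ l m x"
  by (simp add: circ_def ring_distribs add_divide_distrib flip: exp_add)

lemma cnj_circ: "cnj (circ l k x) = circ l (- k) x"
  by (simp add: circ_def exp_cnj)

lemma continuous_on_circ: "continuous_on S (circ l k)"
  unfolding circ_def divide_inverse by (intro continuous_intros)

lemma circ_has_vector_derivative:
  "(circ l k has_vector_derivative (\<i> * of_real (pi * of_int k / l) * circ l k x)) (at x within S)"
proof -
  have "((\<lambda>x. exp (x *\<^sub>R (\<i> * of_real (pi * of_int k / l)))) has_vector_derivative
      exp (x *\<^sub>R (\<i> * of_real (pi * of_int k / l))) * (\<i> * of_real (pi * of_int k / l))) (at x within S)"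
    by (rule exp_scaleR_has_vector_derivative_right)
  moreover have "exp (x *\<^sub>R (\<i> * of_real (pi * of_int k / l))) = circ l k x" for x
    by (simp add: circ_def scaleR_conv_of_real mult_ac)
  ultimately show ?thesis by (simp add: mult.commute)
qed

lemma circ_end: "l \<noteq> 0 \<Longrightarrow> circ l k l = circ l k (- l)"
  by (simp add: circ_def complex_eq_iff Re_exp Im_exp sin_npi_int)

context
  fixes l :: real
  assumes l: "0 < l"
begin

interpretation M: finite_measure "lebesgue_on {- l..l}"
  using l by (intro finite_measureI) (simp add: emeasure_restrict_space)

lemma continuous_measurable:
  "continuous_on {- l..l} g \<Longrightarrow> g \<in> borel_measurable (lebesgue_on {- l..l})"
  for g :: "real \<Rightarrow> 'b::euclidean_space"
  by (rule continuous_imp_measurable_on_sets_lebesgue) simp_all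

lemma circ_measurable [measurable]: "circ l k \<in> borel_measurable (lebesgue_on {- l..l})"
  by (rule continuous_measurable[OF continuous_on_circ])

lemma integral_circ: "(LINT x|lebesgue_on {- l..l}. circ l k x) = (if k = 0 then 2 * of_real l else 0)"
proof -
  have "integrable (lebesgue_on {- l..l}) (circ l k)"
    by (rule M.integrable_const_bound[of _ 1]) auto
  then have eq: "(LINT x|lebesgue_on {- l..l}. circ l k x) = integral {- l..l} (circ l k)"
    by (rule lebesgue_integral_eq_integral) simp
  show ?thesis
  proof (cases "k = 0")
    case True
    have "circ l 0 = (\<lambda>x. 1)" by (simp add: fun_eq_iff)
    then show ?thesis using l True unfolding eq by (simp add: scaleR_conv_of_real)
  next
    case False
    define w where "w = \<i> * of_real (pi * of_int k / l)"
    have w: "w \<noteq> 0" using False l by (simp add: w_def)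
    have "(circ l k has_integral (circ l k l / w - circ l k (- l) / w)) {- l..l}"
    proof (rule fundamental_theorem_of_calculus)
      fix x assume "x \<in> {- l..l}"
      have "((\<lambda>x. circ l k x * (1 / w)) has_vector_derivative (w * circ l k x * (1 / w))) (at x within {- l..l})"
        unfolding w_def by (intro has_vector_derivative_mult_left circ_has_vector_derivative)
      then show "((\<lambda>x. circ l k x / w) has_vector_derivative circ l k x) (at x within {- l..l})"
        using w by simp
    qed (use l in simp)
    then have "integral {- l..l} (circ l k) = 0"
      using circ_end[of l k] l by (simp add: integral_unique)
    then show ?thesis unfolding eq using False by simp
  qed
qed

lemma integrable_mult_bounded:
  fixes f g :: "real \<Rightarrow> complex"
  assumes f: "integrable (lebesgue_on {- l..l}) f" and g: "continuous_on {- l..l} g"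
  shows "integrable (lebesgue_on {- l..l}) (\<lambda>x. f x * g x)"
proof -
  have [measurable]: "g \<in> borel_measurable (lebesgue_on {- l..l})" by (rule continuous_measurable[OF g])
  have [measurable]: "f \<in> borel_measurable (lebesgue_on {- l..l})" using f by simp
  have "bounded (g ` {- l..l})"
    using g by (intro compact_imp_bounded compact_continuous_image) auto
  then obtain B where "\<forall>y\<in>g ` {- l..l}. norm y \<le> B" unfolding bounded_iff by blast
  then have B: "norm (g x) \<le> B" if "x \<in> {- l..l}" for x using that by blast
  show ?thesis
  proof (rule Bochner_Integration.integrable_bound)
    show "integrable (lebesgue_on {- l..l}) (\<lambda>x. B *\<^sub>R f x)" using f by simp
    show "AE x in lebesgue_on {- l..l}. norm (f x * g x) \<le> norm (B *\<^sub>R f x)"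
    proof (rule AE_I2)
      fix x assume "x \<in> space (lebesgue_on {- l..l})"
      then have "norm (g x) \<le> B" using B by simp
      then have "norm (g x) \<le> \<bar>B\<bar>" by simp
      then have "norm (f x) * norm (g x) \<le> norm (f x) * \<bar>B\<bar>" by (intro mult_left_mono) auto
      then show "norm (f x * g x) \<le> norm (B *\<^sub>R f x)" by (simp add: norm_mult mult.commute)
    qed
  qed measurable
qed

section \<open>Functions orthogonal to all exponentials\<close>

context
  fixes f :: "real \<Rightarrow> complex"
  assumes f: "integrable (lebesgue_on {- l..l}) f"
    and orth: "\<And>k. (LINT x|lebesgue_on {- l..l}. f x * circ l k x) = 0"
begin

text \<open>The multipliers preserving orthogonality to all \<open>circ l k\<close> are closed under products,
  which spares the multiplication of explicit trigonometric polynomials.\<close>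

lemma orthogonal_polynomial:
  assumes "real_polynomial_function p"
  shows "(LINT x|lebesgue_on {- l..l}. f x * of_real (p (circ l 1 x))) = 0"
proof -
  let ?M = "lebesgue_on {- l..l}"
  have cont_p: "continuous_on {- l..l} (\<lambda>x. complex_of_real (p (circ l 1 x)))"
    if "real_polynomial_function p" for p
    using that continuous_on_compose2[OF continuous_on_polymonial_function[of p UNIV] continuous_on_circ]
    by (intro continuous_on_of_real) (auto simp: real_polynomial_function_eq)
  have "\<forall>h. continuous_on {- l..l} h \<longrightarrow> (\<forall>k. (LINT x|?M. f x * (circ l k x * h x)) = 0) \<longrightarrow>
      (\<forall>k. (LINT x|?M. f x * (circ l k x * (h x * of_real (p (circ l 1 x))))) = 0)"
    using assms
  proof (induction p rule: real_polynomial_function.induct)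
    case (linear p)
    interpret bounded_linear p by fact
    show ?case
    proof (intro allI impI)
      fix h k assume h: "continuous_on {- l..l} h" and 0: "\<forall>k. (LINT x|?M. f x * (circ l k x * h x)) = 0"
      \<comment> \<open>A real-linear functional on the complex plane has the form a z + b cnj z. On
        the circle z and cnj z shift the frequency k by 1 and -1, so orthogonality is
        preserved.\<close>
      define a b where "a = (of_real (p 1) - \<i> * of_real (p \<i>)) / 2" and "b = (of_real (p 1) + \<i> * of_real (p \<i>)) / 2"
      have p: "of_real (p z) = a * z + b * cnj z" for z
      proof -
        have "p z = p (Re z *\<^sub>R 1 + Im z *\<^sub>R \<i>)"
          by (rule arg_cong[where f = p]) (simp add: complex_eq_iff)
        also have "\<dots> = Re z * p 1 + Im z * p \<i>" by (simp only: add scaleR real_scaleR_def)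
        finally show ?thesis
          by (simp add: a_def b_def complex_eq_iff field_simps)
      qed
      have i: "integrable ?M (\<lambda>x. f x * (circ l m x * h x))" for m
        using f h by (intro integrable_mult_bounded continuous_intros continuous_on_circ)
      have "f x * (circ l k x * (h x * of_real (p (circ l 1 x)))) =
          a * (f x * (circ l (k + 1) x * h x)) + b * (f x * (circ l (k - 1) x * h x))" for x
        using circ_add[of l k 1 x] circ_add[of l k "-1" x] by (simp add: p cnj_circ algebra_simps)
      then show "(LINT x|?M. f x * (circ l k x * (h x * of_real (p (circ l 1 x))))) = 0"
        using 0 i by simp
    qed
  next
    case (const c)
    show ?case by (simp add: mult.assoc[symmetric])
  next
    case (add p q)
    show ?case
    proof (intro allI impI)
      fix h k assume h: "continuous_on {- l..l} h" and 0: "\<forall>k. (LINT x|?M. f x * (circ l k x * h x)) = 0"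
      have i: "integrable ?M (\<lambda>x. f x * (circ l k x * (h x * of_real (r (circ l 1 x)))))"
        if "real_polynomial_function r" for r
        using f h that by (intro integrable_mult_bounded continuous_on_mult continuous_on_circ cont_p)
      have "f x * (circ l k x * (h x * of_real (p (circ l 1 x) + q (circ l 1 x)))) =
          f x * (circ l k x * (h x * of_real (p (circ l 1 x)))) + f x * (circ l k x * (h x * of_real (q (circ l 1 x))))" for x
        by (simp add: algebra_simps)
      then show "(LINT x|?M. f x * (circ l k x * (h x * of_real (p (circ l 1 x) + q (circ l 1 x))))) = 0"
        using add h 0 i by simp
    qed
  next
    case (mult p q)
    show ?case
    proof (intro allI impI)
      fix h k assume h: "continuous_on {- l..l} h" and 0: "\<forall>k. (LINT x|?M. f x * (circ l k x * h x)) = 0"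
      have "continuous_on {- l..l} (\<lambda>x. h x * of_real (p (circ l 1 x)))"
        using h mult.hyps by (intro continuous_on_mult cont_p)
      moreover have "\<forall>k. (LINT x|?M. f x * (circ l k x * (h x * of_real (p (circ l 1 x))))) = 0"
        using mult.IH(1) h 0 by blast
      ultimately show "(LINT x|?M. f x * (circ l k x * (h x * of_real (p (circ l 1 x) * q (circ l 1 x))))) = 0"
        using mult.IH(2)[rule_format, of "\<lambda>x. h x * of_real (p (circ l 1 x))" k]
        by (simp add: mult.assoc)
    qed
  qed
  from this[rule_format, of "\<lambda>_. 1" 0] orth show ?thesis by simp
qed

lemma orthogonal_continuous:
  assumes \<phi>: "continuous_on (sphere 0 1) \<phi>"
  shows "(LINT x|lebesgue_on {- l..l}. f x * of_real (\<phi> (circ l 1 x))) = 0"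
proof -
  let ?M = "lebesgue_on {- l..l}"
  define B where "B = (LINT x|?M. norm (f x))"
  have B: "0 \<le> B" unfolding B_def by (rule Bochner_Integration.integral_nonneg) simp
  have on: "circ l 1 x \<in> sphere 0 1" for x by (simp add: sphere_def dist_norm)
  have c\<phi>: "continuous_on {- l..l} (\<lambda>x. complex_of_real (\<phi> (circ l 1 x)))"
    using on by (intro continuous_on_of_real continuous_on_compose2[OF \<phi> continuous_on_circ]) auto
  have "norm (LINT x|?M. f x * of_real (\<phi> (circ l 1 x))) \<le> e * B" if e: "0 < e" for e
  proof -
    obtain p where p: "real_polynomial_function p" "\<And>x. x \<in> sphere 0 1 \<Longrightarrow> \<bar>\<phi> x - p x\<bar> < e"
      using Stone_Weierstrass_real_polynomial_function[OF compact_sphere \<phi> e] by blast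
    have cp: "continuous_on {- l..l} (\<lambda>x. complex_of_real (p (circ l 1 x)))"
      using p(1) continuous_on_compose2[OF continuous_on_polymonial_function[of p UNIV] continuous_on_circ]
      by (intro continuous_on_of_real) (auto simp: real_polynomial_function_eq)
    have "(LINT x|?M. f x * of_real (\<phi> (circ l 1 x))) =
        (LINT x|?M. f x * of_real (\<phi> (circ l 1 x)) - f x * of_real (p (circ l 1 x)))"
      using orthogonal_polynomial[OF p(1)] integrable_mult_bounded[OF f c\<phi>] integrable_mult_bounded[OF f cp]
      by simp
    also have "norm \<dots> \<le> (LINT x|?M. e * norm (f x))"
    proof (rule order_trans[OF integral_norm_bound integral_mono])
      show "integrable ?M (\<lambda>x. norm (f x * of_real (\<phi> (circ l 1 x)) - f x * of_real (p (circ l 1 x))))"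
        using integrable_mult_bounded[OF f c\<phi>] integrable_mult_bounded[OF f cp] by simp
      show "integrable ?M (\<lambda>x. e * norm (f x))" using f by simp
      fix x
      have "norm (f x * of_real (\<phi> (circ l 1 x)) - f x * of_real (p (circ l 1 x))) =
          norm (f x) * \<bar>\<phi> (circ l 1 x) - p (circ l 1 x)\<bar>"
        by (simp add: norm_mult flip: right_diff_distrib of_real_diff)
      also have "\<dots> \<le> norm (f x) * e" using p(2)[OF on, of x] by (intro mult_left_mono) auto
      finally show "norm (f x * of_real (\<phi> (circ l 1 x)) - f x * of_real (p (circ l 1 x))) \<le> e * norm (f x)"
        by (simp add: mult.commute)
    qed
    also have "\<dots> = e * B" by (simp add: B_def)
    finally show ?thesis .
  qed
  note bound = this
  have "norm (LINT x|?M. f x * of_real (\<phi> (circ l 1 x))) \<le> 0 + e" if e: "0 < e" for e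
  proof -
    \<comment> \<open>Dividing by B + 1 instead of B covers the case B = 0.\<close>
    have "norm (LINT x|?M. f x * of_real (\<phi> (circ l 1 x))) \<le> e / (B + 1) * B"
      using e B by (intro bound) simp
    also have "\<dots> \<le> e" using e B by (simp add: field_simps)
    finally show ?thesis by simp
  qed
  then have "norm (LINT x|?M. f x * of_real (\<phi> (circ l 1 x))) \<le> 0" by (rule field_le_epsilon)
  then show ?thesis by simp
qed

text \<open>The indicator of an open set is the pointwise limit of the truncated distances min 1 (n
  infdist z (- U)), and dominated convergence applies. The complement has to be nonempty because
  \<open>infdist\<close> to the empty set is 0.\<close>

lemma orthogonal_open:
  assumes U: "open U" "U \<noteq> UNIV"
  shows "(LINT x|lebesgue_on {- l..l}. f x * indicator U (circ l 1 x)) = 0"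
proof -
  let ?M = "lebesgue_on {- l..l}"
  define \<phi> where "\<phi> n z = min 1 (real n * infdist z (- U))" for n and z :: complex
  have c: "continuous_on S (\<phi> n)" for S n unfolding \<phi>_def by (intro continuous_intros)
  have [measurable]: "f \<in> borel_measurable ?M" using f by simp
  have m: "(\<lambda>x. f x * of_real (\<phi> n (circ l 1 x))) \<in> borel_measurable ?M" for n
  proof -
    have [measurable]: "(\<lambda>x. complex_of_real (\<phi> n (circ l 1 x))) \<in> borel_measurable ?M"
      by (intro continuous_measurable continuous_on_of_real
          continuous_on_compose2[OF c continuous_on_circ subset_UNIV])
    show ?thesis by measurable
  qed
  have [measurable]: "U \<in> sets borel" using U by simp
  have lim: "(\<lambda>n. \<phi> n z) \<longlonglongrightarrow> indicator U z" for z
  proof (cases "z \<in> U")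
    case True
    then have pos: "0 < infdist z (- U)"
      using U in_closed_iff_infdist_zero[of "- U" z] infdist_nonneg[of z "- U"]
      by (auto simp: closed_Compl less_le)
    obtain N where N: "1 < real N * infdist z (- U)"
      using reals_Archimedean3[OF pos] by blast
    have "\<phi> n z = 1" if "N \<le> n" for n
    proof -
      have "real N * infdist z (- U) \<le> real n * infdist z (- U)"
        using that pos by (intro mult_right_mono) auto
      then show ?thesis using N by (simp add: \<phi>_def)
    qed
    then have "\<forall>\<^sub>F n in sequentially. \<phi> n z = indicator U z"
      using True by (intro eventually_sequentiallyI[of N]) simp
    then show ?thesis by (rule tendsto_eventually)
  next
    case False
    then show ?thesis by (simp add: \<phi>_def)
  qed
  have "(\<lambda>n. LINT x|?M. f x * of_real (\<phi> n (circ l 1 x))) \<longlonglongrightarrow>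
      (LINT x|?M. f x * indicator U (circ l 1 x))"
  proof (rule integral_dominated_convergence)
    show "integrable ?M (\<lambda>x. norm (f x))" using f by simp
    have "(\<lambda>n. complex_of_real (\<phi> n z)) \<longlonglongrightarrow> indicator U z" for z
      using tendsto_of_real[OF lim[of z], where 'a = complex] by (simp add: of_real_indicator)
    then show "AE x in ?M. (\<lambda>n. f x * of_real (\<phi> n (circ l 1 x))) \<longlonglongrightarrow> f x * indicator U (circ l 1 x)"
      by (intro AE_I2 tendsto_mult tendsto_const)
    have "\<bar>\<phi> n z\<bar> \<le> 1" for n z by (auto simp: \<phi>_def infdist_nonneg)
    then show "AE x in ?M. norm (f x * of_real (\<phi> n (circ l 1 x))) \<le> norm (f x)" for n
      by (intro AE_I2) (simp add: norm_mult mult_left_le)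
  qed (use m in auto)
  moreover have "(LINT x|?M. f x * of_real (\<phi> n (circ l 1 x))) = 0" for n
    by (rule orthogonal_continuous[OF c])
  ultimately show ?thesis by (simp add: LIMSEQ_const_iff)
qed

text \<open>The endpoints l and -l are sent to the same point -1 of the circle, which lies on the
  branch cut of the logarithm, so they have to be discarded.\<close>

lemma AE_interior: "AE x in lebesgue_on {- l..l}. x \<in> {- l<..<l}"
proof -
  have "AE x in lebesgue. x \<noteq> a" for a :: real
    by (rule AE_not_in[of "{a}", simplified]) (auto simp: null_sets_completionI)
  then have "AE x in lebesgue. x \<noteq> l \<and> x \<noteq> - l" by (simp add: AE_conj_iff)
  then have "AE x in lebesgue. x \<in> {- l..l} \<longrightarrow> x \<in> {- l<..<l}" by eventually_elim auto
  then show ?thesis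
    using AE_restrict_space_iff[of "{- l..l}" lebesgue "\<lambda>x. x \<in> {- l<..<l}"] by (simp only: sets.Int_space_eq2 lmeasurable_cbox) simp
qed

text \<open>On the open interval from -l to l the map to the circle is inverted by l Im (Ln z) / pi.
  The interval is therefore the preimage of a sector U of the slit plane, which is open since the
  logarithm is continuous there, and which misses 0.\<close>

lemma orthogonal_interval:
  "(LINT x|lebesgue_on {- l..l}. f x * indicator {a<..<b} x) = 0"
proof -
  let ?M = "lebesgue_on {- l..l}"
  define U where "U = {z. z \<notin> \<real>\<^sub>\<le>\<^sub>0 \<and> l * Im (Ln z) / pi \<in> {a<..<b}}"
  have [measurable]: "f \<in> borel_measurable ?M" using f by simp
  have "open ((- \<real>\<^sub>\<le>\<^sub>0) \<inter> (\<lambda>z. l * Im (Ln z) / pi) -` {a<..<b})"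
    by (intro continuous_open_preimage continuous_intros) auto
  then have U: "open U" by (auto simp: U_def vimage_def Int_def)
  have "0 \<notin> U" by (simp add: U_def)
  then have ne: "U \<noteq> UNIV" by blast
  have iff: "circ l 1 x \<in> U \<longleftrightarrow> x \<in> {a<..<b}" if x: "x \<in> {- l<..<l}" for x
  proof -
    let ?t = "pi * x / l"
    have "- 1 < x / l" "x / l < 1" using x l by (auto simp: field_simps)
    then have t: "- pi < ?t" "?t < pi"
      using mult_strict_left_mono[of "- 1" "x / l" pi] mult_strict_left_mono[of "x / l" 1 pi] by auto
    have e: "circ l 1 x = exp (\<i> * of_real ?t)" by (simp add: circ_def)
    have "exp (\<i> * of_real ?t) \<notin> \<real>\<^sub>\<le>\<^sub>0"
    proof
      assume "exp (\<i> * of_real ?t) \<in> \<real>\<^sub>\<le>\<^sub>0"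
      then have "sin ?t = 0" "cos ?t \<le> 0"
        by (auto simp: complex_nonpos_Reals_iff Re_exp Im_exp)
      moreover have "?t = 0" by (rule sin_eq_0_pi[OF t \<open>sin ?t = 0\<close>])
      ultimately show False by (simp only: cos_zero)
    qed
    moreover have "Ln (exp (\<i> * of_real ?t)) = \<i> * of_real ?t"
      using t by (intro Ln_exp) auto
    ultimately show ?thesis using l unfolding e U_def by simp
  qed
  have "AE x in ?M. f x * indicator {a<..<b} x = f x * indicator U (circ l 1 x)"
    using AE_interior by eventually_elim (simp only: indicator_def iff)
  moreover have [measurable]: "U \<in> sets borel" using U by simp
  moreover have [measurable]: "(indicator {a<..<b} :: real \<Rightarrow> complex) \<in> borel_measurable ?M"
    by (intro measurable_restrict_space1 borel_measurable_indicator) simp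
  ultimately have "(LINT x|?M. f x * indicator {a<..<b} x) = (LINT x|?M. f x * indicator U (circ l 1 x))"
    by (intro integral_cong_AE) measurable
  then show ?thesis using orthogonal_open[OF U ne] by simp
qed

text \<open>The Borel sets over which f integrates to 0 contain the intersection-stable family of
  intervals, are closed under complements by orthogonality to the constant (k = 0), and under
  disjoint unions by countable additivity.\<close>

lemma AE_zero_if_orthogonal: "AE x in lebesgue_on {- l..l}. f x = 0"
proof (rule M.density_zero[OF f])
  let ?M = "lebesgue_on {- l..l}"
  have fm [measurable]: "f \<in> borel_measurable ?M" using f by simp
  have int: "integrable ?M (\<lambda>x. f x * indicator A x)" if "A \<in> sets lebesgue" for A
  proof (rule Bochner_Integration.integrable_bound[OF f])
    have [measurable]: "(indicator A :: real \<Rightarrow> complex) \<in> borel_measurable ?M"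
      using that by (intro measurable_restrict_space1) auto
    show "(\<lambda>x. f x * indicator A x) \<in> borel_measurable ?M" by measurable
  qed (auto simp: indicator_def)
  have borel: "(LINT x|?M. f x * indicator A x) = 0" if "A \<in> sets borel" for A
  proof -
    have sb: "sets borel = sigma_sets UNIV (range (\<lambda>(a, b). box a b :: real set))"
      unfolding borel_eq_box by (rule sets_measure_of) simp
    have A: "A \<in> sigma_sets UNIV (range (\<lambda>(a, b). box a b :: real set))"
      using that unfolding sb .
    have G: "Int_stable (range (\<lambda>(a, b). box a b :: real set))"
      by (auto simp: Int_stable_def box_Int_box)
    have sub: "range (\<lambda>(a, b). box a b :: real set) \<subseteq> Pow UNIV" by simp
    have s: "B \<in> sets lebesgue" if "B \<in> sigma_sets UNIV (range (\<lambda>(a, b). box a b :: real set))" for B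
    proof -
      have "B \<in> sets borel" unfolding sb by (rule that)
      then show ?thesis by simp
    qed
    show ?thesis
      using G sub A
    proof (induction rule: sigma_sets_induct_disjoint)
      case (basic B)
      then show ?case using orthogonal_interval by (auto simp: box_real)
    next
      case (compl B)
      have "(LINT x|?M. f x * indicator (UNIV - B) x) = (LINT x|?M. f x * circ l 0 x - f x * indicator B x)"
        by (intro Bochner_Integration.integral_cong) (auto simp: indicator_def)
      also have "\<dots> = 0"
        using orth[of 0] compl int[OF s[OF compl.hyps]] f by simp
      finally show ?case .
    next
      case (union B)
      have sB: "B n \<in> sets lebesgue" for n by (rule s) (use union.hyps in blast)
      have eq: "(LINT x|?M. f x * indicator B x) = set_lebesgue_integral ?M (B \<inter> {- l..l}) f" for B
        unfolding set_lebesgue_integral_def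
        by (intro Bochner_Integration.integral_cong) (auto simp: indicator_def)
      have "set_lebesgue_integral ?M (\<Union>n. B n \<inter> {- l..l}) f =
          (\<Sum>n. set_lebesgue_integral ?M (B n \<inter> {- l..l}) f)"
      proof (rule lebesgue_integral_countable_add)
        show BM: "B n \<inter> {- l..l} \<in> sets ?M" for n using sB by (auto simp: sets_restrict_space)
        show "B i \<inter> {- l..l} \<inter> (B j \<inter> {- l..l}) = {}" if "i \<noteq> j" for i j
          using union.hyps(1) that by (auto simp: disjoint_family_on_def)
        show "set_integrable ?M (\<Union>n. B n \<inter> {- l..l}) f"
          unfolding set_integrable_def
          by (rule integrable_mult_indicator[OF sets.countable_UN f]) (use BM in blast)
      qed
      then show ?case using union.IH unfolding eq by simp
    qed auto
  qed
  fix A assume "A \<in> sets ?M"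
  then have A: "A \<in> sets lebesgue" "A \<subseteq> {- l..l}"
    by (auto simp: sets_restrict_space)
  \<comment> \<open>A Lebesgue set differs from its Borel main part by a null set, which reduces the
    claim to Borel sets.\<close>
  have mp: "main_part lborel A \<in> sets borel" using main_part_sets[OF A(1)] by simp
  have "AE x in lebesgue. x \<in> main_part lborel A \<longleftrightarrow> x \<in> A"
    using A AE_in_main_part[of A lborel] by (simp add: AE_completion)
  then have "AE x in ?M. x \<in> main_part lborel A \<longleftrightarrow> x \<in> A"
    by (subst AE_restrict_space_iff) (auto elim: eventually_mono)
  then have "(LINT x|?M. f x * indicator A x) = (LINT x|?M. f x * indicator (main_part lborel A) x)"
    using int[OF A(1)] int[of "main_part lborel A"] mp
    by (intro integral_cong_AE) (auto simp: indicator_def borel_measurable_integrable elim!: eventually_mono)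
  then show "set_lebesgue_integral ?M A f = 0"
    using borel[OF mp] by (simp add: set_lebesgue_integral_def scaleR_conv_of_real of_real_indicator mult.commute)
qed

end
end


subsection \<open>The Dirac operator of a curve\<close>

text \<open>Converts unconditional summation over the integers into symmetric partial sums;
  \<open>op_closure\<close> asks for sequences.\<close>

lemma filterlim_int_intervals:
  "filterlim (\<lambda>n::nat. {- int n..int n}) (finite_subsets_at_top UNIV) sequentially"
  unfolding filterlim_finite_subsets_at_top
proof (intro allI impI)
  fix X :: "int set" assume "finite X \<and> X \<subseteq> UNIV"
  then have "finite X" by simp
  then obtain N where N: "\<And>x. x \<in> X \<Longrightarrow> nat \<bar>x\<bar> \<le> N"
    using finite_nat_set_iff_bounded_le[of "(\<lambda>x. nat \<bar>x\<bar>) ` X"] by auto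
  have "X \<subseteq> {- int n..int n}" if "N \<le> n" for n
  proof
    fix x assume "x \<in> X"
    from N[OF this] that show "x \<in> {- int n..int n}" by auto
  qed
  then show "\<forall>\<^sub>F n in sequentially. finite {- int n..int n} \<and> X \<subseteq> {- int n..int n} \<and> {- int n..int n} \<subseteq> UNIV"
    by (intro eventually_sequentiallyI[of N]) auto
qed

context
  fixes l :: real
  assumes l: "0 < l"
begin

definition curve_measure :: "real measure" where
  "curve_measure = scale_measure (ennreal (1 / (2 * l))) (lebesgue_on {- l..l})"

lemma curve_space_eq: "curve_space l = L2_space curve_measure"
  by (simp add: curve_space_def curve_measure_def)

lemma sets_curve_measure [measurable_cong]: "sets curve_measure = sets (lebesgue_on {- l..l})"
  by (simp add: curve_measure_def)

lemma finite_measure_curve_measure: "finite_measure curve_measure"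
  using l unfolding curve_measure_def
  by (intro finite_measureI)
    (simp add: space_scale_measure emeasure_restrict_space ennreal_mult[symmetric])

lemma hilbert_space_curve_space: "hilbert_space (curve_space l)"
  unfolding curve_space_eq by (rule finite_measure.hilbert_space_L2_space[OF finite_measure_curve_measure])

interpretation C: hilbert_space "curve_space l" by (rule hilbert_space_curve_space)
interpretation M: finite_measure curve_measure by (rule finite_measure_curve_measure)

lemma measurable_curve_measure:
  "borel_measurable curve_measure = borel_measurable (lebesgue_on {- l..l})"
  by (rule measurable_cong_sets) (auto simp: sets_curve_measure)

lemma curve_carrier_measurable: "f \<in> hcarrier (curve_space l) \<Longrightarrow> f \<in> borel_measurable (lebesgue_on {- l..l})"
  by (simp add: curve_space_eq L2_space_def measurable_curve_measure)

lemma circ_closed: "circ l k \<in> hcarrier (curve_space l)"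
  using circ_measurable[OF l] by (simp add: curve_space_eq L2_space_def measurable_curve_measure)

lemma inner_circ:
  assumes f: "f \<in> hcarrier (curve_space l)"
  shows "hinner (curve_space l) f (circ l k) =
    (1 / (2 * l)) *\<^sub>R (LINT x|lebesgue_on {- l..l}. f x * circ l (- k) x)"
proof -
  note curve_carrier_measurable[OF f, measurable] circ_measurable[OF l, measurable]
  have "hinner (curve_space l) f (circ l k) = (LINT x|curve_measure. f x * circ l (- k) x)"
    by (simp add: curve_space_eq L2_space_def cnj_circ)
  then show ?thesis
    using l unfolding curve_measure_def by (subst (asm) integral_scale_measure) auto
qed

lemma curve_basis: "hilbert_basis (curve_space l) (circ l) UNIV"
proof
  have "hinner (curve_space l) (circ l k) (circ l m) = (if k = m then 1 else 0)" for k m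
    using l integral_circ[OF l, of "k - m"]
    by (simp add: inner_circ circ_closed circ_add[symmetric] scaleR_conv_of_real)
  then show "C.orthonormal (circ l) UNIV"
    by (simp add: C.orthonormal_def circ_closed)
  show "C.total (circ l) UNIV"
    unfolding C.total_def
  proof (intro ballI impI)
    fix f assume f: "f \<in> hcarrier (curve_space l)"
      and orth: "\<forall>k\<in>UNIV. hinner (curve_space l) f (circ l k) = 0"
    note fm [measurable] = curve_carrier_measurable[OF f]
    have sq: "integrable curve_measure (\<lambda>x. (cmod (f x))\<^sup>2)"
      using f by (simp add: curve_space_eq L2_space_def)
    have "integrable curve_measure f"
    proof (rule Bochner_Integration.integrable_bound)
      show "integrable curve_measure (\<lambda>x. 1 + (cmod (f x))\<^sup>2)" using sq by simp
      have "cmod (f x) \<le> 1 + (cmod (f x))\<^sup>2" for x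
        using sum_squares_bound[of 1 "cmod (f x)"] norm_ge_zero[of "f x"] by (simp del: norm_ge_zero)
      then show "AE x in curve_measure. norm (f x) \<le> norm (1 + (cmod (f x))\<^sup>2)"
        by (intro AE_I2) (auto intro: order_trans[OF _ abs_ge_self])
    qed measurable
    then have int: "integrable (lebesgue_on {- l..l}) f"
      using l unfolding curve_measure_def by (subst (asm) integrable_scale_measure) auto
    have "(LINT x|lebesgue_on {- l..l}. f x * circ l k x) = 0" for k
      using orth[THEN bspec, of "- k"] l by (simp add: inner_circ[OF f])
    then have ae: "AE x in lebesgue_on {- l..l}. f x = 0"
      by (intro AE_zero_if_orthogonal[OF l int])
    have "(LINT x|lebesgue_on {- l..l}. (cmod (f x))\<^sup>2) = (LINT x|lebesgue_on {- l..l}. 0)"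
      using ae by (intro integral_cong_AE) auto
    then have "(LINT x|curve_measure. (cmod (f x))\<^sup>2) = 0"
      using l unfolding curve_measure_def by (subst integral_scale_measure) auto
    then show "hnorm (curve_space l) f = 0"
      unfolding curve_space_eq hnorm_L2_space by simp
  qed
qed

interpretation C: hilbert_basis "curve_space l" "circ l" UNIV by (rule curve_basis)

lemma trig_poly_eq: "trig_poly l = {\<lambda>x. \<Sum>k\<in>S. c k * circ l k x | (S :: int set) c. finite S}"
  by (simp add: trig_poly_def circ_def)

lemma trig_poly_derivative:
  "vector_derivative (\<lambda>x. \<Sum>k\<in>S. c k * circ l k x) (at x) =
    (\<Sum>k\<in>S. c k * (\<i> * of_real (pi * of_int k / l) * circ l k x))"
  by (intro vector_derivative_at has_vector_derivative_sum has_vector_derivative_mult_right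
      circ_has_vector_derivative)

text \<open>Coefficients are continuous in the norm, so their relation passes from trigonometric
  polynomials to the closure. Conversely, -i times the derivative of a partial Fourier sum of h is
  the same partial sum of g, so one sequence in the graph approximates both.\<close>

lemma op_closure_derivative:
  "op_closure (curve_space l) {(u, \<lambda>x. - \<i> * vector_derivative u (at x)) | u. u \<in> trig_poly l} =
    C.diag_op (\<lambda>k. pi * of_int k / l)"
proof (intro equalityI subsetI)
  let ?G = "{(u, \<lambda>x. - \<i> * vector_derivative u (at x)) | u. u \<in> trig_poly l}"
  have graph: "u \<in> hcarrier (curve_space l) \<and> v \<in> hcarrier (curve_space l) \<and>
      (\<forall>k. C.coef v k = of_real (pi * of_int k / l) * C.coef u k)" if "(u, v) \<in> ?G" for u v
  proof -
    obtain S c where S: "finite S" and u: "u = (\<lambda>x. \<Sum>k\<in>S. c k * circ l k x)"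
      and v: "v = (\<lambda>x. - \<i> * vector_derivative u (at x))"
      using \<open>(u, v) \<in> ?G\<close> unfolding trig_poly_eq by blast
    have v': "v = (\<lambda>x. \<Sum>k\<in>S. (of_real (pi * of_int k / l) * c k) * circ l k x)"
      unfolding v u trig_poly_derivative by (simp add: sum_distrib_left mult_ac)
    have "C.coef u k = (if k \<in> S then c k else 0)" for k
      unfolding u by (rule C.inner_orthonormal_sum[OF C.onb S]) auto
    moreover have "C.coef v k = (if k \<in> S then of_real (pi * of_int k / l) * c k else 0)" for k
      unfolding v' by (rule C.inner_orthonormal_sum[OF C.onb S]) auto
    moreover have "u \<in> hcarrier (curve_space l)"
      unfolding u by (intro C.sum_closed circ_closed)
    moreover have "v \<in> hcarrier (curve_space l)"
      unfolding v' by (intro C.sum_closed circ_closed)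
    ultimately show ?thesis by simp
  qed
  fix hg assume "hg \<in> op_closure (curve_space l) ?G"
  then obtain h g u v where hg: "hg = (h, g)" "h \<in> hcarrier (curve_space l)" "g \<in> hcarrier (curve_space l)"
    and uv: "\<And>n::nat. (u n, v n) \<in> ?G"
    and lim: "(\<lambda>n. hnorm (curve_space l) (\<lambda>x. u n x - h x)) \<longlonglongrightarrow> 0"
      "(\<lambda>n. hnorm (curve_space l) (\<lambda>x. v n x - g x)) \<longlonglongrightarrow> 0"
    unfolding op_closure_def by blast
  have "C.coef g k = of_real (pi * of_int k / l) * C.coef h k" for k
  proof (rule LIMSEQ_unique)
    show "(\<lambda>n. C.coef (v n) k) \<longlonglongrightarrow> C.coef g k"
      using graph[OF uv] hg lim circ_closed by (intro C.tendsto_inner_left) auto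
    have "(\<lambda>n. of_real (pi * of_int k / l) * C.coef (u n) k) \<longlonglongrightarrow> of_real (pi * of_int k / l) * C.coef h k"
      using graph[OF uv] hg lim circ_closed by (intro tendsto_mult tendsto_const C.tendsto_inner_left) auto
    then show "(\<lambda>n. C.coef (v n) k) \<longlonglongrightarrow> of_real (pi * of_int k / l) * C.coef h k"
      using graph[OF uv] by simp
  qed
  then show "hg \<in> C.diag_op (\<lambda>k. pi * of_int k / l)"
    using hg by (simp add: C.diag_op_def)
next
  let ?G = "{(u, \<lambda>x. - \<i> * vector_derivative u (at x)) | u. u \<in> trig_poly l}"
  fix hg assume "hg \<in> C.diag_op (\<lambda>k. pi * of_int k / l)"
  then obtain h g where hg: "hg = (h, g)" "h \<in> hcarrier (curve_space l)" "g \<in> hcarrier (curve_space l)"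
    and coef: "\<And>k. C.coef g k = of_real (pi * of_int k / l) * C.coef h k"
    by (auto simp: C.diag_op_def)
  define p where "p f n = (\<lambda>x. \<Sum>k\<in>{- int n..int n}. C.coef f k * circ l k x)" for f and n :: nat
  have p_lim: "(\<lambda>n. hnorm (curve_space l) (\<lambda>x. p f n x - f x)) \<longlonglongrightarrow> 0"
    if f: "f \<in> hcarrier (curve_space l)" for f
  proof -
    have pc: "p f n \<in> hcarrier (curve_space l)" for n
      unfolding p_def by (intro C.sum_closed circ_closed)
    have "(\<lambda>n. \<Sum>k\<in>{- int n..int n}. (cmod (C.coef f k))\<^sup>2) \<longlonglongrightarrow> (hnorm (curve_space l) f)\<^sup>2"
      using C.parseval[OF C.onb C.total f] unfolding has_sum_def
      by (rule filterlim_compose) (rule filterlim_int_intervals)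
    then have "(\<lambda>n. (hnorm (curve_space l) f)\<^sup>2 - (\<Sum>k\<in>{- int n..int n}. (cmod (C.coef f k))\<^sup>2)) \<longlonglongrightarrow> 0"
      using tendsto_diff[OF tendsto_const[of "(hnorm (curve_space l) f)\<^sup>2"]] by force
    then have "(\<lambda>n. (hnorm (curve_space l) (\<lambda>x. f x - p f n x))\<^sup>2) \<longlonglongrightarrow> 0"
      unfolding p_def by (subst C.hnorm_diff_projection[OF C.onb _ _ f]) auto
    then have "(\<lambda>n. sqrt ((hnorm (curve_space l) (\<lambda>x. f x - p f n x))\<^sup>2)) \<longlonglongrightarrow> sqrt 0"
      by (rule tendsto_real_sqrt)
    then show ?thesis
      using C.hnorm_nonneg[OF C.diff_closed[OF f pc]] C.hnorm_diff_commute[OF f pc] by simp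
  qed
  have "(p h n, p g n) \<in> ?G" for n
  proof -
    have "p h n \<in> trig_poly l" 
      unfolding trig_poly_eq p_def by (rule CollectI, intro exI conjI, rule refl) simp
    moreover have "p g n = (\<lambda>x. - \<i> * vector_derivative (p h n) (at x))"
      unfolding p_def trig_poly_derivative by (simp add: coef sum_distrib_left mult_ac)
    ultimately show ?thesis by blast
  qed
  then show "hg \<in> op_closure (curve_space l) ?G"
    unfolding op_closure_def hg(1) using hg(2,3) p_lim by blast
qed

text \<open>Adding a multiple of the identity leaves the domain unchanged. The shift makes the
  eigenvalues odd multiples of pi / (2 l), in particular nonzero, and \<open>curve_trace_le\<close>
  relies on that.\<close>

theorem curve_dirac_diag: "curve_dirac l = C.diag_op (\<lambda>k. (2 * of_int k + 1) * pi / (2 * l))"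
proof -
  define c where "c = complex_of_real (pi / (2 * l))"
  define e where "e k = complex_of_real (pi * of_int k / l)" for k
  have ev: "complex_of_real ((2 * of_int k + 1) * pi / (2 * l)) = e k + c" for k
    unfolding e_def c_def of_real_add[symmetric] of_real_eq_iff using l by (simp add: field_simps)
  show ?thesis
    unfolding curve_dirac_def op_closure_derivative c_def[symmetric]
  proof (intro equalityI subsetI)
    fix hg assume "hg \<in> {(h, \<lambda>x. g x + c * h x) | h g. (h, g) \<in> C.diag_op (\<lambda>k. pi * of_int k / l)}"
    then obtain h g where "hg = (h, \<lambda>x. g x + c * h x)"
      "(h, g) \<in> C.diag_op (\<lambda>k. pi * of_int k / l)" by blast
    then show "hg \<in> C.diag_op (\<lambda>k. (2 * of_int k + 1) * pi / (2 * l))"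
      unfolding C.diag_op_def ev e_def[symmetric]
      by (auto simp: C.add_closed C.scale_closed C.inner_add_left C.inner_scale_left circ_closed
          distrib_right)
  next
    fix hg assume "hg \<in> C.diag_op (\<lambda>k. (2 * of_int k + 1) * pi / (2 * l))"
    then obtain h g where hg: "hg = (h, g)" "(h, g) \<in> C.diag_op (\<lambda>k. (2 * of_int k + 1) * pi / (2 * l))"
      by (cases hg) auto
    then have "(h, \<lambda>x. g x - c * h x) \<in> C.diag_op (\<lambda>k. pi * of_int k / l)"
      unfolding C.diag_op_def ev e_def[symmetric]
      by (auto simp: C.diff_closed C.scale_closed C.inner_diff_left C.inner_scale_left circ_closed
          distrib_right)
    then show "hg \<in> {(h, \<lambda>x. g x + c * h x) | h g. (h, g) \<in> C.diag_op (\<lambda>k. pi * of_int k / l)}"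
      unfolding hg(1)
      by (intro CollectI exI[where x = h] exI[where x = "\<lambda>x. g x - c * h x"] conjI) simp_all
  qed
qed

end


subsection \<open>The trace of a sum of curves\<close>

text \<open>Subadditivity is enough for an upper bound, so edges occurring in several of the sets
  \<open>A n\<close> do no harm.\<close>

lemma nn_integral_count_space_UNION_le:
  fixes f :: "'i \<Rightarrow> ennreal"
  shows "(\<integral>\<^sup>+ e. f e \<partial>count_space (\<Union>n::nat. A n)) \<le> (\<Sum>n. \<integral>\<^sup>+ e. f e \<partial>count_space (A n))"
proof -
  have "(\<integral>\<^sup>+ e. f e \<partial>count_space (\<Union>n. A n)) = (\<integral>\<^sup>+ e. f e * indicator (\<Union>n. A n) e \<partial>count_space UNIV)"
    by (simp add: nn_integral_restrict_space[symmetric] restrict_count_space)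
  also have "\<dots> \<le> (\<integral>\<^sup>+ e. (\<Sum>n. f e * indicator (A n) e) \<partial>count_space UNIV)"
  proof (rule nn_integral_mono)
    fix e
    show "f e * indicator (\<Union>n. A n) e \<le> (\<Sum>n. f e * indicator (A n) e)"
    proof (cases "e \<in> (\<Union>n. A n)")
      case True
      then obtain n where "e \<in> A n" by blast
      then have "f e * indicator (\<Union>n. A n) e \<le> (\<Sum>k\<in>{n}. f e * indicator (A k) e)"
        using True by simp
      also have "\<dots> \<le> (\<Sum>k. f e * indicator (A k) e)" by (rule sum_le_suminf) auto
      finally show ?thesis .
    qed simp
  qed
  also have "\<dots> = (\<Sum>n. \<integral>\<^sup>+ e. f e * indicator (A n) e \<partial>count_space UNIV)"
    by (rule nn_integral_suminf) simp
  also have "\<dots> = (\<Sum>n. \<integral>\<^sup>+ e. f e \<partial>count_space (A n))"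
    by (simp add: nn_integral_restrict_space[symmetric] restrict_count_space)
  finally show ?thesis .
qed

lemma nn_integral_count_space_mono_set:
  fixes f :: "'i \<Rightarrow> ennreal"
  assumes "A \<subseteq> B"
  shows "(\<integral>\<^sup>+ e. f e \<partial>count_space A) \<le> (\<integral>\<^sup>+ e. f e \<partial>count_space B)"
proof -
  have "(\<integral>\<^sup>+ e. f e * indicator A e \<partial>count_space UNIV) \<le> (\<integral>\<^sup>+ e. f e * indicator B e \<partial>count_space UNIV)"
    using assms by (intro nn_integral_mono) (auto split: split_indicator)
  then show ?thesis
    by (simp add: nn_integral_restrict_space[symmetric] restrict_count_space)
qed

text \<open>The trace contributed by a single curve, summed over its eigenvalues; it depends on the
  curve only through its length.\<close>

definition curve_trace :: "real \<Rightarrow> real \<Rightarrow> ennreal" where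
  "curve_trace p l = (\<integral>\<^sup>+ k. ennreal ((1 + ((2 * of_int k + 1) * pi / (2 * l))\<^sup>2) powr (- p / 2)) \<partial>count_space (UNIV :: int set))"

text \<open>The term k = 0 alone has the right order: for l \<le> 1 the summand 1 is at most 1 /
  l^2, so 1 + (pi / (2 l))^2 is at most a constant over l^2.\<close>

lemma curve_trace_ge:
  assumes l: "0 < l" "l \<le> 1" and p: "0 < p"
  shows "ennreal ((1 + (pi / 2)\<^sup>2) powr (- p / 2) * l powr p) \<le> curve_trace p l"
proof -
  have "1 + (pi / (2 * l))\<^sup>2 \<le> (1 + (pi / 2)\<^sup>2) / l\<^sup>2"
  proof -
    have "1 \<le> 1 / l\<^sup>2" using l by (simp add: power_le_one)
    then show ?thesis by (simp add: add_divide_distrib power_divide power_mult_distrib)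
  qed
  then have "((1 + (pi / 2)\<^sup>2) / l\<^sup>2) powr (- p / 2) \<le> (1 + (pi / (2 * l))\<^sup>2) powr (- p / 2)"
    using p by (intro powr_mono2') (auto intro: add_pos_nonneg)
  moreover have "((1 + (pi / 2)\<^sup>2) / l\<^sup>2) powr (- p / 2) = (1 + (pi / 2)\<^sup>2) powr (- p / 2) * l powr p"
  proof -
    have "(l\<^sup>2) powr (- p / 2) = l powr (- p)"
      using l by (simp add: powr_powr flip: powr_numeral)
    then show ?thesis
      using l by (simp add: powr_divide powr_minus_divide)
  qed
  ultimately have "ennreal ((1 + (pi / 2)\<^sup>2) powr (- p / 2) * l powr p) \<le>
      (\<integral>\<^sup>+ k. ennreal ((1 + ((2 * of_int k + 1) * pi / (2 * l))\<^sup>2) powr (- p / 2)) \<partial>count_space ({0} :: int set))"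
    by (simp add: nn_integral_count_space_finite ennreal_leI)
  also have "\<dots> \<le> curve_trace p l"
    unfolding curve_trace_def by (rule nn_integral_count_space_mono_set) simp
  finally show ?thesis .
qed

lemma odd_powr_summable:
  assumes p: "1 < p"
  shows "(\<lambda>k::int. \<bar>2 * of_int k + 1\<bar> powr (- p) :: real) summable_on UNIV"
proof -
  let ?f = "\<lambda>k::int. \<bar>2 * of_int k + 1\<bar> powr (- p) :: real"
  have "summable (\<lambda>n. real (Suc n) powr (- p))"
    using p by (subst summable_Suc_iff) (simp add: summable_real_powr_iff)
  then have s: "(\<lambda>n. real (Suc n) powr (- p)) summable_on UNIV"
    by (subst summable_on_UNIV_nonneg_real_iff) auto
  have le: "\<bar>2 * real n + 1\<bar> powr (- p) \<le> real (Suc n) powr (- p)" for n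
    using p by (intro powr_mono2') auto
  have 1: "(\<lambda>n. \<bar>2 * real n + 1\<bar> powr (- p)) summable_on UNIV"
    using s by (rule summable_on_comparison_test) (use le in auto)
  have "?f summable_on range int"
    using 1 by (subst summable_on_reindex) (auto simp: o_def)
  \<comment> \<open>The substitution k = - n - 1 reflects the negative frequencies: |2 k + 1| = 2 n
    + 1 again.\<close>
  moreover have "?f summable_on range (\<lambda>n. - int n - 1)"
  proof -
    have "\<bar>2 * of_int (- int n - 1) + 1\<bar> = \<bar>2 * real n + 1\<bar>" for n by simp
    then show ?thesis
      using 1 by (subst summable_on_reindex) (auto simp: o_def inj_on_def simp del: of_int_diff of_int_minus)
  qed
  moreover have "(UNIV :: int set) = range int \<union> range (\<lambda>n. - int n - 1)"
  proof -
    have "k \<in> range int \<union> range (\<lambda>n. - int n - 1)" for k :: int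
    proof (cases "0 \<le> k")
      case True then show ?thesis by (auto simp: image_iff intro: exI[of _ "nat k"])
    next
      case False then have "k = - int (nat (- k - 1)) - 1" by simp
      then show ?thesis by blast
    qed
    then show ?thesis by blast
  qed
  ultimately show ?thesis by (metis summable_on_union)
qed

text \<open>Dropping the summand 1 bounds each term by the power -p of the absolute eigenvalue,
  which is homogeneous in l. This leaves l^p times a convergent series over odd integers, with one
  constant for all lengths.\<close>

lemma curve_trace_le:
  assumes p: "1 < p"
  obtains C :: real where "0 \<le> C" "\<And>l. 0 < l \<Longrightarrow> curve_trace p l \<le> ennreal (C * l powr p)"
proof -
  let ?f = "\<lambda>k::int. \<bar>2 * of_int k + 1\<bar> powr (- p) :: real"
  obtain s where s: "(?f has_sum s) UNIV"
    using odd_powr_summable[OF p] by (auto simp: summable_on_def)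
  have s0: "0 \<le> s" by (rule has_sum_nonneg[OF s]) simp
  define C where "C = s * (pi / 2) powr (- p)"
  have "curve_trace p l \<le> ennreal (C * l powr p)" if l: "0 < l" for l
  proof -
    have "curve_trace p l \<le> (\<integral>\<^sup>+ k. ennreal (?f k * ((pi / 2) powr (- p) * l powr p)) \<partial>count_space UNIV)"
      unfolding curve_trace_def
    proof (intro nn_integral_mono ennreal_leI)
      fix k :: int
      have odd: "2 * real_of_int k + 1 \<noteq> 0"
      proof
        assume "2 * real_of_int k + 1 = 0"
        then have "real_of_int (2 * k + 1) = 0" by simp
        then have "2 * k + 1 = 0" by (simp only: of_int_eq_0_iff)
        then show False by presburger
      qed
      let ?t = "\<bar>2 * real_of_int k + 1\<bar> * (pi / 2) * (1 / l)"
      have t: "0 < ?t" using odd l by simp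
      have sq: "((2 * real_of_int k + 1) * pi / (2 * l))\<^sup>2 = ?t\<^sup>2"
        by (simp add: power_mult_distrib power_divide)
      have "(1 + ?t\<^sup>2) powr (- p / 2) \<le> (?t\<^sup>2) powr (- p / 2)"
        using p t by (intro powr_mono2') auto
      also have "\<dots> = ?t powr (- p)"
        using t by (simp add: powr_powr flip: powr_numeral)
      also have "\<dots> = ?f k * ((pi / 2) powr (- p) * l powr p)"
        using l odd by (simp add: powr_mult powr_divide powr_minus_divide)
      finally show "(1 + ((2 * of_int k + 1) * pi / (2 * l))\<^sup>2) powr (- p / 2) \<le> ?f k * ((pi / 2) powr (- p) * l powr p)"
        unfolding sq .
    qed
    also have "\<dots> = ennreal (s * ((pi / 2) powr (- p) * l powr p))"
      by (rule nn_integral_count_space_has_sum[OF has_sum_cmult_left[OF s]]) simp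
    finally show ?thesis by (simp add: C_def mult.assoc)
  qed
  moreover have "0 \<le> C" using s0 by (simp add: C_def)
  ultimately show ?thesis using that by blast
qed

text \<open>The eigenvalues of the direct sum are indexed by pairs of a curve and a frequency;
  summing over the frequency first leaves one term per curve. The transformed eigenvalues are at
  most 1, as \<open>positive_trace_diag\<close> demands.\<close>

theorem trace_curve_sum:
  fixes l :: "nat \<Rightarrow> real"
  assumes l: "\<And>j. 0 < l j" and p: "0 < p"
  shows "positive_trace (hilbert_sum (\<lambda>j. curve_space (l j)))
      (functional_calculus (hilbert_sum (\<lambda>j. curve_space (l j)))
        (operator_sum (\<lambda>j. curve_space (l j)) (\<lambda>j. curve_dirac (l j))) (\<lambda>t. (1 + t\<^sup>2) powr (- p / 2))) =
    (\<integral>\<^sup>+ j. curve_trace p (l j) \<partial>count_space UNIV)"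
proof -
  interpret F: hilbert_basis_family "\<lambda>j. curve_space (l j)" "\<lambda>j. circ (l j)"
    by (rule hilbert_basis_family.intro) (rule curve_basis[OF l])
  let ?a = "\<lambda>(j, k). (2 * of_int k + 1) * pi / (2 * l j)"
  have D: "operator_sum (\<lambda>j. curve_space (l j)) (\<lambda>j. curve_dirac (l j)) = F.sb.diag_op ?a"
    unfolding curve_dirac_diag[OF l] by (rule F.operator_sum_diag)
  have m: "(\<lambda>t::real. (1 + t\<^sup>2) powr (- p / 2)) \<in> borel_measurable borel" by measurable
  have "(1 + t\<^sup>2) powr (- p / 2) \<le> 1" for t :: real
  proof -
    have "(1 + t\<^sup>2) powr (- p / 2) \<le> 1 powr (- p / 2)" using p by (intro powr_mono2') auto
    then show ?thesis by simp
  qed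
  then have "positive_trace (hilbert_sum (\<lambda>j. curve_space (l j)))
      (F.sb.diag_op (\<lambda>i. (1 + (?a i)\<^sup>2) powr (- p / 2))) =
      (\<integral>\<^sup>+ i. ennreal ((1 + (?a i)\<^sup>2) powr (- p / 2)) \<partial>count_space UNIV)"
    by (intro F.sb.positive_trace_diag) auto
  also have "\<dots> = (\<integral>\<^sup>+ j. \<integral>\<^sup>+ k. ennreal ((1 + (?a (j, k))\<^sup>2) powr (- p / 2)) \<partial>count_space UNIV \<partial>count_space UNIV)"
    by (rule nn_integral_fst_count_space[symmetric])
  finally show ?thesis
    unfolding D F.sb.functional_calculus_diag[OF m] curve_trace_def by simp
qed


subsection \<open>Geometry of the edges\<close>

text \<open>Barycentric coordinates with respect to the three vertices; any index other than 1 and 2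
  stands for the third one. They describe the triangle by three inequalities, and a corner map acts
  on each of them separately.\<close>

definition bary :: "nat \<Rightarrow> real^2 \<Rightarrow> real" where
  "bary i x = (if i = 1 then 1 - x $ 1 - x $ 2 / sqrt 3 else if i = 2 then 2 * x $ 2 / sqrt 3
     else x $ 1 - x $ 2 / sqrt 3)"

abbreviation corners :: "nat set" where
  "corners \<equiv> {1, 2, 3}"

lemma vec2_eq_iff: "x = y \<longleftrightarrow> x $ 1 = y $ 1 \<and> x $ 2 = (y $ 2 :: real)" for x y :: "real^2"
  by (simp add: vec_eq_iff forall_2)

lemma norm_vec2: "norm x = sqrt ((x $ 1)\<^sup>2 + (x $ 2)\<^sup>2)" for x :: "real^2"
  by (simp add: norm_vec_def L2_set_def sum_2)

lemma gasket_pt_simps: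
  "gasket_pt 1 = vector [0, 0]" "gasket_pt (Suc 0) = vector [0, 0]" "gasket_pt 2 = vector [1 / 2, sqrt 3 / 2]" "gasket_pt 3 = vector [1, 0]"
  "gasket_pt 4 = vector [3 / 4, sqrt 3 / 4]" "gasket_pt 5 = vector [1 / 2, 0]"
  "gasket_pt 6 = vector [1 / 4, sqrt 3 / 4]"
  by (simp_all add: gasket_pt_def Let_def vec2_eq_iff)

lemma bary_gasket_pt: "i \<in> corners \<Longrightarrow> j \<in> corners \<Longrightarrow> bary i (gasket_pt j) = (if i = j then 1 else 0)"
  by (elim insertE emptyE; simp add: bary_def gasket_pt_simps)

lemma bary_sum: "bary 1 x + bary 2 x + bary 3 x = 1"
  by (simp add: bary_def)

lemma bary_comb: "x = bary 1 x *\<^sub>R gasket_pt 1 + bary 2 x *\<^sub>R gasket_pt 2 + bary 3 x *\<^sub>R gasket_pt 3"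
  by (simp add: vec2_eq_iff gasket_pt_simps bary_def field_simps)

lemma bary_affine:
  "i \<in> corners \<Longrightarrow> a + b = 1 \<Longrightarrow> bary i (a *\<^sub>R x + b *\<^sub>R y) = a * bary i x + b * bary i y"
proof -
  assume "a + b = 1"
  then have b: "b = 1 - a" by simp
  show ?thesis unfolding b by (simp add: bary_def field_simps)
qed

text \<open>The factor 2 is crude but reappears below: it turns a gap of \<alpha> between
  coordinates into a distance \<alpha> / 2.\<close>

lemma abs_bary_diff_le:
  assumes i: "i \<in> corners" shows "\<bar>bary i x - bary i y\<bar> \<le> 2 * dist x y"
proof -
  have 3: "1 \<le> sqrt 3" by simp
  have 1: "\<bar>x $ 1 - y $ 1\<bar> \<le> dist x y" "\<bar>x $ 2 - y $ 2\<bar> \<le> dist x y"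
    using component_le_norm_cart[of "x - y" 1] component_le_norm_cart[of "x - y" 2]
    by (auto simp: dist_norm)
  have 2: "\<bar>(x $ 2 - y $ 2) / sqrt 3\<bar> \<le> \<bar>x $ 2 - y $ 2\<bar>"
    using mult_left_mono[OF 3, of "\<bar>x $ 2 - y $ 2\<bar>"] by (simp add: abs_divide divide_le_eq)
  define p q where "p = x $ 1 - y $ 1" and "q = (x $ 2 - y $ 2) / sqrt 3"
  have "bary 1 x - bary 1 y = - p - q" "bary 2 x - bary 2 y = 2 * q" "bary 3 x - bary 3 y = p - q"
    by (simp_all add: p_def q_def bary_def diff_divide_distrib)
  moreover have "\<bar>p\<bar> \<le> dist x y" "\<bar>q\<bar> \<le> dist x y" using 1 2 by (auto simp: p_def q_def)
  ultimately have "\<bar>bary 1 x - bary 1 y\<bar> \<le> 2 * dist x y" "\<bar>bary 2 x - bary 2 y\<bar> \<le> 2 * dist x y"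
    "\<bar>bary 3 x - bary 3 y\<bar> \<le> 2 * dist x y"
    by linarith+
  then show ?thesis using i by blast
qed

lemma base_triangle_eq: "base_triangle = {x. \<forall>i\<in>corners. 0 \<le> bary i x}"
proof (intro equalityI subsetI)
  have "convex {x. \<forall>i\<in>corners. 0 \<le> bary i x}"
  proof (rule convexI)
    fix x y :: "real^2" and u v :: real
    assume "x \<in> {x. \<forall>i\<in>corners. 0 \<le> bary i x}" "y \<in> {x. \<forall>i\<in>corners. 0 \<le> bary i x}"
      "0 \<le> u" "0 \<le> v" "u + v = 1"
    then show "u *\<^sub>R x + v *\<^sub>R y \<in> {x. \<forall>i\<in>corners. 0 \<le> bary i x}"
      by (simp add: bary_affine)
  qed
  moreover have "{gasket_pt 1, gasket_pt 2, gasket_pt 3} \<subseteq> {x. \<forall>i\<in>corners. 0 \<le> bary i x}"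
    by (auto simp: bary_gasket_pt[unfolded One_nat_def] bary_gasket_pt)
  ultimately show "x \<in> {x. \<forall>i\<in>corners. 0 \<le> bary i x}" if "x \<in> base_triangle" for x
    using that hull_minimal[of "{gasket_pt 1, gasket_pt 2, gasket_pt 3}" _ convex]
    unfolding base_triangle_def by blast
next
  fix x assume "x \<in> {x. \<forall>i\<in>corners. 0 \<le> bary i x}"
  then show "x \<in> base_triangle"
    unfolding base_triangle_def convex_hull_3 using bary_comb[of x] bary_sum[of x] by blast
qed

lemma compact_base_triangle: "compact base_triangle"
  unfolding base_triangle_def by (intro compact_convex_hull finite_imp_compact) simp

lemma gasket_pt_in_base_triangle: "i \<in> corners \<Longrightarrow> gasket_pt i \<in> base_triangle"
  unfolding base_triangle_def by (auto intro!: hull_inc)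

lemma dist_gasket_pt:
  assumes "i \<in> corners" "j \<in> corners" "i \<noteq> j"
  shows "dist (gasket_pt i) (gasket_pt j) = 1"
  using assms by (elim insertE emptyE;
      simp add: dist_norm norm_vec2 gasket_pt_simps power_divide power_mult_distrib)

text \<open>A segment determines its endpoints up to order, so the description by \<open>THE\<close>
  has a unique solution.\<close>

lemma segment_length_closed_segment: "segment_length (closed_segment x y) = dist x y"
  for x y :: "'a::euclidean_space"
  unfolding segment_length_def
proof (rule the_equality)
  fix l assume "\<exists>a b. closed_segment x y = closed_segment a b \<and> l = dist a b"
  then obtain a b where "{x, y} = {a, b}" "l = dist a b" by auto
  then show "l = dist x y" by (auto simp: doubleton_eq_iff dist_commute)
qed blast

section \<open>The six maps and their action on the triangle\<close>

locale gasket_parameter =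
  fixes \<alpha> :: real
  assumes \<alpha>_pos: "0 < \<alpha>" and \<alpha>_less: "\<alpha> < 1 / 3"
begin

definition r :: real where "r = (1 - \<alpha>) / 2"

lemma r_bounds: "\<alpha> < r" "0 < r" "r < 1 / 2" "1 / 3 < r"
  using \<alpha>_pos \<alpha>_less by (auto simp: r_def)

lemma gasket_map_corner:
  "j \<in> corners \<Longrightarrow> gasket_map \<alpha> j x = r *\<^sub>R x + (1 - r) *\<^sub>R gasket_pt j"
  by (auto simp: gasket_map_def gasket_mat_def r_def scaleR_matrix_vector_assoc[symmetric] algebra_simps)

lemma bary_corner:
  "i \<in> corners \<Longrightarrow> j \<in> corners \<Longrightarrow>
    bary i (gasket_map \<alpha> j x) = r * bary i x + (if i = j then 1 - r else 0)"
  using bary_affine[of i r "1 - r" x "gasket_pt j"] by (simp add: gasket_map_corner bary_gasket_pt)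

text \<open>The matrices of index 4, 5, 6 are \<alpha> times the orthogonal projection onto the
  direction of a side. The image therefore lies on that side, around its midpoint, and depends only
  on the difference of two barycentric coordinates, so the three maps can be treated at
  once.\<close>

lemma gasket_map_join:
  assumes "j \<in> {4, 5, 6}"
  shows "\<exists>a\<in>corners. \<exists>b\<in>corners. a \<noteq> b \<and>
    (\<forall>x. gasket_map \<alpha> j x = (1 / 2 + \<alpha> / 2 * (bary a x - bary b x)) *\<^sub>R gasket_pt a
       + (1 / 2 - \<alpha> / 2 * (bary a x - bary b x)) *\<^sub>R gasket_pt b)"
proof -
  have 3: "sqrt 3 * (sqrt 3 * z) = 3 * z" for z :: real by (simp add: mult.assoc[symmetric])
  have eq: "gasket_map \<alpha> 4 x = (1 / 2 + \<alpha> / 2 * (bary 2 x - bary 3 x)) *\<^sub>R gasket_pt 2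
      + (1 / 2 - \<alpha> / 2 * (bary 2 x - bary 3 x)) *\<^sub>R gasket_pt 3"
    "gasket_map \<alpha> 5 x = (1 / 2 + \<alpha> / 2 * (bary 3 x - bary 1 x)) *\<^sub>R gasket_pt 3
      + (1 / 2 - \<alpha> / 2 * (bary 3 x - bary 1 x)) *\<^sub>R gasket_pt 1"
    "gasket_map \<alpha> 6 x = (1 / 2 + \<alpha> / 2 * (bary 2 x - bary 1 x)) *\<^sub>R gasket_pt 2
      + (1 / 2 - \<alpha> / 2 * (bary 2 x - bary 1 x)) *\<^sub>R gasket_pt 1" for x
    by (simp_all add: gasket_map_def gasket_mat_def gasket_pt_simps vec2_eq_iff matrix_vector_mult_def
        sum_2 bary_def field_simps 3)
  consider "j = 4" | "j = 5" | "j = 6" using assms by blast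
  then show ?thesis
  proof cases
    case 1
    show ?thesis using eq(1) unfolding 1 by (intro bexI[of _ 2, OF bexI[of _ 3]] conjI allI) auto
  next
    case 2
    show ?thesis using eq(2) unfolding 2 by (intro bexI[of _ 3, OF bexI[of _ 1]] conjI allI) auto
  next
    case 3
    show ?thesis using eq(3) unfolding 3 by (intro bexI[of _ 2, OF bexI[of _ 1]] conjI allI) auto
  qed
qed

text \<open>2 / 3 is a common contraction factor: corner maps contract by r < 1 / 2, and the crude
  barycentric estimate gives 2 \<alpha> < 2 / 3 for the joining maps.\<close>

lemma gasket_map_Lipschitz:
  assumes j: "j \<in> {1..6}" shows "dist (gasket_map \<alpha> j x) (gasket_map \<alpha> j y) \<le> 2 / 3 * dist x y"
proof (cases "j \<in> corners")
  case True
  have "dist (gasket_map \<alpha> j x) (gasket_map \<alpha> j y) = r * dist x y"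
    using r_bounds by (simp add: gasket_map_corner[OF True] dist_norm flip: scaleR_diff_right)
  also have "\<dots> \<le> 2 / 3 * dist x y" using r_bounds by (intro mult_right_mono) auto
  finally show ?thesis .
next
  case False
  have "{1..6} = corners \<union> {4, 5, 6}" by auto
  with False j have "j \<in> {4, 5, 6}" by blast
  then obtain a b where ab: "a \<in> corners" "b \<in> corners" "a \<noteq> b"
    and eq: "\<And>x. gasket_map \<alpha> j x = (1 / 2 + \<alpha> / 2 * (bary a x - bary b x)) *\<^sub>R gasket_pt a
       + (1 / 2 - \<alpha> / 2 * (bary a x - bary b x)) *\<^sub>R gasket_pt b"
    using gasket_map_join by blast
  let ?t = "(bary a x - bary a y) - (bary b x - bary b y)"
  have "gasket_map \<alpha> j x - gasket_map \<alpha> j y = (\<alpha> / 2 * ?t) *\<^sub>R (gasket_pt a - gasket_pt b)"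
    unfolding eq by (simp add: algebra_simps)
  then have "dist (gasket_map \<alpha> j x) (gasket_map \<alpha> j y) = \<alpha> / 2 * \<bar>?t\<bar>"
    using \<alpha>_pos dist_gasket_pt[OF ab] by (simp add: dist_norm abs_mult)
  also have "\<dots> \<le> \<alpha> / 2 * (4 * dist x y)"
    using abs_bary_diff_le[OF ab(1), of x y] abs_bary_diff_le[OF ab(2), of x y] \<alpha>_pos
    by (intro mult_left_mono) linarith+
  also have "\<dots> = 2 * \<alpha> * dist x y" by simp
  also have "\<dots> \<le> 2 / 3 * dist x y" using \<alpha>_less by (intro mult_right_mono) auto
  finally show ?thesis .
qed

lemma bary_bounds:
  assumes "x \<in> base_triangle" "i \<in> corners" shows "0 \<le> bary i x" "bary i x \<le> 1"
  using assms bary_sum[of x] by (auto simp: base_triangle_eq)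

lemma join_image:
  assumes j: "j \<in> {4, 5, 6}"
  obtains u v where "gasket_map \<alpha> j ` base_triangle = closed_segment u v" "dist u v = \<alpha>"
    "u \<in> base_triangle" "v \<in> base_triangle"
proof -
  obtain a b where ab: "a \<in> corners" "b \<in> corners" "a \<noteq> b"
    and eq: "\<And>x. gasket_map \<alpha> j x = (1 / 2 + \<alpha> / 2 * (bary a x - bary b x)) *\<^sub>R gasket_pt a
       + (1 / 2 - \<alpha> / 2 * (bary a x - bary b x)) *\<^sub>R gasket_pt b"
    using gasket_map_join[OF j] by blast
  define f where "f t = (1 / 2 + \<alpha> / 2 * t) *\<^sub>R gasket_pt a + (1 / 2 - \<alpha> / 2 * t) *\<^sub>R gasket_pt b" for t
  have conv: "convex base_triangle" unfolding base_triangle_def by (rule convex_convex_hull)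
  have fT: "f t \<in> base_triangle" if "\<bar>t\<bar> \<le> 1" for t
    unfolding f_def
  proof (rule convexD[OF conv])
    have "\<bar>\<alpha> / 2 * t\<bar> \<le> 1 / 2 * 1"
      using that \<alpha>_pos \<alpha>_less unfolding abs_mult by (intro mult_mono) auto
    then show "0 \<le> 1 / 2 + \<alpha> / 2 * t" "0 \<le> 1 / 2 - \<alpha> / 2 * t" by linarith+
  qed (use ab in \<open>auto intro: gasket_pt_in_base_triangle\<close>)
  \<comment> \<open>Here t = 2 s - 1 runs through [-1, 1], the range of the coordinate difference on
    the triangle, while s is the segment parameter.\<close>
  have seg: "f (2 * s - 1) = (1 - s) *\<^sub>R f (- 1) + s *\<^sub>R f 1" for s
    by (simp add: f_def vec2_eq_iff field_simps)
  have "gasket_map \<alpha> j ` base_triangle = closed_segment (f (- 1)) (f 1)"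
  proof (intro equalityI subsetI)
    fix y assume "y \<in> gasket_map \<alpha> j ` base_triangle"
    then obtain x where x: "x \<in> base_triangle" "y = f (bary a x - bary b x)"
      by (auto simp: eq f_def)
    define d where "d = bary a x - bary b x"
    define s where "s = (d + 1) / 2"
    have "2 * s - 1 = d" by (simp add: s_def add_divide_distrib)
    then have "y = (1 - s) *\<^sub>R f (- 1) + s *\<^sub>R f 1"
      using x(2) seg[of s] by (simp only: d_def)
    moreover have "0 \<le> s" "s \<le> 1"
      using bary_bounds[OF x(1) ab(1)] bary_bounds[OF x(1) ab(2)] by (auto simp: s_def d_def)
    ultimately show "y \<in> closed_segment (f (- 1)) (f 1)" unfolding closed_segment_def by blast
  next
    fix y assume "y \<in> closed_segment (f (- 1)) (f 1)"
    then obtain s where s: "0 \<le> s" "s \<le> 1" "y = (1 - s) *\<^sub>R f (- 1) + s *\<^sub>R f 1"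
      unfolding closed_segment_def by blast
    \<comment> \<open>The side of the triangle from corner b to corner a already maps onto the whole
      joining segment, so a preimage can be taken there.\<close>
    define x where "x = s *\<^sub>R gasket_pt a + (1 - s) *\<^sub>R gasket_pt b"
    have "x \<in> base_triangle"
      unfolding x_def using s ab by (intro convexD[OF conv] gasket_pt_in_base_triangle) auto
    moreover have "bary a x - bary b x = 2 * s - 1"
      using ab unfolding x_def by (subst (1 2) bary_affine) (auto simp: bary_gasket_pt simp del: One_nat_def)
    then have "gasket_map \<alpha> j x = f (2 * s - 1)" unfolding eq f_def by simp
    ultimately show "y \<in> gasket_map \<alpha> j ` base_triangle" using s(3) seg[of s] by force
  qed
  moreover have "dist (f (- 1)) (f 1) = \<alpha>"
  proof -
    have "f 1 - f (- 1) = \<alpha> *\<^sub>R (gasket_pt a - gasket_pt b)"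
      by (simp add: f_def vec2_eq_iff field_simps)
    then show ?thesis
      using \<alpha>_pos dist_gasket_pt[OF ab] by (simp add: dist_norm norm_minus_commute)
  qed
  ultimately show ?thesis using that[of "f (- 1)" "f 1"] fT[of 1] fT[of "- 1"] by simp
qed

lemma gasket_map_triangle:
  assumes j: "j \<in> {1..6}" and x: "x \<in> base_triangle"
  shows "gasket_map \<alpha> j x \<in> base_triangle"
proof (cases "j \<in> corners")
  case True
  have "bary i (gasket_map \<alpha> j x) \<ge> 0" if "i \<in> corners" for i
    using bary_corner[OF that True, of x] bary_bounds(1)[OF x that] r_bounds by auto
  then show ?thesis by (simp add: base_triangle_eq del: One_nat_def)
next
  case False
  have "{1..6} = corners \<union> {4, 5, 6}" by auto
  with False j have "j \<in> {4, 5, 6}" by blast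
  then obtain u v where uv: "gasket_map \<alpha> j ` base_triangle = closed_segment u v"
    "u \<in> base_triangle" "v \<in> base_triangle"
    by (rule join_image)
  have "closed_segment u v \<subseteq> base_triangle"
    using uv unfolding base_triangle_def by (intro closed_segment_subset convex_convex_hull)
  then show ?thesis using uv(1) x by blast
qed

section \<open>Words, their similarities and the separation of cells\<close>

lemma words_snoc: "u @ [a] \<in> words (Suc n) \<longleftrightarrow> u \<in> words n \<and> a \<in> corners"
  by (auto simp: words_def)

lemma word_map_snoc: "word_map \<alpha> (u @ [a]) x = gasket_map \<alpha> a (word_map \<alpha> u x)"
  by (simp add: word_map_def)

lemma words_SucE:
  assumes "w \<in> words (Suc n)"
  obtains u a where "w = u @ [a]" "u \<in> words n" "a \<in> corners"
proof -
  have "w \<noteq> []" using assms by (auto simp: words_def)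
  then obtain u a where "w = u @ [a]" by (meson rev_exhaust)
  then show ?thesis using that assms words_snoc by blast
qed

lemma words_0: "words 0 = {[]}"
  by (auto simp: words_def)

text \<open>Corner maps have scalar linear part, so a word acts as a homothety. Distances scale
  exactly, and segments go to segments.\<close>

lemma word_map_affine: "w \<in> words n \<Longrightarrow> \<exists>c. \<forall>x. word_map \<alpha> w x = r ^ n *\<^sub>R x + c"
proof (induction n arbitrary: w)
  case 0
  then show ?case by (auto simp: words_0 word_map_def)
next
  case (Suc n)
  obtain u a where w: "w = u @ [a]" "u \<in> words n" "a \<in> corners"
    using Suc.prems by (rule words_SucE)
  obtain c where "\<And>x. word_map \<alpha> u x = r ^ n *\<^sub>R x + c" using Suc.IH[OF w(2)] by blast
  then have "word_map \<alpha> w x = r ^ Suc n *\<^sub>R x + (r *\<^sub>R c + (1 - r) *\<^sub>R gasket_pt a)" for x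
    using w(3) by (simp only: w(1) word_map_snoc gasket_map_corner) (simp add: scaleR_add_right)
  then show ?case by blast
qed

lemma dist_word_map:
  assumes "w \<in> words n" shows "dist (word_map \<alpha> w x) (word_map \<alpha> w y) = r ^ n * dist x y"
proof -
  obtain c where "\<forall>x. word_map \<alpha> w x = r ^ n *\<^sub>R x + c" using word_map_affine[OF assms] by blast
  then show ?thesis
    using r_bounds by (simp add: dist_norm flip: scaleR_diff_right)
qed

lemma word_map_segment:
  assumes "w \<in> words n"
  shows "word_map \<alpha> w ` closed_segment x y = closed_segment (word_map \<alpha> w x) (word_map \<alpha> w y)"
proof -
  obtain c where c: "\<forall>x. word_map \<alpha> w x = r ^ n *\<^sub>R x + c" using word_map_affine[OF assms] by blast
  then have "word_map \<alpha> w ` closed_segment x y = (\<lambda>x. c + x) ` ((\<lambda>x. r ^ n *\<^sub>R x) ` closed_segment x y)"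
    unfolding image_image by (intro image_cong) (simp_all add: add.commute)
  also have "(\<lambda>x. r ^ n *\<^sub>R x) ` closed_segment x y = closed_segment (r ^ n *\<^sub>R x) (r ^ n *\<^sub>R y)"
    by (rule closed_segment_linear_image[symmetric]) (rule linear_scaleR)
  also have "(\<lambda>x. c + x) ` \<dots> = closed_segment (word_map \<alpha> w x) (word_map \<alpha> w y)"
  proof -
    have "word_map \<alpha> w z = c + r ^ n *\<^sub>R z" for z using c by (simp add: add.commute)
    then show ?thesis by (simp only: closed_segment_translation)
  qed
  finally show ?thesis .
qed

lemma word_map_triangle: "w \<in> words n \<Longrightarrow> x \<in> base_triangle \<Longrightarrow> word_map \<alpha> w x \<in> base_triangle"
proof (induction n arbitrary: w)
  case 0
  then show ?case by (auto simp: words_0 word_map_def)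
next
  case (Suc n)
  obtain u a where w: "w = u @ [a]" "u \<in> words n" "a \<in> corners"
    using Suc.prems(1) by (rule words_SucE)
  then show ?case
    using Suc.IH[OF w(2) Suc.prems(2)] gasket_map_triangle[of a] by (auto simp: word_map_snoc)
qed

lemma card_words: "card (words n) = 3 ^ n"
  using card_lists_length_eq[of "{1, 2, 3 :: nat}" n]
  by (simp add: words_def conj_commute numeral_3_eq_3)

lemma finite_words: "finite (words n)"
  using finite_lists_length_eq[of "{1, 2, 3 :: nat}" n] by (simp add: words_def conj_commute)

text \<open>Coordinate a is at least 1 - r on cell a and at most r on the other corner cells. The
  gap 1 - 2 r = \<alpha> is halved by the Lipschitz constant 2 of the coordinates.\<close>

lemma corner_separation:
  assumes ab: "a \<in> corners" "b \<in> corners" "a \<noteq> b" and xy: "x \<in> base_triangle" "y \<in> base_triangle"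
  shows "\<alpha> / 2 \<le> dist (gasket_map \<alpha> a x) (gasket_map \<alpha> b y)"
proof -
  have "bary a (gasket_map \<alpha> a x) \<ge> 1 - r"
    using bary_corner[OF ab(1,1), of x] bary_bounds(1)[OF xy(1) ab(1)] r_bounds by simp
  moreover have "bary a (gasket_map \<alpha> b y) \<le> r"
    using bary_corner[OF ab(1,2), of y] bary_bounds(2)[OF xy(2) ab(1)] r_bounds ab(3)
    by (simp add: mult_left_le)
  moreover have "1 - r - r = \<alpha>" by (simp add: r_def field_simps)
  ultimately show ?thesis
    using abs_bary_diff_le[OF ab(1), of "gasket_map \<alpha> a x" "gasket_map \<alpha> b y"] by linarith
qed

text \<open>The letter applied last selects the coarsest cell, so closeness forces agreement at the
  end of the words. Each further common letter costs a factor r in the distance; the disjunct k = 0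
  keeps the truncated exponent k - 1 from imposing a condition there.\<close>

lemma common_suffix:
  assumes "v \<in> words n" "w \<in> words n" "k \<le> n" "x \<in> base_triangle" "y \<in> base_triangle"
    and "k = 0 \<or> dist (word_map \<alpha> v x) (word_map \<alpha> w y) < r ^ (k - 1) * (\<alpha> / 2)"
  shows "drop (n - k) v = drop (n - k) w"
  using assms
proof (induction k arbitrary: n v w)
  case 0
  then show ?case by (simp add: words_def)
next
  case (Suc k)
  then obtain m where n: "n = Suc m" by (cases n) auto
  obtain v' a where v: "v = v' @ [a]" "v' \<in> words m" "a \<in> corners"
    using Suc.prems(1) unfolding n by (rule words_SucE)
  obtain w' b where w: "w = w' @ [b]" "w' \<in> words m" "b \<in> corners"
    using Suc.prems(2) unfolding n by (rule words_SucE)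
  have T: "word_map \<alpha> v' x \<in> base_triangle" "word_map \<alpha> w' y \<in> base_triangle"
    using v w Suc.prems by (auto intro: word_map_triangle)
  have d: "dist (word_map \<alpha> v x) (word_map \<alpha> w y) < r ^ k * (\<alpha> / 2)" using Suc.prems by simp
  \<comment> \<open>The hypothesis is at least as strong as closeness below \<alpha> / 2, so the
    last letters agree; their common similarity is then undone, which divides the distance by
    r.\<close>
  have "r ^ k * (\<alpha> / 2) \<le> 1 * (\<alpha> / 2)"
    using r_bounds \<alpha>_pos by (intro mult_right_mono power_le_one) auto
  with d have "dist (word_map \<alpha> v x) (word_map \<alpha> w y) < \<alpha> / 2" by simp
  then have ab: "a = b"
    using corner_separation[OF v(3) w(3) _ T] by (force simp: v(1) w(1) word_map_snoc)
  have "r * dist (word_map \<alpha> v' x) (word_map \<alpha> w' y) = dist (word_map \<alpha> v x) (word_map \<alpha> w y)"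
    using r_bounds v(3) unfolding v(1) w(1) word_map_snoc ab[symmetric]
    by (simp only: gasket_map_corner) (simp add: dist_norm flip: scaleR_diff_right)
  with d have "r * dist (word_map \<alpha> v' x) (word_map \<alpha> w' y) < r ^ k * (\<alpha> / 2)" by simp
  then have "k = 0 \<or> dist (word_map \<alpha> v' x) (word_map \<alpha> w' y) < r ^ (k - 1) * (\<alpha> / 2)"
    using r_bounds by (cases k) (simp_all only: power_Suc mult.assoc mult_less_cancel_left_pos diff_Suc_1, simp_all)
  then have "drop (m - k) v' = drop (m - k) w'"
    using Suc.prems n v w by (intro Suc.IH) auto
  moreover have "length v' = m" "length w' = m" using v w by (auto simp: words_def)
  ultimately show ?case using n Suc.prems(3) by (simp add: v(1) w(1) ab)
qed

text \<open>Distance 0 satisfies the closeness condition for k = n, and the suffix is then the whole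
  word.\<close>

lemma word_map_inj:
  assumes "v \<in> words n" "w \<in> words n" "x \<in> base_triangle" "y \<in> base_triangle"
    and "word_map \<alpha> v x = word_map \<alpha> w y"
  shows "v = w"
  using common_suffix[of v n w n x y] assms r_bounds \<alpha>_pos by simp

section \<open>Counting edges by level\<close>

lemma triangle_edgesE:
  assumes "e \<in> triangle_edges \<alpha> n"
  obtains w i j where "w \<in> words n" "i \<in> corners" "j \<in> corners" "i \<noteq> j"
    "e = closed_segment (word_map \<alpha> w (gasket_pt i)) (word_map \<alpha> w (gasket_pt j))"
proof -
  obtain x y w where xy: "e = closed_segment x y" "x \<noteq> y" and w: "w \<in> words n"
    "{x, y} \<subseteq> word_map \<alpha> w ` {gasket_pt 1, gasket_pt 2, gasket_pt 3}"
    using assms unfolding triangle_edges_def by blast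
  have *: "\<exists>i\<in>corners. z = word_map \<alpha> w (gasket_pt i)" if "z \<in> {x, y}" for z
    using w(2) that by auto
  obtain i where i: "i \<in> corners" "x = word_map \<alpha> w (gasket_pt i)" using *[of x] by auto
  obtain j where j: "j \<in> corners" "y = word_map \<alpha> w (gasket_pt j)" using *[of y] by auto
  have "i \<noteq> j" using xy(2) i(2) j(2) by metis
  then show ?thesis using that[OF w(1) i(1) j(1)] xy(1) i(2) j(2) by simp
qed

text \<open>Whereas \<open>joining_edges\<close> accumulates all words shorter than n, level n here
  takes words of length exactly n, so that all of its edges have length at most r^n.\<close>

definition level_edges :: "nat \<Rightarrow> (real^2) set set" where
  "level_edges n = triangle_edges \<alpha> n \<union>
     (\<lambda>(w, j). word_map \<alpha> w ` (gasket_map \<alpha> j ` base_triangle)) ` (words n \<times> {4, 5, 6})"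

lemma gasket_edges_subset: "gasket_edges \<alpha> \<subseteq> (\<Union>n. level_edges n)"
proof -
  have "joining_edges \<alpha> n \<subseteq> (\<Union>n. level_edges n)" for n
  proof
    fix e assume "e \<in> joining_edges \<alpha> n"
    then obtain m w i where w: "w \<in> words m" and i: "i \<in> {1, 2, 3 :: nat}"
      and e: "e = word_map \<alpha> w ` (gasket_map \<alpha> (i + 3) ` base_triangle)"
      unfolding joining_edges_def by blast
    have "i + 3 \<in> {4, 5, 6}" using i by auto
    then have "e \<in> level_edges m" unfolding level_edges_def e using w by force
    then show "e \<in> (\<Union>n. level_edges n)" by blast
  qed
  then show ?thesis unfolding gasket_edges_def level_edges_def by blast
qed

lemma level_edges_length:
  assumes e: "e \<in> level_edges n" shows "0 < segment_length e" "segment_length e \<le> r ^ n"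
proof -
  have "0 < segment_length e \<and> segment_length e \<le> r ^ n"
    using e unfolding level_edges_def
  proof
    assume "e \<in> triangle_edges \<alpha> n"
    then obtain w i j where "w \<in> words n" "i \<in> corners" "j \<in> corners" "i \<noteq> j"
      "e = closed_segment (word_map \<alpha> w (gasket_pt i)) (word_map \<alpha> w (gasket_pt j))"
      by (rule triangle_edgesE)
    then show ?thesis
      using dist_gasket_pt[of i j] dist_word_map[of w n] r_bounds
      by (simp add: segment_length_closed_segment)
  next
    assume "e \<in> (\<lambda>(w, j). word_map \<alpha> w ` (gasket_map \<alpha> j ` base_triangle)) ` (words n \<times> {4, 5, 6})"
    then obtain w j where w: "w \<in> words n" and j: "j \<in> {4, 5, 6}"
      and e: "e = word_map \<alpha> w ` (gasket_map \<alpha> j ` base_triangle)" by blast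
    obtain u v where uv: "gasket_map \<alpha> j ` base_triangle = closed_segment u v" "dist u v = \<alpha>"
      using j by (rule join_image)
    have "segment_length e = r ^ n * \<alpha>"
      unfolding e uv(1) word_map_segment[OF w] by (simp add: segment_length_closed_segment dist_word_map[OF w] uv(2))
    then show ?thesis
      using r_bounds \<alpha>_pos \<alpha>_less by (simp add: mult_left_le)
  qed
  then show "0 < segment_length e" "segment_length e \<le> r ^ n" by auto
qed

lemma finite_level_edges: "finite (level_edges n)"
  and card_level_edges: "card (level_edges n) \<le> 12 * 3 ^ n"
proof -
  let ?f = "\<lambda>(w, i, j). closed_segment (word_map \<alpha> w (gasket_pt i)) (word_map \<alpha> w (gasket_pt j))"
  let ?g = "\<lambda>(w, j). word_map \<alpha> w ` (gasket_map \<alpha> j ` base_triangle)"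
  \<comment> \<open>Per word, nine ordered pairs of corners (equal pairs included) and three joining
    edges: this gives the factor 12.\<close>
  let ?A = "words n \<times> corners \<times> corners" and ?B = "words n \<times> {4, 5, 6 :: nat}"
  have fin: "finite ?A" "finite ?B" using finite_words by auto
  have sub: "level_edges n \<subseteq> ?f ` ?A \<union> ?g ` ?B"
  proof -
    have "triangle_edges \<alpha> n \<subseteq> ?f ` ?A"
    proof
      fix e assume "e \<in> triangle_edges \<alpha> n"
      then obtain w i j where w: "w \<in> words n" "i \<in> corners" "j \<in> corners"
        "e = closed_segment (word_map \<alpha> w (gasket_pt i)) (word_map \<alpha> w (gasket_pt j))"
        by (rule triangle_edgesE)
      then have "(w, i, j) \<in> ?A" by blast
      then show "e \<in> ?f ` ?A" by (rule rev_image_eqI) (simp add: w(4))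
    qed
    then show ?thesis unfolding level_edges_def by blast
  qed
  then show "finite (level_edges n)" using fin by (meson finite_UnI finite_imageI finite_subset)
  have "card (level_edges n) \<le> card (?f ` ?A \<union> ?g ` ?B)"
    using fin by (intro card_mono[OF _ sub]) auto
  also have "\<dots> \<le> card (?f ` ?A) + card (?g ` ?B)" by (rule card_Un_le)
  also have "\<dots> \<le> card ?A + card ?B" using fin by (intro add_mono card_image_le)
  also have "\<dots> = 12 * 3 ^ n" by (simp add: card_cartesian_product card_words)
  finally show "card (level_edges n) \<le> 12 * 3 ^ n" .
qed

text \<open>One edge per word suffices for the lower bound on the trace and makes distinctness easy
  to check.\<close>

definition side :: "nat list \<Rightarrow> (real^2) set" where
  "side w = closed_segment (word_map \<alpha> w (gasket_pt 1)) (word_map \<alpha> w (gasket_pt 2))"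

lemma side_length: "w \<in> words n \<Longrightarrow> segment_length (side w) = r ^ n"
  using dist_gasket_pt[of 1 2] by (simp add: side_def segment_length_closed_segment dist_word_map)

lemma side_in_edges: "w \<in> words n \<Longrightarrow> side w \<in> gasket_edges \<alpha>"
proof -
  assume w: "w \<in> words n"
  have "dist (word_map \<alpha> w (gasket_pt 1)) (word_map \<alpha> w (gasket_pt 2)) = r ^ n"
    using dist_gasket_pt[of 1 2] by (simp add: dist_word_map[OF w])
  then have "word_map \<alpha> w (gasket_pt 1) \<noteq> word_map \<alpha> w (gasket_pt 2)" using r_bounds by auto
  then have "side w \<in> triangle_edges \<alpha> n" unfolding side_def triangle_edges_def using w by blast
  then show ?thesis by (auto simp: gasket_edges_def)
qed

text \<open>Equal segments have equal endpoint sets, so a corner image under v is a corner image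
  under w, and \<open>word_map_inj\<close> applies.\<close>

lemma side_inj: "inj_on side (words n)"
proof (rule inj_onI)
  fix v w assume vw: "v \<in> words n" "w \<in> words n" "side v = side w"
  then have "word_map \<alpha> v (gasket_pt 1) \<in> {word_map \<alpha> w (gasket_pt 1), word_map \<alpha> w (gasket_pt 2)}"
    unfolding side_def closed_segment_eq by blast
  then show "v = w"
    using vw gasket_pt_in_base_triangle[of 1] gasket_pt_in_base_triangle[of 2]
    by (auto dest!: word_map_inj[rotated -1])
qed

end


subsection \<open>The spectral dimension\<close>

text \<open>Both dimensions are infima of an open ray: at the critical exponent itself the trace is
  infinite and the Hausdorff measure is nonzero.\<close>

lemma Inf_ereal_greater: "Inf {ereal p | p. d < p} = ereal d"
proof (rule Inf_eqI)
  fix y assume y: "\<And>i. i \<in> {ereal p | p. d < p} \<Longrightarrow> y \<le> i"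
  show "y \<le> ereal d"
  proof (rule ccontr)
    assume "\<not> y \<le> ereal d"
    then have "ereal d < y" by simp
    then obtain z where z: "ereal d < ereal z" "ereal z < y"
      using ereal_dense2 by blast
    then have "y \<le> ereal z" by (intro y) auto
    then show False using z(2) by simp
  qed
qed auto

context gasket_parameter begin

text \<open>The solution d of 3 r^d = 1, the similarity dimension of the three corner maps
  alone.\<close>

definition similarity_dim :: real where "similarity_dim = ln 3 / (ln 2 - ln (1 - \<alpha>))"

lemma ln_r: "ln 2 - ln (1 - \<alpha>) = - ln r" "ln r < 0"
  using \<alpha>_less r_bounds by (auto simp: r_def ln_div)

lemma similarity_dim_gt_1: "1 < similarity_dim"
proof -
  have "ln (1 / 3) < ln r" using r_bounds by (subst ln_less_cancel_iff) auto
  then have "- ln r < ln 3" by (simp add: ln_div)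
  then show ?thesis using ln_r by (simp add: similarity_dim_def field_simps)
qed

lemma three_r_powr_less: "similarity_dim < p \<Longrightarrow> 3 * r powr p < 1"
proof -
  assume "similarity_dim < p"
  then have "ln 3 + p * ln r < 0" using ln_r by (simp add: similarity_dim_def field_simps)
  then have "exp (ln 3 + p * ln r) < exp 0" by (simp only: exp_less_cancel_iff)
  then show ?thesis using r_bounds by (simp add: exp_add powr_def)
qed

lemma three_r_powr_ge: "p \<le> similarity_dim \<Longrightarrow> 1 \<le> 3 * r powr p"
proof -
  assume "p \<le> similarity_dim"
  then have "0 \<le> ln 3 + p * ln r" using ln_r by (simp add: similarity_dim_def field_simps)
  then have "exp 0 \<le> exp (ln 3 + p * ln r)" by (simp only: exp_le_cancel_iff)
  then show ?thesis using r_bounds by (simp add: exp_add powr_def)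
qed

lemma powr_r_power: "(r ^ n) powr p = (r powr p) ^ n"
  using r_bounds by (simp add: powr_power powr_powr mult.commute flip: powr_realpow)

lemma edge_length:
  assumes "e \<in> gasket_edges \<alpha>" shows "0 < segment_length e" "segment_length e \<le> 1"
proof -
  obtain n where n: "e \<in> level_edges n" using assms gasket_edges_subset by blast
  show "0 < segment_length e" using level_edges_length[OF n] by simp
  have "r ^ n \<le> 1" using r_bounds by (intro power_le_one) auto
  then show "segment_length e \<le> 1" using level_edges_length[OF n] by linarith
qed

lemma edge_trace_finite:
  assumes p: "similarity_dim < p"
  shows "(\<integral>\<^sup>+ e. curve_trace p (segment_length e) \<partial>count_space (gasket_edges \<alpha>)) < \<infinity>"
proof -
  obtain C where C: "0 \<le> C" "\<And>l. 0 < l \<Longrightarrow> curve_trace p l \<le> ennreal (C * l powr p)"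
    using curve_trace_le[of p] p similarity_dim_gt_1 by auto
  have level: "(\<integral>\<^sup>+ e. curve_trace p (segment_length e) \<partial>count_space (level_edges n)) \<le>
      ennreal (12 * C * (3 * r powr p) ^ n)" for n
  proof -
    have "(\<integral>\<^sup>+ e. curve_trace p (segment_length e) \<partial>count_space (level_edges n)) =
        (\<Sum>e\<in>level_edges n. curve_trace p (segment_length e))"
      by (rule nn_integral_count_space_finite[OF finite_level_edges])
    also have "\<dots> \<le> (\<Sum>e\<in>level_edges n. ennreal (C * (r powr p) ^ n))"
    proof (rule sum_mono)
      fix e assume e: "e \<in> level_edges n"
      have "segment_length e powr p \<le> (r ^ n) powr p"
        using level_edges_length[OF e] p similarity_dim_gt_1 by (intro powr_mono2) auto
      then have "C * segment_length e powr p \<le> C * (r powr p) ^ n"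
        using C(1) unfolding powr_r_power by (rule mult_left_mono)
      then show "curve_trace p (segment_length e) \<le> ennreal (C * (r powr p) ^ n)"
        using C(2)[OF level_edges_length(1)[OF e]] by (meson ennreal_leI order_trans)
    qed
    also have "\<dots> = of_nat (card (level_edges n)) * ennreal (C * (r powr p) ^ n)" by simp
    also have "\<dots> = ennreal (real (card (level_edges n)) * (C * (r powr p) ^ n))"
      using C(1) by (simp add: ennreal_mult ennreal_of_nat_eq_real_of_nat)
    also have "\<dots> \<le> ennreal ((12 * 3 ^ n) * (C * (r powr p) ^ n))"
    proof (intro ennreal_leI mult_right_mono)
      have "real (card (level_edges n)) \<le> real (12 * 3 ^ n)"
        using card_level_edges[of n] by (simp only: of_nat_le_iff)
      then show "real (card (level_edges n)) \<le> 12 * 3 ^ n" by simp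
    qed (use C(1) in simp)
    finally show ?thesis by (simp add: power_mult_distrib mult_ac)
  qed
  have q: "0 \<le> 3 * r powr p" "3 * r powr p < 1" using three_r_powr_less[OF p] by auto
  have "(\<integral>\<^sup>+ e. curve_trace p (segment_length e) \<partial>count_space (gasket_edges \<alpha>)) \<le>
      (\<integral>\<^sup>+ e. curve_trace p (segment_length e) \<partial>count_space (\<Union>n. level_edges n))"
    by (rule nn_integral_count_space_mono_set[OF gasket_edges_subset])
  also have "\<dots> \<le> (\<Sum>n. \<integral>\<^sup>+ e. curve_trace p (segment_length e) \<partial>count_space (level_edges n))"
    by (rule nn_integral_count_space_UNION_le)
  also have "\<dots> \<le> (\<Sum>n. ennreal (12 * C * (3 * r powr p) ^ n))"
    by (rule suminf_le[OF level]) auto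
  also have "\<dots> = ennreal (\<Sum>n. 12 * C * (3 * r powr p) ^ n)"
    using q C(1) by (intro suminf_ennreal2 summable_mult summable_geometric) auto
  also have "\<dots> < \<infinity>" by simp
  finally show ?thesis .
qed

text \<open>For p up to the critical exponent, 3^n r^(n p) \<ge> 1, so the sides of every level
  contribute at least the fixed amount c. Sides of different levels are distinct because their
  lengths differ, and the contributions of N levels add up to N c.\<close>

lemma edge_trace_infinite:
  assumes p: "0 < p" "p \<le> similarity_dim"
  shows "(\<integral>\<^sup>+ e. curve_trace p (segment_length e) \<partial>count_space (gasket_edges \<alpha>)) = \<infinity>"
proof -
  let ?T = "\<integral>\<^sup>+ e. curve_trace p (segment_length e) \<partial>count_space (gasket_edges \<alpha>)"
  define c where "c = (1 + (pi / 2)\<^sup>2) powr (- p / 2)"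
  have c: "0 < c" by (simp add: c_def add_pos_nonneg less_imp_neq[symmetric])
  have big: "ennreal (real N * c) \<le> ?T" for N
  proof -
    let ?B = "\<lambda>n. side ` words n"
    have fin: "finite (?B n)" for n using finite_words by simp
    have len: "segment_length e = r ^ n" if "e \<in> ?B n" for e n using that side_length by auto
    have disj: "?B m \<inter> ?B n = {}" if "m \<noteq> n" for m n
    proof (rule ccontr)
      assume "?B m \<inter> ?B n \<noteq> {}"
      then obtain e where "e \<in> ?B m" "e \<in> ?B n" by blast
      then have "r ^ m = r ^ n" using len by metis
      moreover have "r ^ m \<noteq> r ^ n"
        using that r_bounds power_inject_exp'[of r m n] by (simp)
      ultimately show False by simp
    qed
    have "ennreal (real N * c) = (\<Sum>n<N. ennreal c)" using c by (simp add: ennreal_mult ennreal_of_nat_eq_real_of_nat)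
    also have "\<dots> \<le> (\<Sum>n<N. \<Sum>e\<in>?B n. curve_trace p (segment_length e))"
    proof (rule sum_mono)
      fix n
      have "c * 1 \<le> c * (3 * r powr p) ^ n"
        using three_r_powr_ge[OF p(2)] c by (intro mult_left_mono one_le_power) auto
      then have "ennreal c \<le> ennreal (3 ^ n * (c * (r ^ n) powr p))"
        unfolding powr_r_power by (intro ennreal_leI) (simp add: power_mult_distrib mult_ac)
      also have "\<dots> = (\<Sum>e\<in>?B n. ennreal (c * (r ^ n) powr p))"
        using c by (simp add: card_image[OF side_inj] card_words ennreal_mult flip: ennreal_power)
      also have "\<dots> \<le> (\<Sum>e\<in>?B n. curve_trace p (segment_length e))"
      proof (rule sum_mono)
        fix e assume e: "e \<in> ?B n"
        have "0 < r ^ n" "r ^ n \<le> 1" using r_bounds by (auto intro: power_le_one)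
        from curve_trace_ge[OF this p(1)]
        show "ennreal (c * (r ^ n) powr p) \<le> curve_trace p (segment_length e)"
          by (simp add: len[OF e] c_def)
      qed
      finally show "ennreal c \<le> (\<Sum>e\<in>?B n. curve_trace p (segment_length e))" .
    qed
    also have "\<dots> = (\<Sum>e\<in>(\<Union>n<N. ?B n). curve_trace p (segment_length e))"
      using fin disj by (intro sum.UNION_disjoint[symmetric]) auto
    also have "\<dots> = (\<integral>\<^sup>+ e. curve_trace p (segment_length e) \<partial>count_space (\<Union>n<N. ?B n))"
      using fin by (intro nn_integral_count_space_finite[symmetric]) auto
    also have "\<dots> \<le> ?T"
      by (rule nn_integral_count_space_mono_set) (auto intro: side_in_edges)
    finally show ?thesis .
  qed
  show ?thesis
  proof (rule ccontr)
    assume "?T \<noteq> \<infinity>"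
    then obtain t where t: "0 \<le> t" "?T = ennreal t" by (cases ?T) auto
    obtain N where "t < real N * c" using reals_Archimedean3[OF c] by blast
    then show False using big[of N] t by (simp add: ennreal_le_iff)
  qed
qed

text \<open>The trace depends on the enumerated edges only through their lengths, so the bijection
  turns the sum over j into a sum over the set of edges.\<close>

theorem spectral_dimension_gasket:
  assumes \<epsilon>: "bij_betw \<epsilon> UNIV (gasket_edges \<alpha>)"
  shows "spectral_dimension (gasket_triple \<alpha> \<epsilon> R) = ereal similarity_dim"
proof -
  have l: "0 < segment_length (\<epsilon> j)" for j
    using edge_length(1)[of "\<epsilon> j"] bij_betw_apply[OF \<epsilon>] by simp
  have trace: "positive_trace (st_space (gasket_triple \<alpha> \<epsilon> R))
      (functional_calculus (st_space (gasket_triple \<alpha> \<epsilon> R)) (st_dirac (gasket_triple \<alpha> \<epsilon> R))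
        (\<lambda>t. (1 + t\<^sup>2) powr (- p / 2))) =
      (\<integral>\<^sup>+ e. curve_trace p (segment_length e) \<partial>count_space (gasket_edges \<alpha>))" if "0 < p" for p
    using trace_curve_sum[of "\<lambda>j. segment_length (\<epsilon> j)" p] l that
      nn_integral_bij_count_space[OF \<epsilon>, of "\<lambda>e. curve_trace p (segment_length e)"]
    by (simp add: gasket_triple_def triple_sum_def curve_triple_def)
  have "0 < p \<and> (\<integral>\<^sup>+ e. curve_trace p (segment_length e) \<partial>count_space (gasket_edges \<alpha>)) < \<infinity>
      \<longleftrightarrow> similarity_dim < p" for p
    using edge_trace_finite[of p] edge_trace_infinite[of p] similarity_dim_gt_1 by (cases "similarity_dim < p") auto
  then have "{ereal p | p. 0 < p \<and>
       positive_trace (st_space (gasket_triple \<alpha> \<epsilon> R))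
         (functional_calculus (st_space (gasket_triple \<alpha> \<epsilon> R)) (st_dirac (gasket_triple \<alpha> \<epsilon> R))
            (\<lambda>t. (1 + t\<^sup>2) powr (- p / 2))) < \<infinity>} = {ereal p | p. similarity_dim < p}"
    using trace by (simp cong: conj_cong)
  then show ?thesis unfolding spectral_dimension_def by (simp only: Inf_ereal_greater)
qed

end


subsection \<open>The gasket as a self-similar set\<close>

context gasket_parameter begin

abbreviation gasket_image :: "(real^2) set \<Rightarrow> (real^2) set" where
  "gasket_image K \<equiv> \<Union>j\<in>{1..6}. gasket_map \<alpha> j ` K"

lemma continuous_gasket_map: "j \<in> {1..6} \<Longrightarrow> continuous_on S (gasket_map \<alpha> j)"
  using gasket_map_Lipschitz[of j]
  by (intro lipschitz_on_continuous_on[of "2 / 3"] lipschitz_onI) auto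

text \<open>Take a point of K farthest from L. It is the image of some y in K, and applying the same
  map to the nearest point of L shrinks the distance by 2 / 3, so the maximal distance is 0.\<close>

lemma gasket_unique_aux:
  assumes K: "compact K" "K \<noteq> {}" "K = gasket_image K" and L: "compact L" "L \<noteq> {}" "L = gasket_image L"
  shows "K \<subseteq> L"
proof -
  have "continuous_on K (\<lambda>x. infdist x L)" by (intro continuous_intros)
  then obtain x where x: "x \<in> K" "\<And>y. y \<in> K \<Longrightarrow> infdist y L \<le> infdist x L"
    using continuous_attains_sup[OF K(1,2)] by blast
  have "x \<in> gasket_image K" using x(1) K(3) by blast
  then obtain j y where j: "j \<in> {1..6}" and y: "y \<in> K" "x = gasket_map \<alpha> j y" by blast
  obtain z where z: "z \<in> L" "infdist y L = dist y z"
    using infdist_attains_inf[OF compact_imp_closed[OF L(1)] L(2)] by blast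
  have "gasket_map \<alpha> j z \<in> L" using L(3) j z(1) by blast
  then have "infdist x L \<le> dist x (gasket_map \<alpha> j z)" by (rule infdist_le)
  also have "\<dots> \<le> 2 / 3 * dist y z" unfolding y(2) by (rule gasket_map_Lipschitz[OF j])
  also have "\<dots> \<le> 2 / 3 * infdist x L" using x(2)[OF y(1)] z(2) by simp
  finally have "infdist x L \<le> 0" by simp
  then have "infdist y L = 0" if "y \<in> K" for y
    using x(2)[OF that] infdist_nonneg[of y L] by linarith
  then show ?thesis
    using in_closed_iff_infdist_zero[OF compact_imp_closed[OF L(1)] L(2)] by blast
qed

text \<open>The triangle is mapped into itself, so its iterated images decrease; their intersection
  is the invariant set, and its location inside the triangle comes for free.\<close>

lemma gasket_exists: "\<exists>K. compact K \<and> K \<noteq> {} \<and> K = gasket_image K \<and> K \<subseteq> base_triangle"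
proof -
  define K where "K n = (gasket_image ^^ n) base_triangle" for n
  have K0: "K 0 = base_triangle" and KS: "K (Suc n) = gasket_image (K n)" for n
    by (simp_all add: K_def)
  have T: "gasket_image base_triangle \<subseteq> base_triangle"
    using gasket_map_triangle by blast
  have comp: "compact (K n)" for n
  proof (induction n)
    case 0 show ?case unfolding K0 by (rule compact_base_triangle)
  next
    case (Suc n)
    then show ?case unfolding KS
      by (intro compact_UN compact_continuous_image continuous_gasket_map) auto
  qed
  have ne: "K n \<noteq> {}" for n
  proof (induction n)
    case 0 show ?case unfolding K0 using gasket_pt_in_base_triangle[of 1] by auto
  next
    case (Suc n)
    have "(1::nat) \<in> {1..6}" by simp
    then show ?case using Suc unfolding KS by blast
  qed
  have step: "K (Suc n) \<subseteq> K n" for n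
  proof (induction n)
    case 0 show ?case unfolding KS K0 by (rule T)
  next
    case (Suc n)
    then show ?case unfolding KS[of "Suc n"] KS[of n] by (rule UN_mono[OF order_refl image_mono])
  qed
  have dec: "K n \<subseteq> K m" if "m \<le> n" for m n
    using that step by (rule lift_Suc_antimono_le[rotated])
  define L where "L = (\<Inter>n. K n)"
  have "L \<noteq> {}" unfolding L_def by (rule compact_nest[OF comp ne dec])
  moreover have "compact L" unfolding L_def
    by (rule compact_Inter) (use comp in auto)
  moreover have "L = gasket_image L"
  proof (intro equalityI subsetI)
    fix x assume x: "x \<in> L"
    \<comment> \<open>The preimages of x in K n could come from different maps for different n.
      Nested compactness yields one point that lies in all K n and is mapped to x by one of the six
      maps.\<close>
    define C where "C n = K n \<inter> (\<Union>j\<in>{1..6}. {y. gasket_map \<alpha> j y = x})" for n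
    have closed: "closed (\<Union>j\<in>{1..6}. {y. gasket_map \<alpha> j y = x})"
      by (intro closed_UN ballI closed_Collect_eq continuous_gasket_map continuous_intros) auto
    have "\<Inter>(range C) \<noteq> {}"
    proof (rule compact_nest)
      show "compact (C n)" for n unfolding C_def using comp closed by (rule compact_Int_closed)
      show "C n \<noteq> {}" for n
      proof -
        have "x \<in> K (Suc n)" using x unfolding L_def by blast
        then show ?thesis unfolding KS C_def by blast
      qed
      show "C n \<subseteq> C m" if "m \<le> n" for m n unfolding C_def using dec[OF that] by blast
    qed
    then obtain y where y: "\<And>n. y \<in> C n" by blast
    then have "y \<in> L" unfolding L_def C_def by blast
    moreover obtain j where "j \<in> {1..6}" "gasket_map \<alpha> j y = x" using y[of 0] unfolding C_def by blast
    ultimately show "x \<in> gasket_image L" by blast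
  next
    fix x assume "x \<in> gasket_image L"
    then have "x \<in> K (Suc n)" for n unfolding KS L_def by blast
    then have "x \<in> K n" for n using step by blast
    then show "x \<in> L" unfolding L_def by blast
  qed
  moreover have "L \<subseteq> base_triangle" using K0 unfolding L_def by blast
  ultimately show ?thesis by blast
qed

lemma stretched_gasket:
  "compact (stretched_gasket \<alpha>)" "stretched_gasket \<alpha> \<noteq> {}"
  "stretched_gasket \<alpha> = gasket_image (stretched_gasket \<alpha>)" "stretched_gasket \<alpha> \<subseteq> base_triangle"
proof -
  obtain K where K: "compact K" "K \<noteq> {}" "K = gasket_image K" "K \<subseteq> base_triangle"
    using gasket_exists by blast
  have "stretched_gasket \<alpha> = K"
    unfolding stretched_gasket_def
  proof (rule the_equality)
    show "compact K \<and> K \<noteq> {} \<and> K = gasket_image K" using K by blast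
    fix L assume L: "compact L \<and> L \<noteq> {} \<and> L = gasket_image L"
    show "L = K"
      using gasket_unique_aux[of L K] gasket_unique_aux[of K L] K L by blast
  qed
  with K show "compact (stretched_gasket \<alpha>)" "stretched_gasket \<alpha> \<noteq> {}"
    "stretched_gasket \<alpha> = gasket_image (stretched_gasket \<alpha>)" "stretched_gasket \<alpha> \<subseteq> base_triangle"
    by auto
qed

lemma gasket_map_in_gasket: "j \<in> {1..6} \<Longrightarrow> x \<in> stretched_gasket \<alpha> \<Longrightarrow> gasket_map \<alpha> j x \<in> stretched_gasket \<alpha>"
  using stretched_gasket(3) by blast

lemma word_map_in_gasket:
  "w \<in> words n \<Longrightarrow> x \<in> stretched_gasket \<alpha> \<Longrightarrow> word_map \<alpha> w x \<in> stretched_gasket \<alpha>"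
proof (induction n arbitrary: w)
  case 0
  then show ?case by (auto simp: words_0 word_map_def)
next
  case (Suc n)
  obtain u a where w: "w = u @ [a]" "u \<in> words n" "a \<in> corners"
    using Suc.prems(1) by (rule words_SucE)
  have "a \<in> {1..6}" using w(3) by auto
  then show ?case
    unfolding w(1) word_map_snoc using Suc.IH[OF w(2) Suc.prems(2)] by (rule gasket_map_in_gasket)
qed

lemma word_map_Cons: "word_map \<alpha> (a # w) x = word_map \<alpha> w (gasket_map \<alpha> a x)"
  by (simp add: word_map_def)

lemma words_Cons: "a # w \<in> words (Suc n) \<longleftrightarrow> w \<in> words n \<and> a \<in> corners"
  by (auto simp: words_def)

text \<open>Self-similarity is applied to the innermost copy: a corner map prolongs the word at its
  front, a joining map puts the point on a segment of the current level. Only at the end are the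
  copies of the gasket enlarged to triangles.\<close>

lemma gasket_cover:
  "stretched_gasket \<alpha> \<subseteq> (\<Union>w\<in>words n. word_map \<alpha> w ` base_triangle) \<union>
     (\<Union>m<n. \<Union>w\<in>words m. \<Union>j\<in>{4, 5, 6}. word_map \<alpha> w ` (gasket_map \<alpha> j ` base_triangle))"
    (is "_ \<subseteq> _ \<union> ?J n")
proof -
  let ?K = "stretched_gasket \<alpha>"
  define J where "J n = (\<Union>m<n. \<Union>w\<in>words m. \<Union>j\<in>{4, 5, 6}. word_map \<alpha> w ` (gasket_map \<alpha> j ` base_triangle))" for n
  have J_mono: "J n \<subseteq> J (Suc n)" for n
    unfolding J_def by (intro UN_mono) auto
  have "?K \<subseteq> (\<Union>w\<in>words n. word_map \<alpha> w ` ?K) \<union> J n"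
  proof (induction n)
    case 0 show ?case by (simp add: words_0 word_map_def)
  next
    case (Suc n)
    show ?case
    proof
      fix x assume "x \<in> ?K"
      then have "x \<in> (\<Union>w\<in>words n. word_map \<alpha> w ` ?K) \<union> J n" by (rule subsetD[OF Suc.IH])
      then show "x \<in> (\<Union>w\<in>words (Suc n). word_map \<alpha> w ` ?K) \<union> J (Suc n)"
      proof
        assume "x \<in> (\<Union>w\<in>words n. word_map \<alpha> w ` ?K)"
        then obtain w y where w: "w \<in> words n" "y \<in> ?K" "x = word_map \<alpha> w y"
          by (elim UN_E imageE)
        have "y \<in> gasket_image ?K" using w(2) stretched_gasket(3) by (rule back_subst)
        then obtain j z where j: "j \<in> {1..6}" and z: "z \<in> ?K" "y = gasket_map \<alpha> j z"
          by (elim UN_E imageE)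
        show ?thesis
        proof (cases "j \<in> corners")
          case True
          then have "j # w \<in> words (Suc n)" using w(1) by (simp only: words_Cons simp_thms)
          moreover have "x = word_map \<alpha> (j # w) z" using w z by (simp add: word_map_Cons)
          ultimately show ?thesis using z(1) by (intro UnI1 UN_I[of "j # w"] rev_image_eqI[of z])
        next
          case False
          have "{1..6} = corners \<union> {4, 5, 6}" by auto
          with False j have j: "j \<in> {4, 5, 6}" by blast
          have "z \<in> base_triangle" using z(1) stretched_gasket(4) by (rule rev_subsetD)
          then have "x \<in> word_map \<alpha> w ` (gasket_map \<alpha> j ` base_triangle)"
            unfolding w(3) z(2) by (intro imageI)
          then have "x \<in> J (Suc n)"
            unfolding J_def using w(1) j by (intro UN_I[of n] UN_I[of w] UN_I[of j] lessThan_iff[THEN iffD2] lessI)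
          then show ?thesis by (rule UnI2)
        qed
      next
        assume "x \<in> J n"
        then show ?thesis by (intro UnI2 subsetD[OF J_mono])
      qed
    qed
  qed
  also have "\<dots> \<subseteq> (\<Union>w\<in>words n. word_map \<alpha> w ` base_triangle) \<union> J n"
    by (intro Un_mono UN_mono image_mono stretched_gasket(4) order_refl)
  finally show ?thesis unfolding J_def .
qed

end


subsection \<open>The Hausdorff dimension\<close>

text \<open>Lists count repeated sets with multiplicity, so costs add exactly under concatenation.
  The number b is only an upper bound for the cost, which allows null families to be stated as
  coverable for every b > 0.\<close>

definition finite_cover :: "real \<Rightarrow> real \<Rightarrow> 'a::metric_space set \<Rightarrow> real \<Rightarrow> bool" where
  "finite_cover s \<delta> A b \<longleftrightarrow> (\<exists>Us. A \<subseteq> \<Union>(set Us) \<and> (\<forall>U\<in>set Us. bounded U \<and> diameter U \<le> \<delta>) \<and>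
     sum_list (map (\<lambda>U. diameter U powr s) Us) \<le> b)"

lemma finite_cover_empty: "0 \<le> b \<Longrightarrow> finite_cover s \<delta> {} b"
  unfolding finite_cover_def by (intro exI[of _ "[]"]) simp

lemma finite_cover_Un:
  assumes "finite_cover s \<delta> A a" "finite_cover s \<delta> B b"
  shows "finite_cover s \<delta> (A \<union> B) (a + b)"
proof -
  obtain Us where Us: "A \<subseteq> \<Union>(set Us)" "\<forall>U\<in>set Us. bounded U \<and> diameter U \<le> \<delta>"
    "sum_list (map (\<lambda>U. diameter U powr s) Us) \<le> a"
    using assms(1) unfolding finite_cover_def by blast
  obtain Vs where Vs: "B \<subseteq> \<Union>(set Vs)" "\<forall>U\<in>set Vs. bounded U \<and> diameter U \<le> \<delta>"
    "sum_list (map (\<lambda>U. diameter U powr s) Vs) \<le> b"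
    using assms(2) unfolding finite_cover_def by blast
  have "A \<union> B \<subseteq> \<Union>(set (Us @ Vs))" using Us(1) Vs(1) by auto
  moreover have "\<forall>U\<in>set (Us @ Vs). bounded U \<and> diameter U \<le> \<delta>" using Us(2) Vs(2) by auto
  moreover have "sum_list (map (\<lambda>U. diameter U powr s) (Us @ Vs)) \<le> a + b"
    using Us(3) Vs(3) by simp
  ultimately show ?thesis unfolding finite_cover_def by blast
qed

lemma finite_cover_UN_null:
  assumes "finite I" "\<And>i b. i \<in> I \<Longrightarrow> 0 < b \<Longrightarrow> finite_cover s \<delta> (A i) b"
  shows "0 < b \<Longrightarrow> finite_cover s \<delta> (\<Union>i\<in>I. A i) b"
  using assms
proof (induction I arbitrary: b rule: finite_induct)
  case empty
  then show ?case by (simp add: finite_cover_empty)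
next
  case (insert i I)
  have "finite_cover s \<delta> (A i) (b / 2)" "finite_cover s \<delta> (\<Union>i\<in>I. A i) (b / 2)"
    using insert by auto
  from finite_cover_Un[OF this] show ?case by simp
qed

lemma finite_cover_family:
  assumes "finite I" "A \<subseteq> (\<Union>i\<in>I. U i)" "\<And>i. i \<in> I \<Longrightarrow> bounded (U i) \<and> diameter (U i) \<le> \<delta>"
    and "(\<Sum>i\<in>I. diameter (U i) powr s) \<le> b"
  shows "finite_cover s \<delta> A b"
proof -
  obtain xs where xs: "set xs = I" "distinct xs" using finite_distinct_list[OF assms(1)] by blast
  have "sum_list (map (\<lambda>U. diameter U powr s) (map U xs)) = (\<Sum>i\<in>I. diameter (U i) powr s)"
    using xs by (simp add: o_def sum_list_distinct_conv_sum_set)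
  then show ?thesis
    unfolding finite_cover_def using assms xs by (intro exI[of _ "map U xs"]) auto
qed

lemma finite_cover_subset: "finite_cover s \<delta> B b \<Longrightarrow> A \<subseteq> B \<Longrightarrow> finite_cover s \<delta> A b"
  unfolding finite_cover_def by blast

lemma hausdorff_premeasure_le_finite_cover:
  assumes "finite_cover s \<delta> A b" "0 \<le> \<delta>"
  shows "hausdorff_premeasure s \<delta> A \<le> ennreal b"
proof -
  obtain Us where Us: "A \<subseteq> \<Union>(set Us)" "\<forall>U\<in>set Us. bounded U \<and> diameter U \<le> \<delta>"
    "sum_list (map (\<lambda>U. diameter U powr s) Us) \<le> b"
    using assms(1) unfolding finite_cover_def by blast
  \<comment> \<open>Padding with empty sets is free: their diameter is 0, and
    \<open>0 powr s = 0\<close>.\<close>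
  define V where "V i = (if i < length Us then Us ! i else {})" for i
  have "A \<subseteq> (\<Union>i. V i)"
  proof
    fix x assume "x \<in> A"
    then obtain U where "U \<in> set Us" "x \<in> U" using Us(1) by blast
    then obtain i where "i < length Us" "x \<in> Us ! i" by (auto simp: in_set_conv_nth)
    then show "x \<in> (\<Union>i. V i)" by (auto simp: V_def intro!: exI[of _ i])
  qed
  moreover have "\<forall>i. bounded (V i) \<and> diameter (V i) \<le> \<delta>"
    using Us(2) assms(2) by (auto simp: V_def)
  ultimately have "hausdorff_premeasure s \<delta> A \<le> (\<Sum>i. ennreal (diameter (V i) powr s))"
    unfolding hausdorff_premeasure_def by (intro Inf_lower) blast
  also have "\<dots> = (\<Sum>i<length Us. ennreal (diameter (V i) powr s))"
    by (rule suminf_finite) (auto simp: V_def)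
  also have "\<dots> = ennreal (\<Sum>i<length Us. diameter (Us ! i) powr s)"
    by (subst sum_ennreal[symmetric]) (auto simp: V_def)
  also have "(\<Sum>i<length Us. diameter (Us ! i) powr s) = sum_list (map (\<lambda>U. diameter U powr s) Us)"
    by (simp add: sum_list_sum_nth atLeast0LessThan)
  also have "ennreal \<dots> \<le> ennreal b" using Us(3) by (rule ennreal_leI)
  finally show ?thesis .
qed

text \<open>Cutting a segment of length L into n equal pieces costs n (L / n)^s = L^s n^(1 - s),
  which tends to 0 for s > 1.\<close>

lemma finite_cover_segment:
  fixes x y :: "'a::real_normed_vector"
  assumes s: "1 < s" and \<delta>: "0 < \<delta>" and b: "0 < b"
  shows "finite_cover s \<delta> (closed_segment x y) b"
proof -
  define L where "L = dist x y"
  have "(\<lambda>n. L powr s * real (Suc n) powr (1 - s)) \<longlonglongrightarrow> L powr s * 0"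
  proof (intro tendsto_mult tendsto_const)
    have "((\<lambda>x::real. x powr (1 - s)) \<longlongrightarrow> 0) at_top"
      using s by (intro tendsto_neg_powr) (auto intro: filterlim_ident)
    then show "(\<lambda>n. real (Suc n) powr (1 - s)) \<longlonglongrightarrow> 0"
      by (rule filterlim_compose) (rule filterlim_compose[OF filterlim_real_sequentially filterlim_Suc])
  qed
  then have "\<forall>\<^sub>F n in sequentially. L powr s * real (Suc n) powr (1 - s) < b"
    using b by (intro order_tendstoD(2)[where y = 0]) simp_all
  moreover have "\<forall>\<^sub>F n in sequentially. L / \<delta> < real (Suc n)"
    by (rule eventually_sequentiallyI[of "nat \<lceil>L / \<delta>\<rceil>"]) linarith
  ultimately have "\<forall>\<^sub>F n in sequentially. L powr s * real (Suc n) powr (1 - s) < b \<and> L / \<delta> < real (Suc n)"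
    by (rule eventually_conj)
  from eventually_happens'[OF sequentially_bot this] obtain m where
    "L powr s * real (Suc m) powr (1 - s) < b \<and> L / \<delta> < real (Suc m)" ..
  moreover define n where "n = Suc m"
  ultimately have n: "0 < n" "L powr s * real n powr (1 - s) < b" "L / \<delta> < real n" by auto
  let ?p = "\<lambda>t. (1 - t) *\<^sub>R x + t *\<^sub>R y"
  let ?U = "\<lambda>k::nat. ?p ` {real k / real n..(real k + 1) / real n}"
  have bd: "dist a c \<le> L / real n" if ac: "a \<in> ?U k" "c \<in> ?U k" for a c k
  proof -
    obtain t u where tu: "a = ?p t" "c = ?p u" "t \<in> {real k / real n..(real k + 1) / real n}"
      "u \<in> {real k / real n..(real k + 1) / real n}" using ac by (elim imageE)
    have "?p t - ?p u = (u - t) *\<^sub>R (x - y)" by (simp add: algebra_simps)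
    then have "dist a c = \<bar>u - t\<bar> * L" by (simp add: tu(1,2) dist_norm L_def)
    moreover have "\<bar>u - t\<bar> \<le> 1 / real n"
      using tu(3,4) by (auto simp: add_divide_distrib abs_le_iff)
    ultimately show ?thesis using mult_right_mono[of "\<bar>u - t\<bar>" "1 / real n" L] by (simp add: L_def)
  qed
  have L0: "0 \<le> L" by (simp add: L_def)
  have diam: "bounded (?U k) \<and> diameter (?U k) \<le> L / real n" for k
  proof
    have "compact (?U k)" by (intro compact_continuous_image continuous_intros compact_Icc)
    then show "bounded (?U k)" by (rule compact_imp_bounded)
    show "diameter (?U k) \<le> L / real n"
      using L0 bd by (intro diameter_le) (auto simp: dist_norm)
  qed
  have "closed_segment x y \<subseteq> (\<Union>k\<in>{..<n}. ?U k)"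
  proof
    fix z assume "z \<in> closed_segment x y"
    then obtain t where t: "0 \<le> t" "t \<le> 1" "z = ?p t" unfolding closed_segment_def by blast
    show "z \<in> (\<Union>k\<in>{..<n}. ?U k)"
    proof (cases "t = 1")
      \<comment> \<open>At t = 1 the rounding used below would give k = n, one past the last
        piece.\<close>
      case True
      have "1 \<in> {real (n - 1) / real n..(real (n - 1) + 1) / real n}" using n(1) by (simp add: of_nat_diff)
      then show ?thesis
        by (intro UN_I[of "n - 1"] rev_image_eqI[of 1]) (use n(1) t(3) True in auto)
    next
      case False
      define k where "k = nat \<lfloor>t * real n\<rfloor>"
      have tn: "0 \<le> t * real n" using t by simp
      then have k: "real k \<le> t * real n" "t * real n < real k + 1" unfolding k_def by linarith+
      have "t * real n < 1 * real n" using t False n(1) by (intro mult_strict_right_mono) auto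
      then have "k < n" using k(1) by linarith
      moreover have "t \<in> {real k / real n..(real k + 1) / real n}"
        using k n(1) by (auto simp: field_simps)
      ultimately show ?thesis using t(3) by blast
    qed
  qed
  moreover have "L / real n \<le> \<delta>" using n(1,3) \<delta> by (simp add: field_simps)
  moreover have "(\<Sum>k<n. diameter (?U k) powr s) \<le> b"
  proof -
    have "(\<Sum>k<n. diameter (?U k) powr s) \<le> (\<Sum>k<n. (L / real n) powr s)"
      using diam s by (intro sum_mono powr_mono2) (auto intro: diameter_ge_0)
    also have "\<dots> = L powr s * real n powr (1 - s)"
      using n(1) by (simp add: L_def powr_divide powr_diff)
    finally show ?thesis using n(2) by linarith
  qed
  ultimately show ?thesis
    using diam by (intro finite_cover_family[of "{..<n}" _ ?U]) (auto intro: order_trans)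
qed

context gasket_parameter begin

text \<open>The level n is fixed first, so that the triangles are small and cost at most b / 2. Only
  finitely many joining segments remain for that n, and they can be refined further at a total cost
  of b / 2.\<close>

lemma hausdorff_measure_gasket_zero:
  assumes s: "similarity_dim < s"
  shows "hausdorff_measure s (stretched_gasket \<alpha>) = 0"
proof -
  have s1: "1 < s" using s similarity_dim_gt_1 by simp
  have q: "0 \<le> 3 * r powr s" "3 * r powr s < 1" using three_r_powr_less[OF s] by auto
  have bT: "bounded base_triangle" by (rule compact_imp_bounded[OF compact_base_triangle])
  define D where "D = diameter base_triangle"
  have D: "0 \<le> D" unfolding D_def by (rule diameter_ge_0[OF bT])
  have small: "hausdorff_premeasure s \<delta> (stretched_gasket \<alpha>) \<le> ennreal b" if \<delta>: "0 < \<delta>" and b: "0 < b" for \<delta> b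
  proof -
    have "(\<lambda>n. D powr s * (3 * r powr s) ^ n) \<longlonglongrightarrow> D powr s * 0"
      using q by (intro tendsto_mult tendsto_const LIMSEQ_power_zero) auto
    then have "\<forall>\<^sub>F n in sequentially. D powr s * (3 * r powr s) ^ n < b / 2"
      using b by (intro order_tendstoD(2)[where y = 0]) simp_all
    moreover have "(\<lambda>n. D * r ^ n) \<longlonglongrightarrow> D * 0"
      using r_bounds by (intro tendsto_mult tendsto_const LIMSEQ_power_zero) auto
    then have "\<forall>\<^sub>F n in sequentially. D * r ^ n < \<delta>"
      using \<delta> by (intro order_tendstoD(2)[where y = 0]) simp_all
    ultimately have "\<forall>\<^sub>F n in sequentially. D powr s * (3 * r powr s) ^ n < b / 2 \<and> D * r ^ n < \<delta>"
      by (rule eventually_conj)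
    from eventually_happens'[OF sequentially_bot this] obtain n where
      n: "D powr s * (3 * r powr s) ^ n < b / 2" "D * r ^ n < \<delta>" by blast
    have d: "bounded (word_map \<alpha> w ` base_triangle) \<and> diameter (word_map \<alpha> w ` base_triangle) \<le> D * r ^ n"
      if w: "w \<in> words n" for w
    proof
      have "word_map \<alpha> w ` base_triangle \<subseteq> base_triangle" using word_map_triangle[OF w] by blast
      then show "bounded (word_map \<alpha> w ` base_triangle)" using bT by (rule bounded_subset[rotated])
      have "dist (word_map \<alpha> w x) (word_map \<alpha> w y) \<le> D * r ^ n"
        if "x \<in> base_triangle" "y \<in> base_triangle" for x y
        using diameter_bounded_bound[OF bT that] r_bounds
        by (simp add: dist_word_map[OF w] D_def mult.commute)
      then show "diameter (word_map \<alpha> w ` base_triangle) \<le> D * r ^ n"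
        using D r_bounds by (intro diameter_le) (auto simp: dist_norm)
    qed
    have "finite_cover s \<delta> (\<Union>w\<in>words n. word_map \<alpha> w ` base_triangle) (b / 2)"
    proof (rule finite_cover_family[OF finite_words])
      show "bounded (word_map \<alpha> w ` base_triangle) \<and> diameter (word_map \<alpha> w ` base_triangle) \<le> \<delta>"
        if "w \<in> words n" for w using d[OF that] n(2) by auto
      have "(\<Sum>w\<in>words n. diameter (word_map \<alpha> w ` base_triangle) powr s) \<le> (\<Sum>w\<in>words n. (D * r ^ n) powr s)"
        using d s1 by (intro sum_mono powr_mono2) (auto intro: diameter_ge_0)
      also have "\<dots> = D powr s * (3 * r powr s) ^ n"
        using D r_bounds by (simp add: card_words powr_mult powr_r_power power_mult_distrib)
      finally show "(\<Sum>w\<in>words n. diameter (word_map \<alpha> w ` base_triangle) powr s) \<le> b / 2" using n(1) by linarith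
    qed simp
    moreover have "finite_cover s \<delta> (\<Union>m<n. \<Union>w\<in>words m. \<Union>j\<in>{4, 5, 6}. word_map \<alpha> w ` (gasket_map \<alpha> j ` base_triangle)) (b / 2)"
    proof (intro finite_cover_UN_null finite_words)
      fix m w and j :: nat and c :: real assume w: "w \<in> words m" and j: "j \<in> {4, 5, 6}" and c: "0 < c"
      obtain u v where "gasket_map \<alpha> j ` base_triangle = closed_segment u v" using j by (rule join_image)
      then show "finite_cover s \<delta> (word_map \<alpha> w ` (gasket_map \<alpha> j ` base_triangle)) c"
        using finite_cover_segment[OF s1 \<delta> c] by (simp add: word_map_segment[OF w])
    qed (use b in auto)
    ultimately have "finite_cover s \<delta> (stretched_gasket \<alpha>) (b / 2 + b / 2)"
      by (rule finite_cover_subset[OF finite_cover_Un gasket_cover])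
    then show ?thesis using \<delta> by (intro hausdorff_premeasure_le_finite_cover) auto
  qed
  have "hausdorff_premeasure s \<delta> (stretched_gasket \<alpha>) = 0" if "0 < \<delta>" for \<delta>
  proof -
    have "hausdorff_premeasure s \<delta> (stretched_gasket \<alpha>) \<le> 0"
      by (rule ennreal_le_epsilon) (simp add: small[OF that])
    then show ?thesis by simp
  qed
  then show ?thesis unfolding hausdorff_measure_def by simp
qed

section \<open>Lower bound by counting words\<close>

lemma words_suffix_count:
  assumes "m \<le> n" shows "card {w \<in> words n. drop (n - m) w = v} \<le> 3 ^ (n - m)"
proof -
  have "inj_on (take (n - m)) {w \<in> words n. drop (n - m) w = v}"
    by (rule inj_onI) (metis (mono_tags, lifting) append_take_drop_id mem_Collect_eq)
  moreover have "take (n - m) ` {w \<in> words n. drop (n - m) w = v} \<subseteq> words (n - m)"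
    by (auto simp: words_def dest: in_set_takeD)
  ultimately have "card {w \<in> words n. drop (n - m) w = v} \<le> card (words (n - m))"
    using finite_words by (rule card_inj_on_le)
  then show ?thesis by (simp add: card_words)
qed

text \<open>The mass distribution estimate for the uniform distribution on words. The first scale m
  below \<rho> satisfies \<rho> \<le> r^(m - 1) \<alpha> / 2 unless m = 0, so all words hitting V
  share their last m letters and at most 3^(n - m) remain. The condition on n ensures m \<le>
  n.\<close>

lemma words_count_le:
  assumes s: "0 < s" "s \<le> similarity_dim" and \<rho>: "0 < \<rho>" and n: "r ^ n * (\<alpha> / 2) < \<rho>"
    and z: "z \<in> base_triangle"
    and V: "\<And>x y. x \<in> V \<Longrightarrow> y \<in> V \<Longrightarrow> dist x y < \<rho>"
  shows "real (card {w \<in> words n. word_map \<alpha> w z \<in> V}) \<le> 3 ^ n * (\<rho> / (\<alpha> / 2)) powr s"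
proof -
  let ?W = "{w \<in> words n. word_map \<alpha> w z \<in> V}"
  define m where "m = (LEAST m. r ^ m * (\<alpha> / 2) < \<rho>)"
  have m: "r ^ m * (\<alpha> / 2) < \<rho>" unfolding m_def using n by (rule LeastI)
  have mn: "m \<le> n" unfolding m_def using n by (rule Least_le)
  have before: "\<rho> \<le> r ^ (m - 1) * (\<alpha> / 2)" if "m \<noteq> 0"
    using not_less_Least[of "m - 1" "\<lambda>m. r ^ m * (\<alpha> / 2) < \<rho>"] that by (simp add: m_def not_less)
  have "card ?W \<le> 3 ^ (n - m)"
  proof (cases "?W = {}")
    case False
    then obtain v where v: "v \<in> ?W" by blast
    have "?W \<subseteq> {w \<in> words n. drop (n - m) w = drop (n - m) v}"
    proof
      fix w assume w: "w \<in> ?W"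
      have "m = 0 \<or> dist (word_map \<alpha> w z) (word_map \<alpha> v z) < r ^ (m - 1) * (\<alpha> / 2)"
        using V[of "word_map \<alpha> w z" "word_map \<alpha> v z"] v w before by (cases "m = 0") auto
      then have "drop (n - m) w = drop (n - m) v"
        using v w mn z by (intro common_suffix[of w n v m z z]) auto
      then show "w \<in> {w \<in> words n. drop (n - m) w = drop (n - m) v}" using w by simp
    qed
    then have "card ?W \<le> card {w \<in> words n. drop (n - m) w = drop (n - m) v}"
      using finite_words by (intro card_mono) auto
    also have "\<dots> \<le> 3 ^ (n - m)" by (rule words_suffix_count[OF mn])
    finally show ?thesis .
  next
    case True
    show ?thesis unfolding True by simp
  qed
  then have "real (card ?W) \<le> real (3 ^ (n - m))" by (simp only: of_nat_le_iff)
  also have "\<dots> = 3 ^ (n - m)" by simp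
  also have "\<dots> \<le> 3 ^ n * (\<rho> / (\<alpha> / 2)) powr s"
  proof -
    \<comment> \<open>This is where s \<le> d enters: 3^(-m) \<le> r^(m s), and r^m is below \<rho>
      / (\<alpha> / 2).\<close>
    have "1 \<le> (3 * r powr s) ^ m" by (rule one_le_power[OF three_r_powr_ge[OF s(2)]])
    then have "3 ^ (n - m) * 1 \<le> 3 ^ (n - m) * (3 ^ m * (r ^ m) powr s)"
      unfolding powr_r_power by (intro mult_left_mono) (auto simp: power_mult_distrib)
    also have "\<dots> = 3 ^ n * (r ^ m) powr s"
      using mn by (simp add: mult.assoc[symmetric] flip: power_add)
    also have "\<dots> \<le> 3 ^ n * (\<rho> / (\<alpha> / 2)) powr s"
    proof (intro mult_left_mono powr_mono2)
      show "r ^ m \<le> \<rho> / (\<alpha> / 2)" using m \<alpha>_pos by (simp add: field_simps)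
    qed (use s r_bounds in auto)
    finally show ?thesis by simp
  qed
  finally show ?thesis .
qed

text \<open>The supremum over scales is bounded below at scale 1. An arbitrary cover is fattened to
  open sets at extra cost at most e and thinned to a finite one by compactness. The images of one
  point z under all 3^n words are distributed among these sets, and the counting estimate gives c =
  (\<alpha> / 2)^s as a lower bound for the cost.\<close>

lemma hausdorff_measure_gasket_pos:
  assumes s: "0 < s" "s \<le> similarity_dim"
  shows "hausdorff_measure s (stretched_gasket \<alpha>) \<noteq> 0"
proof -
  let ?K = "stretched_gasket \<alpha>"
  define c where "c = (\<alpha> / 2) powr s"
  have c: "0 < c" using \<alpha>_pos by (simp add: c_def)
  have "ennreal c \<le> hausdorff_premeasure s 1 ?K"
    unfolding hausdorff_premeasure_def
  proof (rule Inf_greatest)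
    fix t assume "t \<in> {(\<Sum>i. ennreal (diameter (U i) powr s)) | U :: nat \<Rightarrow> (real^2) set.
            ?K \<subseteq> (\<Union>i. U i) \<and> (\<forall>i. bounded (U i) \<and> diameter (U i) \<le> 1)}"
    then obtain U :: "nat \<Rightarrow> (real^2) set" where t: "t = (\<Sum>i. ennreal (diameter (U i) powr s))"
      and U: "?K \<subseteq> (\<Union>i. U i)" "\<And>i. bounded (U i)" by blast
    show "ennreal c \<le> t"
    proof (rule ennreal_le_epsilon)
      fix e :: real assume e: "0 < e"
      \<comment> \<open>Continuity from the right of the power function at the diameter; since s > 0
        this includes diameter 0. The allowances e / 2^(i + 1) sum to e.\<close>
      have "\<exists>\<eta>>0. (diameter (U i) + 2 * \<eta>) powr s \<le> diameter (U i) powr s + e * (1 / 2) ^ Suc i" for i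
      proof -
        let ?d = "diameter (U i)"
        have "0 \<le> ?d" using U(2) by (rule diameter_ge_0)
        have "((\<lambda>\<eta>. (?d + 2 * \<eta>) powr s) \<longlongrightarrow> (?d + 2 * 0) powr s) (at_right 0)"
        proof (rule tendsto_powr2)
          show "((\<lambda>\<eta>. ?d + 2 * \<eta>) \<longlongrightarrow> ?d + 2 * 0) (at_right 0)" by (intro tendsto_intros)
          show "\<forall>\<^sub>F \<eta> in at_right 0. 0 \<le> ?d + 2 * \<eta>"
            using \<open>0 \<le> ?d\<close> by (intro eventually_at_rightI[of 0 1]) auto
        qed (use s in auto)
        then have "\<forall>\<^sub>F \<eta> in at_right 0. (?d + 2 * \<eta>) powr s < ?d powr s + e * (1 / 2) ^ Suc i"
          using e by (intro order_tendstoD(2)[where y = "(?d + 2 * 0) powr s"]) auto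
        moreover have "\<forall>\<^sub>F \<eta> in at_right (0::real). 0 < \<eta>" by (rule eventually_at_right_less)
        ultimately have "\<forall>\<^sub>F \<eta> in at_right 0. 0 < \<eta> \<and> (?d + 2 * \<eta>) powr s < ?d powr s + e * (1 / 2) ^ Suc i"
          by eventually_elim simp
        from eventually_happens'[OF trivial_limit_at_right_real this] obtain \<eta> where
          "0 < \<eta> \<and> (?d + 2 * \<eta>) powr s < ?d powr s + e * (1 / 2) ^ Suc i" ..
        then show ?thesis by (intro exI[of _ \<eta>]) auto
      qed
      then have "\<forall>i. \<exists>\<eta>. 0 < \<eta> \<and> (diameter (U i) + 2 * \<eta>) powr s \<le> diameter (U i) powr s + e * (1 / 2) ^ Suc i"
        by blast
      then obtain \<eta> where
        "\<forall>i. 0 < \<eta> i \<and> (diameter (U i) + 2 * \<eta> i) powr s \<le> diameter (U i) powr s + e * (1 / 2) ^ Suc i"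
        unfolding choice_iff by blast
      then have \<eta>: "0 < \<eta> i" "(diameter (U i) + 2 * \<eta> i) powr s \<le> diameter (U i) powr s + e * (1 / 2) ^ Suc i"
        for i by auto
      define \<rho> where "\<rho> i = diameter (U i) + 2 * \<eta> i" for i
      have \<rho>: "0 < \<rho> i" for i using diameter_ge_0[OF U(2)] \<eta>(1)[of i] by (simp add: \<rho>_def add_nonneg_pos)
      define V where "V i = (\<Union>u\<in>U i. ball u (\<eta> i))" for i
      have V: "dist x y < \<rho> i" if xy: "x \<in> V i" "y \<in> V i" for x y i
      proof -
        obtain u v where uv: "u \<in> U i" "v \<in> U i" "dist u x < \<eta> i" "dist v y < \<eta> i"
          using xy unfolding V_def by auto
        have "dist u v \<le> diameter (U i)" by (rule diameter_bounded_bound[OF U(2) uv(1,2)])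
        moreover have "dist x y \<le> dist x u + dist u v + dist v y"
          using dist_triangle[of x y u] dist_triangle[of u y v] by linarith
        ultimately show ?thesis using uv(3,4) by (simp add: \<rho>_def dist_commute)
      qed
      have openV: "open (V i)" for i unfolding V_def by (intro open_UN ballI open_ball)
      have coverV: "?K \<subseteq> (\<Union>i. V i)"
      proof
        fix x assume "x \<in> ?K"
        then obtain i where "x \<in> U i" using U(1) by blast
        then have "x \<in> V i" unfolding V_def using \<eta>(1)[of i] by (intro UN_I[of x]) auto
        then show "x \<in> (\<Union>i. V i)" by blast
      qed
      obtain I where I: "finite I" "?K \<subseteq> (\<Union>i\<in>I. V i)"
        by (rule compactE_image[OF stretched_gasket(1) openV coverV])
      obtain z where z: "z \<in> ?K" using stretched_gasket(2) by blast
      then have zT: "z \<in> base_triangle" using stretched_gasket(4) by blast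
      \<comment> \<open>One word length fine enough for all sets of the finite subcover at
        once.\<close>
      have "\<exists>n. \<forall>i\<in>I. r ^ n * (\<alpha> / 2) < \<rho> i"
      proof -
        have "\<forall>\<^sub>F n in sequentially. \<forall>i\<in>I. r ^ n * (\<alpha> / 2) < \<rho> i"
        proof (intro eventually_ball_finite[OF I(1)] ballI)
          fix i
          have "(\<lambda>n. r ^ n * (\<alpha> / 2)) \<longlonglongrightarrow> 0 * (\<alpha> / 2)"
            using r_bounds by (intro tendsto_mult tendsto_const LIMSEQ_power_zero) auto
          then show "\<forall>\<^sub>F n in sequentially. r ^ n * (\<alpha> / 2) < \<rho> i"
            using \<rho>[of i] by (intro order_tendstoD(2)[where y = 0]) simp_all
        qed
        then show ?thesis by (rule eventually_happens'[OF sequentially_bot])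
      qed
      then obtain n where n: "\<And>i. i \<in> I \<Longrightarrow> r ^ n * (\<alpha> / 2) < \<rho> i" by blast
      let ?W = "\<lambda>i. {w \<in> words n. word_map \<alpha> w z \<in> V i}"
      have "words n \<subseteq> (\<Union>i\<in>I. ?W i)"
      proof
        fix w assume w: "w \<in> words n"
        have "word_map \<alpha> w z \<in> (\<Union>i\<in>I. V i)"
          by (rule subsetD[OF I(2) word_map_in_gasket[OF w z]])
        then show "w \<in> (\<Union>i\<in>I. ?W i)" using w by blast
      qed
      then have "card (words n) \<le> card (\<Union>i\<in>I. ?W i)"
        using I(1) finite_words by (intro card_mono) auto
      also have "\<dots> \<le> (\<Sum>i\<in>I. card (?W i))" by (rule card_UN_le[OF I(1)])
      finally have "3 ^ n \<le> (\<Sum>i\<in>I. card (?W i))" by (simp add: card_words)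
      then have "real (3 ^ n) \<le> real (\<Sum>i\<in>I. card (?W i))" by (simp only: of_nat_le_iff)
      then have "3 ^ n \<le> (\<Sum>i\<in>I. real (card (?W i)))" by simp
      also have "\<dots> \<le> (\<Sum>i\<in>I. 3 ^ n * (\<rho> i / (\<alpha> / 2)) powr s)"
        using V by (intro sum_mono words_count_le s \<rho> n zT)
      also have "\<dots> = 3 ^ n * ((\<Sum>i\<in>I. \<rho> i powr s) / c)"
      proof -
        have "(\<rho> i / (\<alpha> / 2)) powr s = \<rho> i powr s / c" for i
          unfolding c_def by (rule powr_divide)
        then show ?thesis by (simp only: sum_distrib_left[symmetric] sum_divide_distrib[symmetric])
      qed
      finally have "c \<le> (\<Sum>i\<in>I. \<rho> i powr s)"
        using c by (simp add: pos_le_divide_eq)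
      also have "\<dots> \<le> (\<Sum>i\<in>I. diameter (U i) powr s + e * (1 / 2) ^ Suc i)"
        unfolding \<rho>_def by (intro sum_mono \<eta>)
      also have "\<dots> = (\<Sum>i\<in>I. diameter (U i) powr s) + e * (\<Sum>i\<in>I. (1 / 2) ^ Suc i)"
        by (simp add: sum.distrib sum_distrib_left)
      also have "(\<Sum>i\<in>I. (1 / 2 :: real) ^ Suc i) \<le> 1"
        using sum_le_suminf[OF sums_summable[OF power_half_series] I(1)] sums_unique[OF power_half_series]
        by simp
      then have "(\<Sum>i\<in>I. diameter (U i) powr s) + e * (\<Sum>i\<in>I. (1 / 2) ^ Suc i) \<le>
          (\<Sum>i\<in>I. diameter (U i) powr s) + e"
        using e by (simp add: mult_left_le)
      finally have "ennreal c \<le> ennreal ((\<Sum>i\<in>I. diameter (U i) powr s) + e)" by (rule ennreal_leI)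
      also have "\<dots> = (\<Sum>i\<in>I. ennreal (diameter (U i) powr s)) + ennreal e"
        using e by (simp add: ennreal_plus sum_nonneg)
      also have "\<dots> \<le> t + ennreal e"
        unfolding t using I(1) by (intro add_right_mono sum_le_suminf) auto
      finally show "ennreal c \<le> t + ennreal e" .
    qed
  qed
  also have "\<dots> \<le> hausdorff_measure s ?K"
    unfolding hausdorff_measure_def by (rule SUP_upper) simp
  finally show ?thesis using c by auto
qed

theorem hausdorff_dimension_gasket: "hausdorff_dimension (stretched_gasket \<alpha>) = ereal similarity_dim"
proof -
  have "0 < s \<and> hausdorff_measure s (stretched_gasket \<alpha>) = 0 \<longleftrightarrow> similarity_dim < s" for s
    using hausdorff_measure_gasket_zero[of s] hausdorff_measure_gasket_pos[of s] similarity_dim_gt_1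
    by (cases "similarity_dim < s") auto
  then show ?thesis unfolding hausdorff_dimension_def by (simp only: Inf_ereal_greater)
qed

end

theorem corollary5p2:
  fixes \<alpha> :: real
    and \<epsilon> :: "nat \<Rightarrow> (real^2) set"
    and R :: "nat \<Rightarrow> real \<Rightarrow> real^2"
  assumes "0 < \<alpha>" and "\<alpha> < 1 / 3"
    and "bij_betw \<epsilon> UNIV (gasket_edges \<alpha>)"
    and "\<And>j. arclength_param (\<epsilon> j) (R j)"
  shows "spectral_dimension (gasket_triple \<alpha> \<epsilon> R) = ereal (ln 3 / (ln 2 - ln (1 - \<alpha>))) \<and>
         hausdorff_dimension (stretched_gasket \<alpha>) = ereal (ln 3 / (ln 2 - ln (1 - \<alpha>)))"
proof -
  interpret gasket_parameter \<alpha> by unfold_locales fact+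
  show ?thesis
    using spectral_dimension_gasket[OF assms(3), of R] hausdorff_dimension_gasket
    by (simp add: similarity_dim_def)
qed

end
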